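(* Let $0<a<1$, $\alpha>-1$, $\phi(z)=az+(1-a)$ and $n\in\mathbb{N}\cup\{0\}$. Let $\widetilde{C_\phi}^{(n)}$ be the $n$th iterated Aluthge transform of the composition operator $C_\phi$ on $\mathcal{A}_\alpha^2(\mathbb{D})$. Then: (i) $0$ lies in the interior of the numerical range $W(\widetilde{C_\phi}^{(n)})$; (ii) $\|\widetilde{C_\phi}^{(n)}\|=\dfrac{1}{a^{(\alpha+2)/2}}$, and $\widetilde{C_\phi}^{(n)}$ is normaloid, hence spectraloid.
   Context: $\mathbb{D}$ is the open unit disk in $\mathbb{C}$. For $\alpha>-1$, the weighted Bergman space $\mathcal{A}_\alpha^2(\mathbb{D})$ is the Hilbert space of analytic functions $f(z)=\sum_{n\ge0}a_nz^n$ on $\mathbb{D}$ with $\sum_n \frac{n!\,\Gamma(\alpha+2)}{\Gamma(n+\alpha+2)}|a_n|^2<\infty$, with inner product $\langle \sum a_nz^n,\sum b_nz^n\rangle=\sum_{n}\frac{n!\,\Gamma(\alpha+2)}{\Gamma(n+\alpha+2)}a_n\overline{b_n}$. For an analytic self-map $\phi$ of $\mathbb{D}$, $C_\phi h=h\circ\phi$, a bounded operator on $\mathcal{A}_\alpha^2(\mathbb{D})$. For a bounded operator $T$ on a Hilbert space $H$, let $|T|=(T^*T)^{1/2}$ and let $T=U|T|$ be the polar decomposition, $U$ being the partial isometry with $\ker U=\ker T=\ker|T|$. The Aluthge transform of $T$ is $\widetilde{T}=|T|^{1/2}U|T|^{1/2}$. The iterated Aluthge transforms are $\widetilde{T}^{(0)}=T$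 and $\widetilde{T}^{(n+1)}=\widetilde{(\widetilde{T}^{(n)})}$ for every integer $n\ge0$. The numerical range is $W(T)=\{\langle Tx,x\rangle:x\in H,\ \|x\|=1\}$ (interior taken in $\mathbb{C}$), the numerical radius is $w(T)=\sup\{|\lambda|:\lambda\in W(T)\}$, and $r(T)$ is the spectral radius. $T$ is normaloid if $\|T\|=r(T)$ and spectraloid if $r(T)=w(T)$. *)

theory Defs
  imports "HOL-Complex_Analysis.Complex_Analysis" "HOL-Library.FuncSet"
begin

text \<open>
  A Hilbert space here is a set of complex-valued functions on a type, with the pointwise vector
  space operations, together with an inner product that is linear in the first argument. The
  weighted Bergman spaces depend on a real parameter, so they are given by carrier sets rather than
  by types. Operators are extensional functions on the carrier, so that two operators are
  equal as soon as they agree on the carrier.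
\<close>

record 'x fun_hilbert =
  hset :: "('x \<Rightarrow> complex) set"
  hinner :: "('x \<Rightarrow> complex) \<Rightarrow> ('x \<Rightarrow> complex) \<Rightarrow> complex"

type_synonym 'x fun_op = "('x \<Rightarrow> complex) \<Rightarrow> ('x \<Rightarrow> complex)"

definition hnorm :: "'x fun_hilbert \<Rightarrow> ('x \<Rightarrow> complex) \<Rightarrow> real" where
  "hnorm H f = sqrt (Re (hinner H f f))"

definition bounded_ops :: "'x fun_hilbert \<Rightarrow> 'x fun_op set" where
  "bounded_ops H = {T \<in> hset H \<rightarrow>\<^sub>E hset H.
     (\<forall>f\<in>hset H. \<forall>g\<in>hset H. T (\<lambda>x. f x + g x) = (\<lambda>x. T f x + T g x)) \<and>
     (\<forall>c. \<forall>f\<in>hset H. T (\<lambda>x. c * f x) = (\<lambda>x. c * T f x)) \<and>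
     (\<exists>K. \<forall>f\<in>hset H. hnorm H (T f) \<le> K * hnorm H f)}"

definition op_norm :: "'x fun_hilbert \<Rightarrow> 'x fun_op \<Rightarrow> real" where
  "op_norm H T = (SUP f\<in>{f \<in> hset H. hnorm H f \<le> 1}. hnorm H (T f))"

definition op_kernel :: "'x fun_hilbert \<Rightarrow> 'x fun_op \<Rightarrow> ('x \<Rightarrow> complex) set" where
  "op_kernel H T = {f \<in> hset H. T f = (\<lambda>x. 0)}"

definition adjoint_op :: "'x fun_hilbert \<Rightarrow> 'x fun_op \<Rightarrow> 'x fun_op" where
  "adjoint_op H T = (THE S. S \<in> bounded_ops H \<and>
     (\<forall>f\<in>hset H. \<forall>g\<in>hset H. hinner H (T f) g = hinner H f (S g)))"

definition positive_op :: "'x fun_hilbert \<Rightarrow> 'x fun_op \<Rightarrow> bool" where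
  "positive_op H P \<longleftrightarrow> P \<in> bounded_ops H \<and>
     (\<forall>f\<in>hset H. hinner H (P f) f \<in> \<real>\<^sub>\<ge>\<^sub>0)"

definition sqrt_op :: "'x fun_hilbert \<Rightarrow> 'x fun_op \<Rightarrow> 'x fun_op" where
  "sqrt_op H P = (THE S. positive_op H S \<and> compose (hset H) S S = P)"

definition abs_op :: "'x fun_hilbert \<Rightarrow> 'x fun_op \<Rightarrow> 'x fun_op" where
  "abs_op H T = sqrt_op H (compose (hset H) (adjoint_op H T) T)"

definition partial_isometry :: "'x fun_hilbert \<Rightarrow> 'x fun_op \<Rightarrow> bool" where
  "partial_isometry H U \<longleftrightarrow> U \<in> bounded_ops H \<and>
     (\<forall>f\<in>hset H. (\<forall>g\<in>op_kernel H U. hinner H f g = 0) \<longrightarrow> hnorm H (U f) = hnorm H f)"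

definition polar_op :: "'x fun_hilbert \<Rightarrow> 'x fun_op \<Rightarrow> 'x fun_op" where
  "polar_op H T = (THE U. partial_isometry H U \<and>
     op_kernel H U = op_kernel H T \<and> op_kernel H U = op_kernel H (abs_op H T) \<and>
     T = compose (hset H) U (abs_op H T))"

definition aluthge :: "'x fun_hilbert \<Rightarrow> 'x fun_op \<Rightarrow> 'x fun_op" where
  "aluthge H T = compose (hset H) (sqrt_op H (abs_op H T))
     (compose (hset H) (polar_op H T) (sqrt_op H (abs_op H T)))"

definition iterated_aluthge :: "'x fun_hilbert \<Rightarrow> nat \<Rightarrow> 'x fun_op \<Rightarrow> 'x fun_op" where
  "iterated_aluthge H n T = (aluthge H ^^ n) T"

definition numerical_range :: "'x fun_hilbert \<Rightarrow> 'x fun_op \<Rightarrow> complex set" where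
  "numerical_range H T = {hinner H (T f) f | f. f \<in> hset H \<and> hnorm H f = 1}"

definition numerical_radius :: "'x fun_hilbert \<Rightarrow> 'x fun_op \<Rightarrow> real" where
  "numerical_radius H T = (SUP l\<in>numerical_range H T. cmod l)"

definition op_spectrum :: "'x fun_hilbert \<Rightarrow> 'x fun_op \<Rightarrow> complex set" where
  "op_spectrum H T = {l. \<not> (\<exists>S\<in>bounded_ops H. \<forall>f\<in>hset H.
     S (\<lambda>x. T f x - l * f x) = f \<and> (\<lambda>x. T (S f) x - l * S f x) = f)}"

definition spectral_radius_op :: "'x fun_hilbert \<Rightarrow> 'x fun_op \<Rightarrow> real" where
  "spectral_radius_op H T = (SUP l\<in>op_spectrum H T. cmod l)"

definition normaloid :: "'x fun_hilbert \<Rightarrow> 'x fun_op \<Rightarrow> bool" where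
  "normaloid H T \<longleftrightarrow> op_norm H T = spectral_radius_op H T"

definition spectraloid :: "'x fun_hilbert \<Rightarrow> 'x fun_op \<Rightarrow> bool" where
  "spectraloid H T \<longleftrightarrow> spectral_radius_op H T = numerical_radius H T"

definition bergman_weight :: "real \<Rightarrow> nat \<Rightarrow> real" where
  "bergman_weight \<alpha> n = fact n * Gamma (\<alpha> + 2) / Gamma (real n + \<alpha> + 2)"

text \<open>
  Functions on the disk are represented by total functions vanishing off the disk, which makes
  the representation unique and compatible with the pointwise operations.
\<close>

definition bergman :: "real \<Rightarrow> complex fun_hilbert" where
  "bergman \<alpha> = \<lparr>
     hset = {f. f holomorphic_on ball 0 1 \<and> (\<forall>z. z \<notin> ball 0 1 \<longrightarrow> f z = 0) \<and>
       summable (\<lambda>n. bergman_weight \<alpha> n * (cmod (fps_nth (fps_expansion f 0) n))\<^sup>2)},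
     hinner = (\<lambda>f g. \<Sum>n. of_real (bergman_weight \<alpha> n) *
       fps_nth (fps_expansion f 0) n * cnj (fps_nth (fps_expansion g 0) n))\<rparr>"

definition composition_op :: "real \<Rightarrow> (complex \<Rightarrow> complex) \<Rightarrow> complex fun_op" where
  "composition_op \<alpha> \<phi> =
     (\<lambda>h\<in>hset (bergman \<alpha>). \<lambda>z. if z \<in> ball 0 1 then h (\<phi> z) else 0)"

end

theory Submission
  imports Defs "HOL-Library.Function_Algebras"
begin

text \<open>
  Put \<open>s = \<alpha> + 2\<close> and pass from the disc to the half-plane \<open>Re u > 1/2\<close> by \<open>u = 1 / (1 - z)\<close>,
  replacing \<open>f\<close> by its transform \<open>F u = u powr (- s) * f (1 - 1 / u)\<close>. The map \<open>\<phi>\<close> fixes the point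
  \<open>1\<close>, which is sent to infinity, so it becomes the dilation \<open>u \<mapsto> u / a\<close>. The affine maps
  \<open>u \<mapsto> b * u + d\<close> of the half-plane into itself act by \<open>F u \<mapsto> b powr (s / 2) * F (b * u + d)\<close>, and
  these operators are contractions which compose like the affine maps. The translations
  \<open>u \<mapsto> u + k\<close> give a semigroup \<open>P k\<close> of positive injective operators, and the affine map with slope
  \<open>1 / a\<close> which preserves the boundary line \<open>Re u = 1/2\<close> gives a unitary \<open>D\<close> with
  \<open>D (P k f) = P (a * k) (D f)\<close>. With \<open>c = a powr (- s / 2)\<close>,
  \<open>C\<^sub>\<phi> = c P ((1 - a) / 2) D\<close>.

  For an operator \<open>T k = c P k D\<close> everything in the Aluthge transform is explicit: the
  adjoint of \<open>T k\<close> times \<open>T k\<close> is \<open>c\<^sup>2 P (2 k / a)\<close>, hence the modulus is \<open>c P (k / a)\<close>, the partial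
  isometry is \<open>D\<close>, and the transform is \<open>T (k * (1 + a) / (2 * a))\<close> (lemma \<open>aluthge_T\<close>). So every
  iterate is again some \<open>T k\<close>, of norm at most \<open>c\<close>. Moreover
  \<open>T (k + (1 - a) * e) (P e f) = P e (T k f)\<close>, so the injective operator \<open>P e\<close>, for the right \<open>e\<close>,
  carries eigenvectors of \<open>C\<^sub>\<phi>\<close> to eigenvectors of the iterate with the same eigenvalue
  (\<open>iterated_aluthge_eigenvector\<close>). The powers \<open>(1 - z) powr q\<close> with \<open>Re q > - s / 2\<close> lie in the
  space and are eigenvectors of \<open>C\<^sub>\<phi>\<close> for \<open>a powr q\<close>, and these numbers fill the punctured disc
  of radius \<open>c\<close>.

  An operator whose norm is at most \<open>c\<close>, and for which the nonzero numbers of modulus less than \<open>c\<close>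
  are all eigenvalues, has norm, spectral radius and numerical radius \<open>c\<close>, and \<open>0\<close> is interior to
  its numerical range (\<open>disc_of_eigenvalues\<close>); this is the claim.

  Two steps need analysis. That the square root of a positive operator is unique
  (\<open>positive_sqrt_unique\<close>) follows from an estimate for the norm of the difference of two roots. That the
  affine maps act by contractions is a comparison of kernels: on a linear combination of
  reproducing kernels the norm is a quadratic form in the values \<open>x powr (- s)\<close>, its image
  has the same form with \<open>x\<close> replaced by \<open>x + k\<close> for some \<open>k \<ge> 0\<close>, and the binomial series writes
  \<open>x powr (- s)\<close> as \<open>(x + k) powr (- s)\<close> plus positive multiples of
  \<open>(x + k) powr (- s - n)\<close>, which are positive definite because they are Gram matrices in the
  Bergman spaces with parameters \<open>\<alpha> + n\<close> (\<open>gram_antimono\<close>). Density of the kernels and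
  completeness do the rest.
\<close>

section \<open>Pre-Hilbert spaces of functions\<close>

text \<open>
  Together with the pointwise instances of the algebraic classes for functions, this scalar
  multiplication allows calculations in the carrier without mentioning points.
\<close>
definition scl :: "complex \<Rightarrow> ('x \<Rightarrow> complex) \<Rightarrow> 'x \<Rightarrow> complex" (infixr "*\<^sub>c" 75) where
  "c *\<^sub>c f = (\<lambda>x. c * f x)"

lemma scl_simps:
  "c *\<^sub>c (f + g) = c *\<^sub>c f + c *\<^sub>c g" "c *\<^sub>c (f - g) = c *\<^sub>c f - c *\<^sub>c g"
  "c *\<^sub>c (d *\<^sub>c f) = (c * d) *\<^sub>c f" "1 *\<^sub>c f = f" "0 *\<^sub>c f = 0" "c *\<^sub>c 0 = 0"
  by (simp_all add: scl_def fun_eq_iff algebra_simps)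

lemma minus_one_scl: "(- 1) *\<^sub>c f = - f"
  by (simp add: scl_def fun_eq_iff)

lemma scl_eq_0_iff: "c *\<^sub>c f = 0 \<longleftrightarrow> c = 0 \<or> f = 0"
  by (auto simp: scl_def fun_eq_iff)

text \<open>
  A carrier instead of a type, because the spaces depend on a real parameter. The vector operations
  are the pointwise ones, so only closure and the laws of the inner product have to be required.
\<close>
locale prehilbert =
  fixes H :: "'x fun_hilbert"
  assumes zero_closed [simp, intro]: "0 \<in> hset H"
    and add_closed [simp, intro]: "f \<in> hset H \<Longrightarrow> g \<in> hset H \<Longrightarrow> f + g \<in> hset H"
    and scl_closed [simp, intro]: "f \<in> hset H \<Longrightarrow> c *\<^sub>c f \<in> hset H"
    and inner_add_left: "f \<in> hset H \<Longrightarrow> g \<in> hset H \<Longrightarrow> h \<in> hset H \<Longrightarrow>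
      hinner H (f + g) h = hinner H f h + hinner H g h"
    and inner_scl_left: "f \<in> hset H \<Longrightarrow> h \<in> hset H \<Longrightarrow> hinner H (c *\<^sub>c f) h = c * hinner H f h"
    and inner_cnj: "f \<in> hset H \<Longrightarrow> g \<in> hset H \<Longrightarrow> hinner H g f = cnj (hinner H f g)"
    and inner_nonneg: "f \<in> hset H \<Longrightarrow> 0 \<le> Re (hinner H f f)"
    and inner_definite: "f \<in> hset H \<Longrightarrow> Re (hinner H f f) = 0 \<Longrightarrow> f = 0"
begin

abbreviation "car \<equiv> hset H"
abbreviation "ip \<equiv> hinner H"
abbreviation "nrm \<equiv> hnorm H"

lemma uminus_closed [simp, intro]: "f \<in> car \<Longrightarrow> - f \<in> car"
  using scl_closed[of f "-1"] by (simp add: minus_one_scl)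

lemma diff_closed [simp, intro]: "f \<in> car \<Longrightarrow> g \<in> car \<Longrightarrow> f - g \<in> car"
  using add_closed[of f "- g"] by simp

lemma sum_closed: "(\<And>i. i \<in> I \<Longrightarrow> f i \<in> car) \<Longrightarrow> sum f I \<in> car"
  by (induction I rule: infinite_finite_induct) auto

lemma inner_uminus_left: "f \<in> car \<Longrightarrow> h \<in> car \<Longrightarrow> ip (- f) h = - ip f h"
  using inner_scl_left[of f h "-1"] by (simp add: minus_one_scl)

lemma inner_diff_left: "f \<in> car \<Longrightarrow> g \<in> car \<Longrightarrow> h \<in> car \<Longrightarrow> ip (f - g) h = ip f h - ip g h"
  using inner_add_left[of f "- g" h] by (simp add: inner_uminus_left)

lemma inner_zero_left [simp]: "h \<in> car \<Longrightarrow> ip 0 h = 0"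
  using inner_diff_left[of h h h] by simp

lemma inner_add_right: "f \<in> car \<Longrightarrow> g \<in> car \<Longrightarrow> h \<in> car \<Longrightarrow> ip h (f + g) = ip h f + ip h g"
  using inner_cnj[of "f + g" h] inner_cnj[of f h] inner_cnj[of g h] by (simp add: inner_add_left)

lemma inner_diff_right: "f \<in> car \<Longrightarrow> g \<in> car \<Longrightarrow> h \<in> car \<Longrightarrow> ip h (f - g) = ip h f - ip h g"
  using inner_cnj[of "f - g" h] inner_cnj[of f h] inner_cnj[of g h] by (simp add: inner_diff_left)

lemma inner_scl_right: "f \<in> car \<Longrightarrow> h \<in> car \<Longrightarrow> ip h (c *\<^sub>c f) = cnj c * ip h f"
  using inner_cnj[of "c *\<^sub>c f" h] inner_cnj[of f h] by (simp add: inner_scl_left)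

lemma inner_zero_right [simp]: "h \<in> car \<Longrightarrow> ip h 0 = 0"
  using inner_diff_right[of h h h] by simp

lemmas inner_simps = inner_add_left inner_diff_left inner_scl_left
  inner_add_right inner_diff_right inner_scl_right

lemma inner_sum_left:
  "(\<And>i. i \<in> I \<Longrightarrow> f i \<in> car) \<Longrightarrow> g \<in> car \<Longrightarrow> ip (sum f I) g = (\<Sum>i\<in>I. ip (f i) g)"
  by (induction I rule: infinite_finite_induct) (auto simp: inner_add_left sum_closed)

lemma inner_sum_right:
  "(\<And>i. i \<in> I \<Longrightarrow> f i \<in> car) \<Longrightarrow> g \<in> car \<Longrightarrow> ip g (sum f I) = (\<Sum>i\<in>I. ip g (f i))"
  by (induction I rule: infinite_finite_induct) (auto simp: inner_add_right sum_closed)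

lemma nrm_nonneg [simp]: "f \<in> car \<Longrightarrow> 0 \<le> nrm f"
  by (simp add: hnorm_def inner_nonneg)

lemma nrm_sq: "f \<in> car \<Longrightarrow> (nrm f)\<^sup>2 = Re (ip f f)"
  by (simp add: hnorm_def inner_nonneg)

lemma inner_self: "f \<in> car \<Longrightarrow> ip f f = of_real ((nrm f)\<^sup>2)"
proof -
  assume f: "f \<in> car"
  have "Im (ip f f) = 0"
    using arg_cong[where f = Im, OF inner_cnj[OF f f]] by simp
  then show ?thesis using nrm_sq[OF f] by (simp add: complex_eq_iff)
qed

lemma nrm_eq_0_iff: "f \<in> car \<Longrightarrow> nrm f = 0 \<longleftrightarrow> f = 0"
  using inner_definite[of f] nrm_sq[of f] by auto

lemma nrm_zero [simp]: "nrm 0 = 0"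
  by (simp add: nrm_eq_0_iff)

lemma nrm_scl: "f \<in> car \<Longrightarrow> nrm (c *\<^sub>c f) = cmod c * nrm f"
proof -
  assume f: "f \<in> car"
  have "(nrm (c *\<^sub>c f))\<^sup>2 = Re ((c * cnj c) * ip f f)"
    using f by (simp add: nrm_sq inner_simps mult_ac)
  also have "\<dots> = (cmod c * nrm f)\<^sup>2"
    using f by (simp add: inner_self complex_norm_square[symmetric] power_mult_distrib
        flip: of_real_mult of_real_power)
  finally show ?thesis using f by (simp add: power2_eq_iff_nonneg)
qed

lemma nrm_uminus: "f \<in> car \<Longrightarrow> nrm (- f) = nrm f"
  using nrm_scl[of f "-1"] by (simp add: minus_one_scl)

lemma nrm_diff_commute: "f \<in> car \<Longrightarrow> g \<in> car \<Longrightarrow> nrm (f - g) = nrm (g - f)"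
  using nrm_uminus[of "f - g"] by simp

lemma nrm_add_sq:
  "f \<in> car \<Longrightarrow> g \<in> car \<Longrightarrow> (nrm (f + g))\<^sup>2 = (nrm f)\<^sup>2 + 2 * Re (ip f g) + (nrm g)\<^sup>2"
  using inner_cnj[of f g] by (simp add: nrm_sq inner_simps)

lemma nrm_diff_sq:
  "f \<in> car \<Longrightarrow> g \<in> car \<Longrightarrow> (nrm (f - g))\<^sup>2 = (nrm f)\<^sup>2 - 2 * Re (ip f g) + (nrm g)\<^sup>2"
  using inner_cnj[of f g] by (simp add: nrm_sq inner_simps)

lemma Cauchy_Schwarz:
  assumes f: "f \<in> car" and g: "g \<in> car"
  shows "cmod (ip f g) \<le> nrm f * nrm g"
proof (cases "g = 0")
  case True
  then show ?thesis using f by simp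
next
  case False
  define N where "N = (nrm g)\<^sup>2"
  have N: "N > 0" using False g nrm_eq_0_iff[OF g] by (simp add: N_def)
  define c where "c = ip f g / of_real N"
  have cc: "c * cnj (ip f g) = of_real ((cmod (ip f g))\<^sup>2 / N)"
    using complex_norm_square[of "ip f g"] by (simp add: c_def)
  have "0 \<le> (nrm (f - c *\<^sub>c g))\<^sup>2" by simp
  also have "\<dots> = (nrm f)\<^sup>2 - 2 * Re (c * cnj (ip f g)) + (cmod c)\<^sup>2 * N"
    using f g by (simp add: nrm_diff_sq nrm_scl inner_simps power_mult_distrib N_def algebra_simps)
  also have "(cmod c)\<^sup>2 * N = (cmod (ip f g))\<^sup>2 / N"
    using N by (simp add: c_def norm_divide power2_eq_square)
  finally have "0 \<le> (nrm f)\<^sup>2 - (cmod (ip f g))\<^sup>2 / N" unfolding cc by simp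
  then have "(cmod (ip f g))\<^sup>2 \<le> (nrm f * nrm g)\<^sup>2"
    using N by (simp add: field_simps N_def power_mult_distrib)
  then show ?thesis using f g by (simp add: abs_le_square_iff[symmetric])
qed

lemma Re_inner_le: "f \<in> car \<Longrightarrow> g \<in> car \<Longrightarrow> Re (ip f g) \<le> nrm f * nrm g"
  using Cauchy_Schwarz[of f g] complex_Re_le_cmod[of "ip f g"] by linarith

lemma nrm_triangle:
  assumes f: "f \<in> car" and g: "g \<in> car"
  shows "nrm (f + g) \<le> nrm f + nrm g"
proof -
  have "(nrm (f + g))\<^sup>2 \<le> (nrm f + nrm g)\<^sup>2"
    using f g Re_inner_le[OF f g] by (simp add: nrm_add_sq power2_sum)
  then show ?thesis using f g by (simp add: abs_le_square_iff[symmetric])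
qed

lemma nrm_triangle_diff: "f \<in> car \<Longrightarrow> g \<in> car \<Longrightarrow> nrm f \<le> nrm (f - g) + nrm g"
  using nrm_triangle[of "f - g" g] by simp

lemma nrm_triangle3:
  "f \<in> car \<Longrightarrow> g \<in> car \<Longrightarrow> h \<in> car \<Longrightarrow> nrm (f - h) \<le> nrm (f - g) + nrm (g - h)"
  using nrm_triangle[of "f - g" "g - h"] by simp

lemma inner_eq_0_all: "f \<in> car \<Longrightarrow> (\<And>g. g \<in> car \<Longrightarrow> ip f g = 0) \<Longrightarrow> f = 0"
  using inner_definite[of f] by simp

section \<open>Bounded operators\<close>

lemma opD:
  assumes "T \<in> bounded_ops H"
  shows op_closed: "f \<in> car \<Longrightarrow> T f \<in> car"
    and op_add: "f \<in> car \<Longrightarrow> g \<in> car \<Longrightarrow> T (f + g) = T f + T g"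
    and op_scl: "f \<in> car \<Longrightarrow> T (c *\<^sub>c f) = c *\<^sub>c T f"
    and op_ext: "T \<in> extensional car"
    and op_bound: "\<exists>K. \<forall>f\<in>car. nrm (T f) \<le> K * nrm f"
  using assms by (auto simp: bounded_ops_def plus_fun_def scl_def PiE_def)

lemma op_zero: "T \<in> bounded_ops H \<Longrightarrow> T 0 = 0"
  using op_scl[of T 0 0] by (simp only: scl_simps zero_closed)

lemma op_diff: "T \<in> bounded_ops H \<Longrightarrow> f \<in> car \<Longrightarrow> g \<in> car \<Longrightarrow> T (f - g) = T f - T g"
  using op_add[of T f "- g"] op_scl[of T g "-1"]
  by (simp only: minus_one_scl uminus_closed diff_conv_add_uminus)

lemma opI:
  assumes "\<And>f. f \<in> car \<Longrightarrow> T f \<in> car"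
    and "\<And>f g. f \<in> car \<Longrightarrow> g \<in> car \<Longrightarrow> T (f + g) = T f + T g"
    and "\<And>c f. f \<in> car \<Longrightarrow> T (c *\<^sub>c f) = c *\<^sub>c T f"
    and "\<And>f. f \<in> car \<Longrightarrow> nrm (T f) \<le> K * nrm f"
    and "T \<in> extensional car"
  shows "T \<in> bounded_ops H"
proof -
  have "\<exists>K. \<forall>f\<in>car. nrm (T f) \<le> K * nrm f" using assms(4) by blast
  then show ?thesis
    using assms(1-3,5) by (auto simp: bounded_ops_def plus_fun_def scl_def PiE_def)
qed

lemma op_eqI:
  "S \<in> bounded_ops H \<Longrightarrow> T \<in> bounded_ops H \<Longrightarrow> (\<And>f. f \<in> car \<Longrightarrow> S f = T f) \<Longrightarrow> S = T"
  by (rule extensionalityI[OF op_ext op_ext])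

lemma op_compose:
  assumes S: "S \<in> bounded_ops H" and T: "T \<in> bounded_ops H"
  shows "compose car S T \<in> bounded_ops H"
proof -
  obtain K L where K: "\<And>f. f \<in> car \<Longrightarrow> nrm (S f) \<le> K * nrm f"
    and L: "\<And>f. f \<in> car \<Longrightarrow> nrm (T f) \<le> L * nrm f"
    using op_bound[OF S] op_bound[OF T] by auto
  show ?thesis
  proof (rule opI[where K = "\<bar>K\<bar> * \<bar>L\<bar>"])
    fix f assume f: "f \<in> car"
    then have Tf: "T f \<in> car" using T by (simp add: op_closed)
    have "nrm (S (T f)) \<le> \<bar>K\<bar> * nrm (T f)"
      using K[OF Tf] mult_right_mono[OF abs_ge_self nrm_nonneg[OF Tf], of K] by linarith
    also have "\<dots> \<le> \<bar>K\<bar> * (\<bar>L\<bar> * nrm f)"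
      using L[OF f] mult_right_mono[OF abs_ge_self nrm_nonneg[OF f], of L]
      by (intro mult_left_mono) auto
    finally show "nrm (compose car S T f) \<le> \<bar>K\<bar> * \<bar>L\<bar> * nrm f"
      using f by (simp add: compose_eq mult.assoc)
  qed (simp_all add: compose_eq op_closed[OF S] op_closed[OF T] op_add[OF S] op_add[OF T]
      op_scl[OF S] op_scl[OF T])
qed

lemma op_norm_bdd: "T \<in> bounded_ops H \<Longrightarrow> bdd_above ((\<lambda>f. nrm (T f)) ` {f \<in> car. nrm f \<le> 1})"
proof -
  assume T: "T \<in> bounded_ops H"
  then obtain K where K: "\<And>f. f \<in> car \<Longrightarrow> nrm (T f) \<le> K * nrm f" using op_bound by blast
  have "nrm (T f) \<le> \<bar>K\<bar>" if "f \<in> car" "nrm f \<le> 1" for f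
  proof -
    have "K * nrm f \<le> \<bar>K\<bar> * 1" using that by (intro mult_mono) auto
    then show ?thesis using K[OF that(1)] by simp
  qed
  then show ?thesis by (auto intro!: bdd_aboveI[of _ "\<bar>K\<bar>"])
qed

lemma op_norm_nonneg: "T \<in> bounded_ops H \<Longrightarrow> 0 \<le> op_norm H T"
  unfolding op_norm_def using cSUP_upper[OF _ op_norm_bdd, of 0 T]
  by (simp add: op_zero[of T])

lemma op_norm_bound:
  assumes T: "T \<in> bounded_ops H" and f: "f \<in> car"
  shows "nrm (T f) \<le> op_norm H T * nrm f"
proof (cases "f = 0")
  case True
  then show ?thesis by (simp add: op_zero[OF T])
next
  case False
  then have n: "nrm f > 0" using f nrm_eq_0_iff[OF f] nrm_nonneg[OF f] by linarith
  define c where "c = complex_of_real (1 / nrm f)"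
  have c: "cmod c = 1 / nrm f" using n by (simp add: c_def norm_divide)
  have "nrm (T (c *\<^sub>c f)) \<le> op_norm H T" unfolding op_norm_def
    by (rule cSUP_upper[OF _ op_norm_bdd[OF T]]) (use f n c in \<open>auto simp: nrm_scl\<close>)
  also have "nrm (T (c *\<^sub>c f)) = nrm (T f) / nrm f"
    using f T by (simp add: op_scl nrm_scl op_closed c)
  finally show ?thesis using n by (simp add: field_simps)
qed

lemma op_norm_le:
  assumes K: "\<And>f. f \<in> car \<Longrightarrow> nrm (T f) \<le> K * nrm f" and "0 \<le> K"
  shows "op_norm H T \<le> K"
  unfolding op_norm_def
proof (rule cSUP_least)
  have "0 \<in> {f \<in> car. nrm f \<le> 1}" by simp
  then show "{f \<in> car. nrm f \<le> 1} \<noteq> {}" by blast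
next
  fix f assume f: "f \<in> {f \<in> car. nrm f \<le> 1}"
  then have "K * nrm f \<le> K * 1" using \<open>0 \<le> K\<close> by (intro mult_left_mono) auto
  then show "nrm (T f) \<le> K" using f K[of f] by auto
qed

section \<open>Adjoints, positive operators and their square roots\<close>

lemma adjoint_op_eqI:
  assumes S: "S \<in> bounded_ops H"
    and adj: "\<And>f g. f \<in> car \<Longrightarrow> g \<in> car \<Longrightarrow> ip (T f) g = ip f (S g)"
  shows "adjoint_op H T = S"
  unfolding adjoint_op_def
proof (rule the_equality)
  fix S' assume S': "S' \<in> bounded_ops H \<and> (\<forall>f\<in>car. \<forall>g\<in>car. ip (T f) g = ip f (S' g))"
  show "S' = S"
  proof (rule op_eqI)
    fix g assume g: "g \<in> car"
    have c: "S' g \<in> car" "S g \<in> car"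
      using op_closed[OF S g] op_closed[OF conjunct1[OF S'] g] by auto
    have "S' g - S g = 0"
    proof (rule inner_definite)
      have "ip f (S' g - S g) = 0" if f: "f \<in> car" for f
      proof -
        have "ip f (S' g) = ip f (S g)"
          using S'[THEN conjunct2, rule_format, OF f g] adj[OF f g] by (rule trans[OF sym])
        then show ?thesis using f c by (simp add: inner_diff_right)
      qed
      then show "Re (ip (S' g - S g) (S' g - S g)) = 0" using c by simp
    qed (use c in simp)
    then show "S' g = S g" by simp
  qed (rule conjunct1[OF S'], rule S)
qed (intro conjI ballI S adj)

text \<open>
  Polarization: a sesquilinear form with real diagonal is Hermitian, as one sees at \<open>f + g\<close> and
  at \<open>f + \<i> g\<close>.
\<close>
lemma positive_op_self_adjoint:
  assumes P: "positive_op H P" and f: "f \<in> car" and g: "g \<in> car"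
  shows "ip (P f) g = ip f (P g)"
proof -
  have bd: "P \<in> bounded_ops H" and nn: "\<And>f. f \<in> car \<Longrightarrow> Im (ip (P f) f) = 0"
    using P by (simp_all add: positive_op_def complex_nonneg_Reals_iff)
  define h where "h = \<i> *\<^sub>c g"
  have c: "P f \<in> car" "P g \<in> car" "h \<in> car" using bd f g by (auto simp: op_closed h_def)
  have "Im (ip (P f) g + ip (P g) f) = 0"
    using nn[of "f + g"] nn[of f] nn[of g] f g c by (simp add: op_add[OF bd] inner_simps)
  moreover have "Im (ip (P f) h + ip (P h) f) = 0"
    using nn[of "f + h"] nn[of f] nn[of h] f c bd op_closed[OF bd c(3)]
    by (simp add: op_add[OF bd] inner_simps)
  then have "Re (ip (P g) f - ip (P f) g) = 0"
    using f g c by (simp add: h_def op_scl[OF bd] inner_simps)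
  moreover have "ip f (P g) = cnj (ip (P g) f)" using f c by (metis inner_cnj)
  ultimately show ?thesis by (simp add: complex_eq_iff)
qed

lemma positive_op_nonneg: "positive_op H P \<Longrightarrow> f \<in> car \<Longrightarrow> 0 \<le> Re (ip (P f) f)"
  by (auto simp: positive_op_def complex_nonneg_Reals_iff)

lemma positive_op_self_adjoint_Re:
  "positive_op H P \<Longrightarrow> f \<in> car \<Longrightarrow> g \<in> car \<Longrightarrow> Re (ip (P f) g) = Re (ip (P g) f)"
  using positive_op_self_adjoint[of P f g] inner_cnj[of f "P g"]
  by (metis complex_cnj_cnj cnj.simps(1) inner_cnj op_closed positive_op_def)

text \<open>
  Let \<open>D = R - S\<close> and \<open>P = R + S\<close>. Equality of the squares means \<open>P D = - D P\<close>, and positivity of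
  \<open>R\<close> and \<open>S\<close> means that the form of \<open>D\<close> lies between those of \<open>- P\<close> and \<open>P\<close>. Add the
  upper bound at \<open>D f + c f\<close> to the lower bound at \<open>D f - c f\<close>; by anticommutation the result is
  \<open>2 c \<parallel>D f\<parallel>\<^sup>2 \<le> \<langle>P f, (c\<^sup>2 - D\<^sup>2) f\<rangle>\<close>. Take for \<open>c\<close> the norm \<open>M\<close>
  of \<open>D\<close>: if \<open>f\<close> is a unit vector with \<open>\<parallel>D f\<parallel>\<close> close to \<open>M\<close>, then \<open>D\<^sup>2 f\<close> is close to \<open>M\<^sup>2 f\<close>,
  the right-hand side is close to \<open>0\<close>, and the left-hand side is close to \<open>2 M\<^sup>3\<close>. Hence \<open>M = 0\<close>.
\<close>
lemma positive_sqrt_unique: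
  assumes R: "positive_op H R" and S: "positive_op H S"
    and sq: "\<And>f. f \<in> car \<Longrightarrow> R (R f) = S (S f)"
  shows "R = S"
proof -
  have Rb: "R \<in> bounded_ops H" and Sb: "S \<in> bounded_ops H"
    using R S by (auto simp: positive_op_def)
  note Rc [simp] = op_closed[OF Rb] and Sc [simp] = op_closed[OF Sb]
  define D P where "D = (\<lambda>f\<in>car. R f - S f)" and "P = (\<lambda>f\<in>car. R f + S f)"
  have D_eq: "D f = R f - S f" and P_eq: "P f = R f + S f" if "f \<in> car" for f
    using that by (auto simp: D_def P_def)
  obtain KR KS where KR: "\<And>f. f \<in> car \<Longrightarrow> nrm (R f) \<le> KR * nrm f"
    and KS: "\<And>f. f \<in> car \<Longrightarrow> nrm (S f) \<le> KS * nrm f"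
    using op_bound[OF Rb] op_bound[OF Sb] by auto
  have Db: "D \<in> bounded_ops H"
  proof (rule opI[where K = "KR + KS"])
    fix f assume f: "f \<in> car"
    have "nrm (D f) \<le> nrm (R f) + nrm (S f)"
      using f nrm_triangle[of "R f" "- S f"] by (simp add: D_eq nrm_uminus)
    then show "nrm (D f) \<le> (KR + KS) * nrm f"
      using KR[OF f] KS[OF f] by (simp add: algebra_simps)
  qed (use Rb Sb in \<open>auto simp: D_eq op_add op_scl scl_simps\<close>, simp add: D_def)
  have Pb: "P \<in> bounded_ops H"
  proof (rule opI[where K = "KR + KS"])
    fix f assume f: "f \<in> car"
    have "nrm (P f) \<le> nrm (R f) + nrm (S f)"
      using f nrm_triangle[of "R f" "S f"] by (simp add: P_eq)
    then show "nrm (P f) \<le> (KR + KS) * nrm f"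
      using KR[OF f] KS[OF f] by (simp add: algebra_simps)
  qed (use Rb Sb in \<open>auto simp: P_eq op_add op_scl scl_simps\<close>, simp add: P_def)
  note Dc [simp] = op_closed[OF Db] and Pc [simp] = op_closed[OF Pb]
  have symD: "Re (ip (D f) g) = Re (ip (D g) f)" if "f \<in> car" "g \<in> car" for f g
    using that positive_op_self_adjoint_Re[OF R that] positive_op_self_adjoint_Re[OF S that]
    by (simp add: D_eq inner_simps)
  have symP: "Re (ip (P f) g) = Re (ip (P g) f)" if "f \<in> car" "g \<in> car" for f g
    using that positive_op_self_adjoint_Re[OF R that] positive_op_self_adjoint_Re[OF S that]
    by (simp add: P_eq inner_simps)
  have PD: "P (D f) = - D (P f)" if f: "f \<in> car" for f
    using f sq[OF f] by (simp add: P_eq D_eq op_diff[OF Rb] op_diff[OF Sb] op_add[OF Rb] op_add[OF Sb])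
  have le1: "Re (ip (D f) f) \<le> Re (ip (P f) f)" and le2: "- Re (ip (D f) f) \<le> Re (ip (P f) f)"
    if f: "f \<in> car" for f
    using f positive_op_nonneg[OF R f] positive_op_nonneg[OF S f]
    by (simp_all add: P_eq D_eq inner_simps)
  have key: "2 * c * (nrm (D f))\<^sup>2 \<le> Re (ip (P f) (of_real (c\<^sup>2) *\<^sub>c f - D (D f)))"
    if f: "f \<in> car" for f and c :: real
  proof -
    define g where "g = of_real c *\<^sub>c f"
    have g: "g \<in> car" using f by (simp add: g_def)
    have "Re (ip (D (D f + g)) (D f + g)) - Re (ip (D (D f - g)) (D f - g))
        = 2 * Re (ip (D (D f)) g) + 2 * Re (ip (D g) (D f))"
      using f g by (simp add: op_add[OF Db] op_diff[OF Db] inner_simps)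
    also have "\<dots> = 4 * Re (ip (D g) (D f))" using symD[of "D f" g] f g by simp
    also have "\<dots> = 4 * c * (nrm (D f))\<^sup>2"
      using f by (simp add: g_def op_scl[OF Db] inner_simps nrm_sq)
    finally have 1: "4 * c * (nrm (D f))\<^sup>2 =
      Re (ip (D (D f + g)) (D f + g)) - Re (ip (D (D f - g)) (D f - g))" by simp
    have 2: "Re (ip (D (D f + g)) (D f + g)) - Re (ip (D (D f - g)) (D f - g))
        \<le> Re (ip (P (D f + g)) (D f + g)) + Re (ip (P (D f - g)) (D f - g))"
      using le1[of "D f + g"] le2[of "D f - g"] f g by simp
    have 3: "Re (ip (P (D f + g)) (D f + g)) + Re (ip (P (D f - g)) (D f - g))
        = 2 * Re (ip (P (D f)) (D f)) + 2 * Re (ip (P g) g)"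
      using f g by (simp add: op_add[OF Pb] op_diff[OF Pb] inner_simps)
    have 4: "Re (ip (P (D f)) (D f)) = - Re (ip (P f) (D (D f)))"
      using f symD[of "P f" "D f"] inner_cnj[of "P f" "D (D f)"]
      by (simp add: PD inner_uminus_left)
    have 5: "Re (ip (P g) g) = Re (ip (P f) (of_real (c\<^sup>2) *\<^sub>c f))"
      using f by (simp add: g_def op_scl[OF Pb] inner_simps power2_eq_square)
    have "Re (ip (P f) (of_real (c\<^sup>2) *\<^sub>c f - D (D f))) =
        Re (ip (P f) (of_real (c\<^sup>2) *\<^sub>c f)) - Re (ip (P f) (D (D f)))"
      using f by (subst inner_diff_right) auto
    then show ?thesis using 1 2 3 4 5 by linarith
  qed
  define M where "M = op_norm H D"
  define K where "K = op_norm H P"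
  have DM: "nrm (D f) \<le> M * nrm f" if "f \<in> car" for f
    using op_norm_bound[OF Db that] by (simp add: M_def)
  have M0: "0 \<le> M" and K0: "0 \<le> K" using op_norm_nonneg Db Pb by (auto simp: M_def K_def)
  have improve: "4 * (nrm (D f))\<^sup>2 * (nrm (D f))\<^sup>2 \<le> (K * nrm f)\<^sup>2 * (M\<^sup>2 * (nrm f)\<^sup>2 - (nrm (D f))\<^sup>2)"
    if f: "f \<in> car" and M: "M > 0" for f
  proof -
    define g where "g = of_real (M\<^sup>2) *\<^sub>c f - D (D f)"
    have g: "g \<in> car" using f by (simp add: g_def)
    have "2 * M * (nrm (D f))\<^sup>2 \<le> nrm (P f) * nrm g"
      using key[OF f, of M] Re_inner_le[of "P f" g] f g by (auto simp: g_def)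
    also have "\<dots> \<le> K * nrm f * nrm g"
      using op_norm_bound[OF Pb f] f g by (intro mult_right_mono) (auto simp: K_def)
    finally have A: "(2 * M * (nrm (D f))\<^sup>2)\<^sup>2 \<le> (K * nrm f)\<^sup>2 * (nrm g)\<^sup>2"
      using M by (metis power_mono power_mult_distrib zero_le_mult_iff zero_le_power2 M0 zero_le_numeral)
    have B: "(nrm g)\<^sup>2 \<le> M\<^sup>2 * (M\<^sup>2 * (nrm f)\<^sup>2 - (nrm (D f))\<^sup>2)"
    proof -
      have "(nrm g)\<^sup>2 = (M\<^sup>2 * nrm f)\<^sup>2 - 2 * M\<^sup>2 * Re (ip f (D (D f))) + (nrm (D (D f)))\<^sup>2"
        using f by (simp add: g_def nrm_diff_sq nrm_scl inner_scl_left flip: of_real_power)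
      also have "Re (ip f (D (D f))) = (nrm (D f))\<^sup>2"
        using f symD[of "D f" f] inner_cnj[of f "D (D f)"] by (simp add: nrm_sq)
      also have "(nrm (D (D f)))\<^sup>2 \<le> (M * nrm (D f))\<^sup>2"
        using DM[of "D f"] f by (intro power_mono) auto
      finally have "(nrm g)\<^sup>2 \<le> (M\<^sup>2 * nrm f)\<^sup>2 - 2 * M\<^sup>2 * (nrm (D f))\<^sup>2 + (M * nrm (D f))\<^sup>2"
        by simp
      also have "\<dots> = M\<^sup>2 * (M\<^sup>2 * (nrm f)\<^sup>2 - (nrm (D f))\<^sup>2)"
        by (simp only: power_mult_distrib) (simp add: algebra_simps power2_eq_square)
      finally show ?thesis .
    qed
    have "M\<^sup>2 * (4 * (nrm (D f))\<^sup>2 * (nrm (D f))\<^sup>2) = (2 * M * (nrm (D f))\<^sup>2)\<^sup>2"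
      by (simp add: power2_eq_square)
    also have "\<dots> \<le> (K * nrm f)\<^sup>2 * (M\<^sup>2 * (M\<^sup>2 * (nrm f)\<^sup>2 - (nrm (D f))\<^sup>2))"
      using A mult_left_mono[OF B zero_le_power2[of "K * nrm f"]] by linarith
    also have "\<dots> = M\<^sup>2 * ((K * nrm f)\<^sup>2 * (M\<^sup>2 * (nrm f)\<^sup>2 - (nrm (D f))\<^sup>2))"
      by (rule mult.left_commute)
    finally have "M\<^sup>2 * (4 * (nrm (D f))\<^sup>2 * (nrm (D f))\<^sup>2)
        \<le> M\<^sup>2 * ((K * nrm f)\<^sup>2 * (M\<^sup>2 * (nrm f)\<^sup>2 - (nrm (D f))\<^sup>2))" .
    then show ?thesis using M by (simp only: mult_le_cancel_left_pos zero_less_power)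
  qed
  have "M = 0"
  proof (rule ccontr)
    assume "M \<noteq> 0"
    then have M: "M > 0" using M0 by simp
    \<comment> \<open>Quantitative form of the limit argument: if \<open>t = \<parallel>D f\<parallel>\<^sup>2 > M\<^sup>2 / 2\<close> for a unit vector \<open>f\<close>, then
      \<open>M\<^sup>4 \<le> 4 t\<^sup>2 \<le> (K\<^sup>2 + 1) (M\<^sup>2 - t)\<close>. So \<open>m\<close> bounds \<open>t\<close> in all cases. The summand \<open>1\<close> avoids a
      division by zero.\<close>
    define m where "m = max (M\<^sup>2 / 2) (M\<^sup>2 - M^4 / (K\<^sup>2 + 1))"
    have m: "0 \<le> m" "m < M\<^sup>2"
    proof -
      have "M ^ 4 / (K\<^sup>2 + 1) > 0" using M by (intro divide_pos_pos) (auto simp: add_nonneg_pos)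
      then show "m < M\<^sup>2" using M by (simp add: m_def)
      show "0 \<le> m" by (simp add: m_def le_max_iff_disj)
    qed
    have unit: "(nrm (D f))\<^sup>2 \<le> m" if f: "f \<in> car" and f1: "nrm f = 1" for f
    proof -
      define t where "t = (nrm (D f))\<^sup>2"
      have tM: "t \<le> M\<^sup>2" using DM[OF f] f f1 unfolding t_def by (intro power_mono) auto
      have "4 * t * t \<le> K\<^sup>2 * (M\<^sup>2 - t)" using improve[OF f M] f1 by (simp add: t_def)
      also have "\<dots> \<le> (K\<^sup>2 + 1) * (M\<^sup>2 - t)" using tM by (intro mult_right_mono) auto
      finally have i: "4 * t * t \<le> (K\<^sup>2 + 1) * (M\<^sup>2 - t)" .
      show "t \<le> m"
      proof (cases "t \<le> M\<^sup>2 / 2")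
        case False
        then have "(M\<^sup>2 / 2) * (M\<^sup>2 / 2) \<le> t * t" by (intro mult_mono) (auto simp: t_def)
        then have "M ^ 4 \<le> (K\<^sup>2 + 1) * (M\<^sup>2 - t)" using i by (simp add: power4_eq_xxxx power2_eq_square)
        then have "M ^ 4 / (K\<^sup>2 + 1) \<le> M\<^sup>2 - t"
          by (simp add: pos_divide_le_eq add_nonneg_pos mult.commute)
        then show ?thesis by (simp add: m_def)
      qed (simp add: m_def)
    qed
    have "M \<le> sqrt m" unfolding M_def
    proof (rule op_norm_le)
      fix f assume f: "f \<in> car"
      show "nrm (D f) \<le> sqrt m * nrm f"
      proof (cases "f = 0")
        case False
        then have n: "nrm f > 0" using f nrm_eq_0_iff[OF f] nrm_nonneg[OF f] by linarith
        define g where "g = of_real (1 / nrm f) *\<^sub>c f"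
        have g: "g \<in> car" "nrm g = 1" using f n by (auto simp: g_def nrm_scl norm_divide)
        have "nrm (D g) = nrm (D f) / nrm f"
          using f n by (simp add: g_def op_scl[OF Db] nrm_scl norm_divide)
        moreover have "nrm (D g) \<le> sqrt m" using unit[OF g] g by (simp add: real_le_rsqrt)
        ultimately have "nrm (D f) / nrm f \<le> sqrt m" by simp
        then show ?thesis using n by (simp add: pos_divide_le_eq)
      qed (simp add: op_zero[OF Db])
    qed (use m in simp)
    then have "M\<^sup>2 \<le> m" using m M by (metis M0 power_mono real_sqrt_pow2)
    then show False using m by simp
  qed
  show "R = S"
  proof (rule op_eqI[OF Rb Sb])
    fix f assume f: "f \<in> car"
    have "nrm (D f) = 0" using DM[OF f] f \<open>M = 0\<close> by (intro antisym) auto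
    then have "D f = 0" using f nrm_eq_0_iff[of "D f"] by simp
    then show "R f = S f" using D_eq[OF f] by simp
  qed
qed

lemma sqrt_op_eqI:
  assumes R: "positive_op H R" and "compose car R R = P"
  shows "sqrt_op H P = R"
  unfolding sqrt_op_def
proof (rule the_equality)
  fix S assume S: "positive_op H S \<and> compose car S S = P"
  show "S = R"
  proof (rule positive_sqrt_unique)
    fix f assume f: "f \<in> car"
    have "compose car S S = compose car R R" using conjunct2[OF S] assms(2) by (rule trans[OF _ sym])
    then have "compose car S S f = compose car R R f" by (rule fun_cong)
    then show "S (S f) = R (R f)" using f by (simp only: compose_eq)
  qed (rule conjunct1[OF S], rule R)
qed (rule conjI[OF assms])

end

section \<open>Aluthge transforms in a dilation semigroup\<close>

context prehilbert
begin

lemma isometry_inner: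
  assumes V: "V \<in> bounded_ops H" and iso: "\<And>f. f \<in> car \<Longrightarrow> nrm (V f) = nrm f"
    and f: "f \<in> car" and g: "g \<in> car"
  shows "ip (V f) (V g) = ip f g"
proof -
  note Vc = op_closed[OF V]
  have Re: "Re (ip (V f) (V g)) = Re (ip f g)" if f: "f \<in> car" and g: "g \<in> car" for f g
    using iso[of "f + g"] nrm_add_sq[OF f g] nrm_add_sq[OF Vc[OF f] Vc[OF g]] f g iso[OF f] iso[OF g]
    by (simp add: op_add[OF V])
  have "Im (ip (V f) (V g)) = Im (ip f g)"
    using Re[of f "\<i> *\<^sub>c g"] f g Vc by (simp add: op_scl[OF V] inner_scl_right)
  then show ?thesis using Re[OF f g] by (simp add: complex_eq_iff)
qed

end

text \<open>
  The model is \<open>L\<^sup>2(0, \<infinity>)\<close>, where \<open>P k\<close> is multiplication by \<open>exp (- k t)\<close> and \<open>D\<close> is the unitary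
  dilation \<open>h(t) \<mapsto> \<surd>a h(a t)\<close> with inverse \<open>E\<close>. Only the relations between these operators are
  kept.
\<close>
locale dilation_semigroup = prehilbert H for H :: "'x fun_hilbert" +
  fixes P :: "real \<Rightarrow> 'x fun_op" and D E :: "'x fun_op" and a c :: real
  assumes a0: "0 < a" and a1: "a < 1" and c0: "0 < c"
    and P_op: "0 \<le> k \<Longrightarrow> P k \<in> bounded_ops H"
    and P_contraction: "0 \<le> k \<Longrightarrow> f \<in> hset H \<Longrightarrow> hnorm H (P k f) \<le> hnorm H f"
    and P_adjoint: "0 \<le> k \<Longrightarrow> f \<in> hset H \<Longrightarrow> g \<in> hset H \<Longrightarrow>
      hinner H (P k f) g = hinner H f (P k g)"
    and P_P: "0 \<le> k \<Longrightarrow> 0 \<le> m \<Longrightarrow> f \<in> hset H \<Longrightarrow> P k (P m f) = P (k + m) f"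
    and P_injective: "0 \<le> k \<Longrightarrow> f \<in> hset H \<Longrightarrow> P k f = 0 \<Longrightarrow> f = 0"
    and D_op: "D \<in> bounded_ops H" and E_op: "E \<in> bounded_ops H"
    and D_contraction: "f \<in> hset H \<Longrightarrow> hnorm H (D f) \<le> hnorm H f"
    and E_contraction: "f \<in> hset H \<Longrightarrow> hnorm H (E f) \<le> hnorm H f"
    and D_E: "f \<in> hset H \<Longrightarrow> D (E f) = f" and E_D: "f \<in> hset H \<Longrightarrow> E (D f) = f"
    and D_P: "0 \<le> k \<Longrightarrow> f \<in> hset H \<Longrightarrow> D (P k f) = P (a * k) (D f)"
begin

lemmas Pc [simp] = op_closed[OF P_op]
  and Dc [simp] = op_closed[OF D_op] and Ec [simp] = op_closed[OF E_op]

lemma D_isometry: "f \<in> car \<Longrightarrow> nrm (D f) = nrm f"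
  using D_contraction[of f] E_contraction[of "D f"] by (simp add: E_D)

lemma D_adjoint: "f \<in> car \<Longrightarrow> g \<in> car \<Longrightarrow> ip (D f) g = ip f (E g)"
  using isometry_inner[OF D_op D_isometry, of f "E g"] by (simp add: D_E)

lemma E_P: "0 \<le> k \<Longrightarrow> f \<in> car \<Longrightarrow> E (P k f) = P (k / a) (E f)"
  using arg_cong[where f = E, OF D_P[of "k / a" "E f"]] a0 by (simp add: D_E E_D)

definition scaled_P :: "real \<Rightarrow> real \<Rightarrow> 'x fun_op" where
  "scaled_P r k = (\<lambda>f\<in>car. of_real r *\<^sub>c P k f)"

text \<open>
  The weighted dilations. This family contains the composition operator and is closed under the
  Aluthge transform.
\<close>
definition T :: "real \<Rightarrow> 'x fun_op" where
  "T k = (\<lambda>f\<in>car. of_real c *\<^sub>c P k (D f))"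

lemma scaled_P_eq: "f \<in> car \<Longrightarrow> scaled_P r k f = of_real r *\<^sub>c P k f"
  and T_eq: "f \<in> car \<Longrightarrow> T k f = of_real c *\<^sub>c P k (D f)"
  by (simp_all add: scaled_P_def T_def)

lemma scaled_P_op: "0 \<le> k \<Longrightarrow> scaled_P r k \<in> bounded_ops H"
proof (rule opI[where K = "\<bar>r\<bar>"])
  show "nrm (scaled_P r k f) \<le> \<bar>r\<bar> * nrm f" if "0 \<le> k" "f \<in> car" for f
    using that P_contraction[of k f] by (simp add: scaled_P_eq nrm_scl mult_left_mono)
qed (simp_all add: scaled_P_eq op_add[OF P_op] op_scl[OF P_op] scl_simps mult.commute, simp add: scaled_P_def)

lemma T_bound: "0 \<le> k \<Longrightarrow> f \<in> car \<Longrightarrow> nrm (T k f) \<le> c * nrm f"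
  using P_contraction[of k "D f"] c0 by (simp add: T_eq nrm_scl D_isometry)

lemma T_op: "0 \<le> k \<Longrightarrow> T k \<in> bounded_ops H"
  by (rule opI[where K = c], simp_all add: T_bound, simp_all add: T_eq op_add[OF P_op] op_scl[OF P_op] op_add[OF D_op]
      op_scl[OF D_op] scl_simps mult.commute) (simp add: T_def)

text \<open>
  The semigroup law provides the symmetric square root \<open>P (k / 2)\<close> of \<open>P k\<close>.
\<close>
lemma scaled_P_positive: "0 \<le> k \<Longrightarrow> 0 \<le> r \<Longrightarrow> positive_op H (scaled_P r k)"
proof -
  assume k: "0 \<le> k" and r: "0 \<le> r"
  have "ip (scaled_P r k f) f \<in> \<real>\<^sub>\<ge>\<^sub>0" if f: "f \<in> car" for f
  proof -
    have "ip (P k f) f = ip (P (k / 2) (P (k / 2) f)) f" using k f by (subst P_P) auto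
    also have "\<dots> = ip (P (k / 2) f) (P (k / 2) f)" using k f by (intro P_adjoint) auto
    also have "\<dots> = of_real ((nrm (P (k / 2) f))\<^sup>2)" using k f by (intro inner_self) auto
    finally have "ip (scaled_P r k f) f = of_real (r * (nrm (P (k / 2) f))\<^sup>2)"
      using k f by (simp add: scaled_P_eq inner_scl_left)
    then show ?thesis using r by (simp only: nonneg_Reals_of_real_iff) simp
  qed
  then show ?thesis using k by (auto simp: positive_op_def scaled_P_op)
qed

lemma sqrt_scaled_P: "0 \<le> k \<Longrightarrow> 0 \<le> r \<Longrightarrow> sqrt_op H (scaled_P r k) = scaled_P (sqrt r) (k / 2)"
proof (rule sqrt_op_eqI)
  assume k: "0 \<le> k" and r: "0 \<le> r"
  show "positive_op H (scaled_P (sqrt r) (k / 2))" using k r by (intro scaled_P_positive) auto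
  show "compose car (scaled_P (sqrt r) (k / 2)) (scaled_P (sqrt r) (k / 2)) = scaled_P r k"
  proof (rule op_eqI)
    fix f assume f: "f \<in> car"
    have "sqrt r * sqrt r = r" using r by simp
    then show "compose car (scaled_P (sqrt r) (k / 2)) (scaled_P (sqrt r) (k / 2)) f = scaled_P r k f"
      using f k by (simp add: compose_eq scaled_P_eq op_scl[OF P_op] scl_simps P_P flip: of_real_mult)
  qed (use k in \<open>auto intro!: op_compose scaled_P_op\<close>)
qed

lemma adjoint_T: "0 \<le> k \<Longrightarrow> adjoint_op H (T k) = (\<lambda>f\<in>car. of_real c *\<^sub>c E (P k f))"
proof (rule adjoint_op_eqI)
  assume k: "0 \<le> k"
  show "(\<lambda>f\<in>car. of_real c *\<^sub>c E (P k f)) \<in> bounded_ops H"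
  proof (rule opI[where K = c])
    show "nrm ((\<lambda>f\<in>car. of_real c *\<^sub>c E (P k f)) f) \<le> c * nrm f" if f: "f \<in> car" for f
      using P_contraction[OF k f] E_contraction[of "P k f"] k f c0 by (simp add: nrm_scl)
  qed (use k in \<open>simp_all add: op_add[OF P_op] op_scl[OF P_op] op_add[OF E_op]
      op_scl[OF E_op] scl_simps mult.commute\<close>)
  show "ip (T k f) g = ip f ((\<lambda>f\<in>car. of_real c *\<^sub>c E (P k f)) g)" if "f \<in> car" "g \<in> car" for f g
    using that k P_adjoint[of k "D f" g] D_adjoint[of f "P k g"]
    by (simp add: T_eq inner_scl_left inner_scl_right)
qed

lemma abs_T: "0 \<le> k \<Longrightarrow> abs_op H (T k) = scaled_P c (k / a)"
proof -
  assume k: "0 \<le> k"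
  have "compose car (adjoint_op H (T k)) (T k) = scaled_P (c\<^sup>2) (2 * k / a)"
  proof (rule extensionalityI)
    fix f assume f: "f \<in> car"
    show "compose car (adjoint_op H (T k)) (T k) f = scaled_P (c\<^sup>2) (2 * k / a) f"
      using f k by (simp add: compose_eq adjoint_T T_eq op_scl[OF P_op] op_scl[OF E_op] scl_simps
          P_P E_P E_D scaled_P_eq power2_eq_square)
  qed (simp_all add: compose_def scaled_P_def)
  then show ?thesis using k a0 c0 by (simp add: abs_op_def sqrt_scaled_P)
qed

lemma kernel_trivial:
  assumes "S \<in> bounded_ops H" and "\<And>f. f \<in> car \<Longrightarrow> S f = 0 \<Longrightarrow> f = 0"
  shows "op_kernel H S = {0}"
  using assms op_zero[OF assms(1)] by (auto simp: op_kernel_def zero_fun_def[symmetric])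

text \<open>
  All kernels are trivial, so a competing partial isometry \<open>U\<close> is an isometry, and it agrees with
  \<open>D\<close> on the range of the modulus, that is \<open>U P (k / a) = D P (k / a) = P k D\<close>. Isometries
  preserve inner products, hence \<open>U f\<close> and \<open>D f\<close> have the same
  inner product with every \<open>P k g\<close>, which is in the image of \<open>P (k / a)\<close> under both. So
  \<open>P k (U f - D f) = 0\<close>, and \<open>P k\<close> is injective.
\<close>
lemma polar_T:
  assumes k: "0 \<le> k"
  shows "polar_op H (T k) = D"
proof -
  have ka: "0 \<le> k / a" using k a0 by simp
  have kerT: "op_kernel H (T k) = {0}"
  proof (rule kernel_trivial[OF T_op[OF k]])
    fix f assume f: "f \<in> car" and "T k f = 0"
    then have "D f = 0" using k c0 P_injective[of k "D f"] by (auto simp: T_eq scl_eq_0_iff)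
    then show "f = 0" using f E_D[OF f] by (simp add: op_zero[OF E_op])
  qed
  have kerA: "op_kernel H (abs_op H (T k)) = {0}"
    unfolding abs_T[OF k]
  proof (rule kernel_trivial[OF scaled_P_op[OF ka]])
    fix f assume "f \<in> car" "scaled_P c (k / a) f = 0"
    then show "f = 0" using ka c0 P_injective[of "k / a" f] by (auto simp: scaled_P_eq scl_eq_0_iff)
  qed
  have kerD: "op_kernel H D = {0}"
  proof (rule kernel_trivial[OF D_op])
    fix f assume "f \<in> car" "D f = 0"
    then show "f = 0" using E_D[of f] by (simp add: op_zero[OF E_op])
  qed
  have T_polar: "T k = compose car D (abs_op H (T k))"
  proof (rule op_eqI[OF T_op[OF k] op_compose[OF D_op]])
    show "abs_op H (T k) \<in> bounded_ops H" using scaled_P_op[OF ka] by (simp add: abs_T[OF k])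
    fix f assume "f \<in> car"
    then show "T k f = compose car D (abs_op H (T k)) f"
      using ka a0 by (simp add: abs_T[OF k] compose_eq scaled_P_eq T_eq op_scl[OF D_op] D_P)
  qed
  show ?thesis unfolding polar_op_def
  proof (rule the_equality)
    show "partial_isometry H D \<and> op_kernel H D = op_kernel H (T k) \<and>
        op_kernel H D = op_kernel H (abs_op H (T k)) \<and> T k = compose car D (abs_op H (T k))"
      using T_polar by (simp add: kerT kerA kerD partial_isometry_def D_op D_isometry)
    fix U assume U: "partial_isometry H U \<and> op_kernel H U = op_kernel H (T k) \<and>
        op_kernel H U = op_kernel H (abs_op H (T k)) \<and> T k = compose car U (abs_op H (T k))"
    have Ub: "U \<in> bounded_ops H" using U by (simp add: partial_isometry_def)
    note Uc [simp] = op_closed[OF Ub]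
    have "op_kernel H U = {0}" using U kerT by blast
    then have Uiso: "nrm (U f) = nrm f" if "f \<in> car" for f
      using U that by (auto simp: partial_isometry_def)
    have UP: "U (P (k / a) f) = P k (D f)" if f: "f \<in> car" for f
    proof -
      have "T k f = compose car U (abs_op H (T k)) f" using U by (rule fun_cong[OF conjunct2[OF conjunct2[OF conjunct2]]])
      then have "of_real c *\<^sub>c (U (P (k / a) f) - P k (D f)) = 0"
        using f ka by (simp add: abs_T[OF k] compose_eq scaled_P_eq T_eq op_scl[OF Ub] scl_simps)
      then show ?thesis using c0 by (simp add: scl_eq_0_iff)
    qed
    show "U = D"
    proof (rule op_eqI[OF Ub D_op])
      fix f assume f: "f \<in> car"
      have "P k (U f - D f) = 0"
      proof (rule inner_eq_0_all)
        show "P k (U f - D f) \<in> car" using k f by simp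
        fix g assume g: "g \<in> car"
        have 1: "P k g = D (P (k / a) (E g))" using k g ka a0 by (simp add: D_P D_E)
        have 2: "P k g = U (P (k / a) (E g))" using UP[of "E g"] g by (simp add: D_E)
        have "ip (U f) (P k g) = ip f (P (k / a) (E g))"
          unfolding 2 using f g ka by (intro isometry_inner[OF Ub Uiso]) auto
        moreover have "ip (D f) (P k g) = ip f (P (k / a) (E g))"
          unfolding 1 using f g ka by (intro isometry_inner[OF D_op D_isometry]) auto
        ultimately show "ip (P k (U f - D f)) g = 0"
          using f g k by (simp add: P_adjoint inner_diff_left)
      qed
      then show "U f = D f" using P_injective[OF k, of "U f - D f"] f by simp
    qed
  qed
qed

text \<open>
  The factor \<open>P (k / (2 a))\<close> to the right of \<open>D\<close> becomes \<open>P (k / 2)\<close> when it is moved to the left, and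
  \<open>k / (2 a) + k / 2 = k (1 + a) / (2 a)\<close>.
\<close>
lemma aluthge_T:
  assumes k: "0 \<le> k"
  shows "aluthge H (T k) = T (k * ((1 + a) / (2 * a)))"
proof (rule extensionalityI)
  have ka: "0 \<le> k / (2 * a)" "0 \<le> k / a" using k a0 by simp_all
  have S: "sqrt_op H (abs_op H (T k)) = scaled_P (sqrt c) (k / (2 * a))"
    using sqrt_scaled_P[of "k / a" c] ka c0 by (simp add: abs_T[OF k] mult.commute)
  fix f assume f: "f \<in> car"
  have s: "sqrt c * sqrt c = c" using c0 by simp
  have e: "k / (2 * a) + a * (k / (2 * a)) = k * ((1 + a) / (2 * a))"
    by (simp add: algebra_simps add_divide_distrib)
  define x r where "x = k / (2 * a)" and "r = sqrt c"
  have x: "0 \<le> x" "0 \<le> a * x" using ka(1) a0 by (simp_all only: x_def mult_nonneg_nonneg less_imp_le)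
  have "aluthge H (T k) f = (of_real r * of_real r) *\<^sub>c P (x + a * x) (D f)"
    unfolding aluthge_def S polar_T[OF k] x_def[symmetric] r_def[symmetric]
    using f x by (simp add: compose_eq scaled_P_eq op_scl[OF D_op] op_scl[OF P_op] scl_simps D_P P_P)
  also have "x + a * x = k * ((1 + a) / (2 * a))" using e by (simp only: x_def)
  also have "complex_of_real r * of_real r = of_real c" using s by (simp only: r_def flip: of_real_mult)
  finally show "aluthge H (T k) f = T (k * ((1 + a) / (2 * a))) f"
    using f by (simp add: T_eq)
qed (simp_all add: aluthge_def compose_def T_def)

lemma iterated_aluthge_T:
  assumes k: "0 \<le> k"
  shows "iterated_aluthge H n (T k) = T (k * ((1 + a) / (2 * a)) ^ n)"
proof (induction n)
  case (Suc n)
  have "0 \<le> k * ((1 + a) / (2 * a)) ^ n" using k a0 by simp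
  from aluthge_T[OF this]
  have "iterated_aluthge H (Suc n) (T k) = T (k * ((1 + a) / (2 * a)) ^ n * ((1 + a) / (2 * a)))"
    using Suc.IH by (simp add: iterated_aluthge_def)
  also have "k * ((1 + a) / (2 * a)) ^ n * ((1 + a) / (2 * a)) = k * ((1 + a) / (2 * a)) ^ Suc n"
    by simp
  finally show ?case .
qed (simp add: iterated_aluthge_def)

text \<open>
  Moving \<open>P e\<close> across \<open>D\<close> contracts its parameter to \<open>a e\<close>; the difference \<open>(1 - a) e\<close> is absorbed
  in the weight.
\<close>
lemma T_P:
  assumes "0 \<le> k" "0 \<le> e" and f: "f \<in> car"
  shows "T (k + (1 - a) * e) (P e f) = P e (T k f)"
proof -
  have "0 \<le> (1 - a) * e" "0 \<le> a * e" using a0 a1 assms by simp_all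
  then have "T (k + (1 - a) * e) (P e f) = of_real c *\<^sub>c P (k + (1 - a) * e + a * e) (D f)"
    using assms by (simp add: T_eq D_P P_P)
  also have "k + (1 - a) * e + a * e = e + k" by (simp add: algebra_simps)
  also have "of_real c *\<^sub>c P (e + k) (D f) = P e (T k f)"
    using assms by (simp add: T_eq P_P op_scl[OF P_op])
  finally show ?thesis .
qed

lemma iterated_aluthge_eigenvector:
  assumes f: "f \<in> car" "f \<noteq> 0" and eig: "T ((1 - a) / 2) f = l *\<^sub>c f"
  shows "\<exists>g\<in>car. g \<noteq> 0 \<and> iterated_aluthge H n (T ((1 - a) / 2)) g = l *\<^sub>c g"
proof -
  \<comment> \<open>The solution of \<open>(1 - a) / 2 * ((1 + a) / (2 * a)) ^ n = (1 - a) / 2 + (1 - a) * e\<close>, which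
    matches the weight of the iterate with the one that \<open>P e\<close> produces.\<close>
  define e where "e = (((1 + a) / (2 * a)) ^ n - 1) / 2"
  have "1 \<le> (1 + a) / (2 * a)" using a0 a1 by simp
  then have e: "0 \<le> e" by (simp add: e_def one_le_power)
  have k: "0 \<le> (1 - a) / 2" using a1 by simp
  have "(1 - a) / 2 * y = (1 - a) / 2 + (1 - a) * ((y - 1) / 2)" for y :: real
    by (simp add: field_simps)
  then have "(1 - a) / 2 * ((1 + a) / (2 * a)) ^ n = (1 - a) / 2 + (1 - a) * e"
    unfolding e_def by blast
  then have "iterated_aluthge H n (T ((1 - a) / 2)) (P e f) = P e (T ((1 - a) / 2) f)"
    using T_P[OF k e f(1)] by (simp only: iterated_aluthge_T[OF k])
  also have "\<dots> = l *\<^sub>c P e f" using eig e f by (simp add: op_scl[OF P_op])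
  finally show ?thesis using P_injective[of e f] f e by (intro bexI[of _ "P e f"]) auto
qed

end

section \<open>Operators with a disc of eigenvalues\<close>

locale hilbert = prehilbert +
  assumes complete: "(\<And>n. X n \<in> hset H) \<Longrightarrow>
    (\<And>e. e > 0 \<Longrightarrow> \<exists>N. \<forall>m\<ge>N. \<forall>n\<ge>N. hnorm H (X m - X n) < e) \<Longrightarrow>
    \<exists>g\<in>hset H. (\<lambda>n. hnorm H (X n - g)) \<longlonglongrightarrow> 0"
begin

lemma geometric_convergent:
  assumes X: "\<And>n. X n \<in> car" and r: "0 \<le> r" "r < 1"
    and step: "\<And>n. nrm (X (Suc n) - X n) \<le> C * r ^ n"
  shows "\<exists>g\<in>car. (\<lambda>n. nrm (X n - g)) \<longlonglongrightarrow> 0"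
proof (rule complete[OF X])
  fix e :: real assume e: "e > 0"
  define K where "K = C / (1 - r)"
  define b where "b = (\<lambda>n. K * r ^ n)"
  have CK: "C = K * (1 - r)" using r by (simp add: K_def)
  have C: "0 \<le> C" using order_trans[OF nrm_nonneg step[of 0]] X by simp
  have le: "nrm (X (n + m) - X n) \<le> b n - b (n + m)" for n m
  proof (induction m)
    case (Suc m)
    have "nrm (X (n + Suc m) - X n) \<le> nrm (X (Suc (n + m)) - X (n + m)) + nrm (X (n + m) - X n)"
      using nrm_triangle3[of "X (Suc (n + m))" "X (n + m)" "X n"] X by simp
    also have "\<dots> \<le> C * r ^ (n + m) + (b n - b (n + m))" using Suc step[of "n + m"] by linarith
    also have "C * r ^ (n + m) = b (n + m) - b (n + Suc m)"
      by (simp add: b_def CK algebra_simps)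
    finally show ?case by simp
  qed (simp only: add_0_right diff_self nrm_zero order_refl)
  have b0: "0 \<le> b n" for n using C r by (simp add: b_def K_def)
  have "b \<longlonglongrightarrow> K * 0" unfolding b_def
    using r by (intro tendsto_intros LIMSEQ_power_zero) auto
  then have "eventually (\<lambda>n. b n < e) sequentially" using e by (auto intro: order_tendstoD)
  then obtain N where N: "\<And>n. n \<ge> N \<Longrightarrow> b n < e" by (auto simp: eventually_sequentially)
  have *: "nrm (X m - X n) < e" if "N \<le> n" "n \<le> m" for m n
    using le[of n "m - n"] b0[of m] N[of n] that by simp
  show "\<exists>N. \<forall>m\<ge>N. \<forall>n\<ge>N. nrm (X m - X n) < e"
  proof (intro exI[of _ N] allI impI)
    fix m n assume "N \<le> m" "N \<le> n"
    then show "nrm (X m - X n) < e"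
      using *[of n m] *[of m n] nrm_diff_commute[of "X m" "X n"] X by (cases "n \<le> m") auto
  qed
qed

text \<open>
  Outside the disc of radius \<open>c\<close> the equation \<open>T g - l g = f\<close> is a fixed point equation for the
  contraction \<open>g \<mapsto> (T g - f) / l\<close>; its iterates converge by completeness, and
  \<open>\<parallel>T g - l g\<parallel> \<ge> (\<bar>l\<bar> - c) \<parallel>g\<parallel>\<close> gives uniqueness and boundedness of the inverse.
\<close>
lemma not_in_spectrum:
  assumes T: "T \<in> bounded_ops H" and bd: "\<And>f. f \<in> car \<Longrightarrow> nrm (T f) \<le> c * nrm f"
    and c: "0 \<le> c" and l: "c < cmod l"
  shows "l \<notin> op_spectrum H T"
proof -
  note Tc [simp] = op_closed[OF T]
  have l0: "l \<noteq> 0" using c l by auto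
  have lower: "(cmod l - c) * nrm g \<le> nrm (T g - l *\<^sub>c g)" if g: "g \<in> car" for g
    using nrm_triangle_diff[of "l *\<^sub>c g" "T g"] bd[OF g] g nrm_diff_commute[of "T g" "l *\<^sub>c g"]
    by (simp add: nrm_scl algebra_simps)
  have inj: "g = h" if "g \<in> car" "h \<in> car" "T g - l *\<^sub>c g = T h - l *\<^sub>c h" for g h
  proof -
    have "T (g - h) - l *\<^sub>c (g - h) = (T g - l *\<^sub>c g) - (T h - l *\<^sub>c h)"
      using that by (simp add: op_diff[OF T] scl_simps algebra_simps)
    then have "T (g - h) - l *\<^sub>c (g - h) = 0" using that by simp
    then have "(cmod l - c) * nrm (g - h) \<le> 0" using lower[of "g - h"] that by simp
    then have "nrm (g - h) = 0"
      using l that by (intro antisym) (auto simp: mult_le_0_iff)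
    then show ?thesis using that nrm_eq_0_iff[of "g - h"] by simp
  qed
  have surj: "\<exists>g\<in>car. T g - l *\<^sub>c g = f" if f: "f \<in> car" for f
  proof -
    define X where "X = rec_nat 0 (\<lambda>_ g. (1 / l) *\<^sub>c (T g - f))"
    have X0: "X 0 = 0" and XS: "X (Suc n) = (1 / l) *\<^sub>c (T (X n) - f)" for n
      by (simp_all add: X_def)
    have X [simp]: "X n \<in> car" for n
    by (induction n, unfold X0 XS) (simp_all only: zero_closed scl_closed diff_closed Tc f)
    have step: "nrm (X (Suc n) - X n) \<le> (nrm (X 1)) * (c / cmod l) ^ n" for n
    proof (induction n)
      case (Suc n)
      have "X (Suc (Suc n)) - X (Suc n) = (1 / l) *\<^sub>c (T (X (Suc n)) - f) - (1 / l) *\<^sub>c (T (X n) - f)"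
        by (rule arg_cong2[of _ _ _ _ "(-)", OF XS XS])
      also have "\<dots> = (1 / l) *\<^sub>c T (X (Suc n) - X n)"
        by (simp add: op_diff[OF T] scl_def fun_eq_iff algebra_simps)
      finally have "nrm (X (Suc (Suc n)) - X (Suc n)) = nrm (T (X (Suc n) - X n)) / cmod l"
        by (simp add: nrm_scl norm_divide)
      also have "\<dots> \<le> c * nrm (X (Suc n) - X n) / cmod l"
        using bd by (intro divide_right_mono) auto
      also have "\<dots> \<le> c * (nrm (X 1) * (c / cmod l) ^ n) / cmod l"
        using c by (intro divide_right_mono mult_left_mono Suc.IH) auto
      also have "\<dots> = nrm (X 1) * (c / cmod l) ^ Suc n" by simp
      finally show ?case .
    qed (simp add: X0)
    obtain g where g: "g \<in> car" and lim: "(\<lambda>n. nrm (X n - g)) \<longlonglongrightarrow> 0"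
      using geometric_convergent[OF X _ _ step] c l by (auto simp: divide_less_eq_1)
    have "nrm ((1 / l) *\<^sub>c (T g - f) - g) \<le> 0"
    proof (rule LIMSEQ_le_const)
      show "(\<lambda>n. c / cmod l * nrm (X n - g) + nrm (X (Suc n) - g)) \<longlonglongrightarrow> 0"
        by (rule tendsto_eq_rhs[OF tendsto_add[OF tendsto_mult_left[OF lim] LIMSEQ_Suc[OF lim]]]) simp
      have "nrm ((1 / l) *\<^sub>c (T g - f) - g) \<le> c / cmod l * nrm (X n - g) + nrm (X (Suc n) - g)" for n
      proof -
        have "(1 / l) *\<^sub>c (T g - f) - X (Suc n) = (1 / l) *\<^sub>c T (g - X n)"
          using g f by (simp add: XS op_diff[OF T] scl_simps algebra_simps)
        then have "nrm ((1 / l) *\<^sub>c (T g - f) - X (Suc n)) = nrm (T (g - X n)) / cmod l"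
          using g by (simp add: nrm_scl norm_divide)
        also have "\<dots> \<le> c * nrm (g - X n) / cmod l"
          using bd[of "g - X n"] g by (intro divide_right_mono) auto
        finally show ?thesis
          using nrm_triangle3[of "(1 / l) *\<^sub>c (T g - f)" "X (Suc n)" g] g f
            nrm_diff_commute[of g "X n"] by simp
      qed
      then show "\<exists>N. \<forall>n\<ge>N. nrm ((1 / l) *\<^sub>c (T g - f) - g) \<le> c / cmod l * nrm (X n - g) + nrm (X (Suc n) - g)"
        by blast
    qed
    then have "nrm ((1 / l) *\<^sub>c (T g - f) - g) = 0"
      using g f by (intro antisym) auto
    then have "(1 / l) *\<^sub>c (T g - f) = g"
      using nrm_eq_0_iff[of "(1 / l) *\<^sub>c (T g - f) - g"] g f by simp
    then have "l *\<^sub>c ((1 / l) *\<^sub>c (T g - f)) = l *\<^sub>c g" by (rule arg_cong)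
    then have "T g - f = l *\<^sub>c g" using l0 by (simp add: fun_eq_iff scl_def)
    then have "T g x - f x = l * g x" for x by (simp add: fun_eq_iff scl_def)
    then have "T g - l *\<^sub>c g = f" by (simp add: fun_eq_iff scl_def algebra_simps)
    then show ?thesis using g by blast
  qed
  define S where "S = (\<lambda>f\<in>car. THE g. g \<in> car \<and> T g - l *\<^sub>c g = f)"
  have S_eqI: "S f = g" if "f \<in> car" "g \<in> car" "T g - l *\<^sub>c g = f" for f g
  proof -
    have "(THE g. g \<in> car \<and> T g - l *\<^sub>c g = f) = g"
    proof (rule the_equality)
      show "g \<in> car \<and> T g - l *\<^sub>c g = f" using that by blast
      fix h assume "h \<in> car \<and> T h - l *\<^sub>c h = f"
      then have h: "h \<in> car" "T h - l *\<^sub>c h = T g - l *\<^sub>c g" using that by simp_all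
      show "h = g" by (rule inj[OF h(1) that(2) h(2)])
    qed
    then show ?thesis using that by (simp only: S_def restrict_apply if_True)
  qed
  have S: "S f \<in> car" "T (S f) - l *\<^sub>c S f = f" if f: "f \<in> car" for f
  proof -
    obtain g where g: "g \<in> car" "T g - l *\<^sub>c g = f" using surj[OF f] by blast
    then show "S f \<in> car" "T (S f) - l *\<^sub>c S f = f" using S_eqI[OF f g] by auto
  qed
  have Sb: "S \<in> bounded_ops H"
  proof (rule opI[where K = "1 / (cmod l - c)"])
    fix f g assume f: "f \<in> car" and g: "g \<in> car"
    have "T (S f + S g) - l *\<^sub>c (S f + S g) = (T (S f) - l *\<^sub>c S f) + (T (S g) - l *\<^sub>c S g)"
      using S(1)[OF f] S(1)[OF g] by (simp add: op_add[OF T] scl_simps)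
    then show "S (f + g) = S f + S g" using S f g by (intro S_eqI) auto
  next
    fix f k assume f: "f \<in> car"
    have "T (k *\<^sub>c S f) - l *\<^sub>c (k *\<^sub>c S f) = k *\<^sub>c (T (S f) - l *\<^sub>c S f)"
      using S(1)[OF f] by (simp add: op_scl[OF T] scl_simps mult.commute)
    then show "S (k *\<^sub>c f) = k *\<^sub>c S f" using S f by (intro S_eqI) auto
  next
    fix f assume f: "f \<in> car"
    show "nrm (S f) \<le> 1 / (cmod l - c) * nrm f"
      using lower[OF S(1)[OF f]] S(2)[OF f] l by (simp add: field_simps)
  qed (use S in \<open>auto simp: S_def\<close>)
  have "\<exists>S\<in>bounded_ops H. \<forall>f\<in>car. S (\<lambda>x. T f x - l * f x) = f \<and> (\<lambda>x. T (S f) x - l * S f x) = f"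
  proof (intro bexI[OF _ Sb] ballI conjI)
    fix f assume f: "f \<in> car"
    have "S (T f - l *\<^sub>c f) = f" using f by (intro S_eqI) auto
    then show "S (\<lambda>x. T f x - l * f x) = f" by (simp add: fun_diff_def scl_def)
    show "(\<lambda>x. T (S f) x - l * S f x) = f" using S(2)[OF f] by (simp add: fun_diff_def scl_def)
  qed
  then show ?thesis by (simp add: op_spectrum_def)
qed

lemma eigenvalue_in_spectrum:
  assumes f: "f \<in> car" "f \<noteq> 0" and eig: "T f = l *\<^sub>c f"
  shows "l \<in> op_spectrum H T"
proof (rule ccontr)
  assume "l \<notin> op_spectrum H T"
  then obtain S where S: "S \<in> bounded_ops H" and inv: "S (\<lambda>x. T f x - l * f x) = f"
    using f unfolding op_spectrum_def by blast
  have "(\<lambda>x. T f x - l * f x) = 0" using eig by (simp add: scl_def fun_eq_iff)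
  then show False using inv f op_zero[OF S] by simp
qed

lemma Sup_between_balls:
  assumes c: "0 < c" and lo: "ball 0 c - {0} \<subseteq> A" and hi: "A \<subseteq> cball (0 :: complex) c"
  shows "(SUP l\<in>A. cmod l) = c"
proof (rule antisym)
  have "complex_of_real (c / 2) \<in> ball 0 c - {0}" using c by simp
  then have ne: "A \<noteq> {}" using lo by blast
  then show "(SUP l\<in>A. cmod l) \<le> c" using hi by (intro cSUP_least) auto
  have bdd: "bdd_above (cmod ` A)" using hi by (auto intro!: bdd_aboveI[of _ c])
  show "c \<le> (SUP l\<in>A. cmod l)"
  proof (rule dense_le_bounded[of 0])
    fix x assume x: "0 < x" "x < c"
    have "of_real x \<in> A" using lo x by (auto simp: subset_iff)
    from cSUP_upper[OF this bdd] show "x \<le> (SUP l\<in>A. cmod l)" using x by simp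
  qed (rule c)
qed

lemma eigenvalue_in_numerical_range:
  assumes T: "T \<in> bounded_ops H" and f: "f \<in> car" "f \<noteq> 0" and v: "ip (T f) f = l * ip f f"
  shows "l \<in> numerical_range H T"
proof -
  have n: "nrm f > 0" using f nrm_eq_0_iff[of f] nrm_nonneg[of f] by linarith
  define g where "g = of_real (1 / nrm f) *\<^sub>c f"
  have "g \<in> car" "nrm g = 1" using f n by (auto simp: g_def nrm_scl norm_divide)
  moreover have "ip (T g) g = l"
    using f n op_closed[OF T f(1)] v
    by (simp add: g_def op_scl[OF T] inner_scl_left inner_scl_right inner_self power2_eq_square)
  ultimately show ?thesis unfolding numerical_range_def by blast
qed

text \<open>
  Eigenvalues belong to the spectrum and to the numerical range, and both sets are contained in the
  closed disc of radius \<open>c\<close>, so that all three radii are determined. The number \<open>0\<close> need not be an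
  eigenvalue. It is in the numerical range because of two opposite eigenvalues.
\<close>
theorem disc_of_eigenvalues:
  assumes T: "T \<in> bounded_ops H" and c: "0 < c"
    and bd: "\<And>f. f \<in> car \<Longrightarrow> nrm (T f) \<le> c * nrm f"
    and eig: "\<And>l. l \<noteq> 0 \<Longrightarrow> cmod l < c \<Longrightarrow> \<exists>f\<in>car. f \<noteq> 0 \<and> T f = l *\<^sub>c f"
  shows "0 \<in> interior (numerical_range H T)" "op_norm H T = c"
    "normaloid H T" "spectraloid H T"
proof -
  note Tc [simp] = op_closed[OF T]
  have nr1: "l \<in> numerical_range H T" if "l \<noteq> 0" "cmod l < c" for l
  proof -
    from eig[OF that] obtain f where "f \<in> car" "f \<noteq> 0" "T f = l *\<^sub>c f" by blast
    then show ?thesis by (intro eigenvalue_in_numerical_range[OF T]) (auto simp: inner_scl_left)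
  qed
  have nr0: "0 \<in> numerical_range H T"
  proof -
    \<comment> \<open>If \<open>f\<close> and \<open>g\<close> are eigenvectors for \<open>l\<close> and \<open>- l\<close>, of equal norm and with real inner product,
      then \<open>\<langle>T (f + g), f + g\<rangle> = l (\<parallel>f\<parallel>\<^sup>2 - \<parallel>g\<parallel>\<^sup>2 + \<langle>f, g\<rangle> - \<langle>g, f\<rangle>) = 0\<close>. A scalar factor arranges
      both conditions, and \<open>p\<close> is its phase.\<close>
    define l where "l = complex_of_real (c / 2)"
    have l: "l \<noteq> 0" "cmod l < c" "cmod (- l) < c" using c by (auto simp: l_def)
    obtain f where f: "f \<in> car" "f \<noteq> 0" "T f = l *\<^sub>c f" using eig[OF l(1,2)] by blast
    obtain g' where g': "g' \<in> car" "g' \<noteq> 0" "T g' = (- l) *\<^sub>c g'"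
      using eig[OF _ l(3)] l(1) by auto
    have n: "nrm f > 0" "nrm g' > 0"
      using f g' nrm_eq_0_iff[of f] nrm_nonneg[of f] nrm_eq_0_iff[of g'] nrm_nonneg[of g'] by linarith+
    define p where "p = (if ip f g' = 0 then 1 else sgn (ip f g'))"
    have p: "cmod p = 1" by (simp add: p_def norm_sgn)
    define g where "g = (of_real (nrm f / nrm g') * p) *\<^sub>c g'"
    have g: "g \<in> car" "T g = (- l) *\<^sub>c g" "nrm g = nrm f"
      using g' n by (auto simp: g_def op_scl[OF T] scl_simps nrm_scl norm_mult norm_divide p mult.commute)
    have "cnj p * ip f g' = of_real (cmod (ip f g'))"
    proof (cases "ip f g' = 0")
      case False
      then have "cnj p * ip f g' = (cnj (ip f g') * ip f g') / of_real (cmod (ip f g'))"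
        by (simp add: p_def sgn_eq)
      also have "cnj (ip f g') * ip f g' = of_real ((cmod (ip f g'))\<^sup>2)"
        by (metis complex_norm_square mult.commute of_real_power)
      finally show ?thesis using False by (simp add: power2_eq_square)
    qed (simp)
    then have fg: "ip f g = of_real (nrm f / nrm g' * cmod (ip f g'))"
      using f g' by (simp add: g_def inner_scl_right mult.assoc)
    have gf: "ip g f = ip f g" using inner_cnj[OF f(1) g(1)] fg by simp
    have "f + g \<noteq> 0"
    proof
      assume s: "f + g = 0"
      then have "T (f + g) = 0" by (simp only: op_zero[OF T])
      then have "l *\<^sub>c (f - g) = 0"
        using f g by (simp add: op_add[OF T] scl_def fun_eq_iff algebra_simps)
      then have "f = g" using l by (simp add: scl_eq_0_iff)
      then have "2 *\<^sub>c f = 0" using s by (simp add: scl_def fun_eq_iff)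
      then show False using f by (simp add: scl_eq_0_iff)
    qed
    moreover have "ip (T (f + g)) (f + g) = 0"
      using f g by (simp add: op_add[OF T] inner_simps gf inner_self)
    ultimately show ?thesis using f g by (intro eigenvalue_in_numerical_range[OF T, of "f + g"]) auto
  qed
  have nrange_lo: "ball 0 c \<subseteq> numerical_range H T"
  proof
    fix l :: complex assume "l \<in> ball 0 c"
    then show "l \<in> numerical_range H T" using nr0 nr1[of l] by (cases "l = 0") auto
  qed
  have nrange_hi: "numerical_range H T \<subseteq> cball 0 c"
  proof
    fix l assume "l \<in> numerical_range H T"
    then obtain f where f: "f \<in> car" "nrm f = 1" "l = ip (T f) f" by (auto simp: numerical_range_def)
    then show "l \<in> cball 0 c" using Cauchy_Schwarz[of "T f" f] bd[of f] by simp
  qed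
  show "0 \<in> interior (numerical_range H T)"
    using nrange_lo c by (intro interiorI[of "ball 0 c"]) auto
  have spec_lo: "ball 0 c - {0} \<subseteq> op_spectrum H T"
  proof
    fix l :: complex assume "l \<in> ball 0 c - {0}"
    then obtain f where "f \<in> car" "f \<noteq> 0" "T f = l *\<^sub>c f" using eig[of l] by auto
    then show "l \<in> op_spectrum H T" by (rule eigenvalue_in_spectrum)
  qed
  have spec_hi: "op_spectrum H T \<subseteq> cball 0 c"
    using not_in_spectrum[OF T bd] c by (auto simp: subset_iff not_less[symmetric])
  have r: "spectral_radius_op H T = c" unfolding spectral_radius_op_def
    by (rule Sup_between_balls[OF c spec_lo spec_hi])
  have w: "numerical_radius H T = c" unfolding numerical_radius_def
    using nrange_lo by (intro Sup_between_balls[OF c _ nrange_hi]) auto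
  show "op_norm H T = c"
  proof (rule antisym)
    show "op_norm H T \<le> c" using bd c by (intro op_norm_le) auto
    show "c \<le> op_norm H T"
    proof (rule dense_le_bounded[of 0])
      fix x assume x: "0 < x" "x < c"
      obtain f where f: "f \<in> car" "f \<noteq> 0" "T f = of_real x *\<^sub>c f"
        using eig[of "of_real x"] x by auto
      have "nrm f > 0" using f nrm_eq_0_iff[of f] nrm_nonneg[of f] by linarith
      then show "x \<le> op_norm H T" using op_norm_bound[OF T f(1)] f x by (simp add: nrm_scl)
    qed (rule c)
  qed
  then show "normaloid H T" "spectraloid H T" by (simp_all add: normaloid_def spectraloid_def r w)
qed

end

section \<open>Weighted Bergman spaces as spaces of power series\<close>

definition coef :: "(complex \<Rightarrow> complex) \<Rightarrow> nat \<Rightarrow> complex" where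
  "coef f n = fps_nth (fps_expansion f 0) n"

lemma coef_sums:
  assumes "f holomorphic_on ball 0 1" "cmod z < 1"
  shows "(\<lambda>n. coef f n * z ^ n) sums f z"
  using holomorphic_power_series[OF assms(1), of z] assms(2) by (simp add: coef_def fps_expansion_def)

lemma coef_eqI:
  assumes "\<And>z. cmod z < 1 \<Longrightarrow> (\<lambda>n. a n * z ^ n) sums f z"
  shows "coef f = a"
proof -
  have "f has_fps_expansion Abs_fps a" unfolding has_fps_expansion_def
  proof
    have "conv_radius a \<ge> norm (1 / 2 :: complex)"
      by (rule conv_radius_geI) (use assms[of "1 / 2"] in \<open>simp add: sums_iff\<close>)
    moreover have "norm (1 / 2 :: complex) = 1 / 2" by simp
    ultimately have "ereal (1 / 2) \<le> fps_conv_radius (Abs_fps a)" by (simp add: fps_conv_radius_def)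
    then show "0 < fps_conv_radius (Abs_fps a)" by (rule less_le_trans[rotated]) simp
    have "eventually (\<lambda>z::complex. z \<in> ball 0 1) (nhds 0)" by (intro eventually_nhds_in_open) auto
    then show "\<forall>\<^sub>F z in nhds 0. eval_fps (Abs_fps a) z = f z"
      by eventually_elim (use assms in \<open>auto simp: eval_fps_def sums_iff\<close>)
  qed
  then show ?thesis by (auto simp: fun_eq_iff coef_def fps_expansion_eqI)
qed

locale bergman_space =
  fixes \<alpha> :: real
  assumes alpha: "\<alpha> > -1"
begin

definition "s = \<alpha> + 2"
abbreviation "B \<equiv> bergman \<alpha>"
abbreviation "bw \<equiv> bergman_weight \<alpha>"

lemma s_pos: "0 < s"
  using alpha by (simp add: s_def)

text \<open>
  The reciprocal weights are the coefficients of the binomial series of \<open>(1 - x) powr (- s)\<close>, which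
  is why the reproducing kernel below has a closed form.
\<close>
lemma inverse_bw: "1 / bw n = pochhammer s n / fact n"
proof -
  have "s \<notin> \<int>\<^sub>\<le>\<^sub>0" using s_pos by (auto elim!: nonpos_Ints_cases)
  from pochhammer_Gamma[OF this, of n] show ?thesis
    by (simp add: bergman_weight_def s_def add.commute add.left_commute)
qed

lemma bw_pos [simp]: "0 < bw n"
  using alpha by (simp add: bergman_weight_def Gamma_real_pos)

lemma bw_0: "bw 0 = 1"
  using inverse_bw[of 0] by simp

lemma bw_nonzero [simp]: "bw n \<noteq> 0" and bw_nonneg [simp]: "0 \<le> bw n"
  using bw_pos[of n] by linarith+

lemma gbinomial_bw: "(- complex_of_real s) gchoose n = (-1) ^ n * of_real (1 / bw n)"
proof -
  have "pochhammer (complex_of_real s) n = of_real (pochhammer s n)"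
    by (rule pochhammer_of_real)
  then show ?thesis unfolding gbinomial_pochhammer inverse_bw by simp
qed

lemma binomial_kernel_sums:
  assumes "cmod x < 1"
  shows "(\<lambda>n. of_real (1 / bw n) * x ^ n) sums (1 - x) powr (- of_real s)"
proof -
  have "(- of_real s gchoose n) * (- x) ^ n = of_real (1 / bw n) * x ^ n" for n
    unfolding gbinomial_bw by (simp add: power_minus[of x])
  then show ?thesis using gen_binomial_complex[of "- x" "- of_real s"] assms by simp
qed

lemma summable_power_div_bw: "0 \<le> r \<Longrightarrow> r < 1 \<Longrightarrow> summable (\<lambda>n. r ^ n / bw n)"
  using binomial_kernel_sums[of "of_real r"]
  by (simp add: sums_iff summable_of_real_iff flip: of_real_power of_real_mult of_real_divide)

lemma in_bergman:
  "f \<in> hset B \<longleftrightarrow> f holomorphic_on ball 0 1 \<and> (\<forall>z. \<not> cmod z < 1 \<longrightarrow> f z = 0) \<and>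
    summable (\<lambda>n. bw n * (cmod (coef f n))\<^sup>2)"
  by (auto simp: bergman_def coef_def)

lemma inner_bergman: "hinner B f g = (\<Sum>n. of_real (bw n) * coef f n * cnj (coef g n))"
  by (simp add: bergman_def coef_def)

lemma bergman_sums: "f \<in> hset B \<Longrightarrow> cmod z < 1 \<Longrightarrow> (\<lambda>n. coef f n * z ^ n) sums f z"
  by (simp add: in_bergman coef_sums)

definition of_coefs :: "(nat \<Rightarrow> complex) \<Rightarrow> complex \<Rightarrow> complex" where
  "of_coefs a z = (if cmod z < 1 then \<Sum>n. a n * z ^ n else 0)"

text \<open>
  The space is a weighted \<open>l\<^sup>2\<close> space of coefficient sequences. The power series converges in the
  disc because \<open>x y \<le> w x\<^sup>2 + y\<^sup>2 / w\<close>, applied with the weight \<open>w\<close> to \<open>x = \<bar>a n\<bar>\<close> and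
  \<open>y = \<bar>z\<bar> ^ n\<close>, bounds its terms by two summable sequences.
\<close>
lemma of_coefs:
  assumes "summable (\<lambda>n. bw n * (cmod (a n))\<^sup>2)"
  shows of_coefs_closed: "of_coefs a \<in> hset B" and coef_of_coefs: "coef (of_coefs a) = a"
proof -
  have sums: "(\<lambda>n. a n * z ^ n) sums of_coefs a z" if z: "cmod z < 1" for z
  proof -
    have "summable (\<lambda>n. a n * z ^ n)"
    proof (rule summable_comparison_test')
      have "(cmod z)\<^sup>2 < 1" using z by (simp add: abs_square_less_1)
      then have "summable (\<lambda>n. ((cmod z)\<^sup>2) ^ n / bw n)" by (intro summable_power_div_bw) auto
      with assms show "summable (\<lambda>n. bw n * (cmod (a n))\<^sup>2 + ((cmod z)\<^sup>2) ^ n / bw n)"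
        by (rule summable_add)
      fix n
      define x y where "x = cmod (a n)" and "y = cmod z ^ n"
      have "0 \<le> (bw n * x - y)\<^sup>2 / bw n" by simp
      also have "\<dots> = bw n * x\<^sup>2 - 2 * (x * y) + y\<^sup>2 / bw n"
        by (simp add: power2_eq_square field_simps)
      finally have "2 * (x * y) \<le> bw n * x\<^sup>2 + y\<^sup>2 / bw n" by simp
      moreover have "0 \<le> x * y" by (simp add: x_def y_def)
      ultimately have "x * y \<le> bw n * x\<^sup>2 + y\<^sup>2 / bw n" by linarith
      then show "norm (a n * z ^ n) \<le> bw n * (cmod (a n))\<^sup>2 + ((cmod z)\<^sup>2) ^ n / bw n"
        by (simp add: x_def y_def norm_mult norm_power power_mult[symmetric] mult.commute)
    qed
    then show ?thesis using z by (simp add: of_coefs_def summable_sums)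
  qed
  show c: "coef (of_coefs a) = a" by (rule coef_eqI) (rule sums)
  have "of_coefs a holomorphic_on ball 0 1"
    by (rule power_series_holomorphic[of 0 1 a]) (simp add: sums)
  then show "of_coefs a \<in> hset B" using assms by (simp add: in_bergman c) (simp add: of_coefs_def)
qed

lemma coef_add: "f \<in> hset B \<Longrightarrow> g \<in> hset B \<Longrightarrow> coef (f + g) n = coef f n + coef g n"
proof -
  assume f: "f \<in> hset B" and g: "g \<in> hset B"
  have "coef (f + g) = (\<lambda>n. coef f n + coef g n)"
    by (rule coef_eqI) (use bergman_sums[OF f] bergman_sums[OF g] in \<open>simp add: distrib_right sums_add\<close>)
  then show ?thesis by simp
qed

lemma coef_scl: "f \<in> hset B \<Longrightarrow> coef (c *\<^sub>c f) n = c * coef f n"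
proof -
  assume f: "f \<in> hset B"
  have "coef (c *\<^sub>c f) = (\<lambda>n. c * coef f n)"
    by (rule coef_eqI) (use bergman_sums[OF f] in \<open>simp add: scl_def mult.assoc sums_mult\<close>)
  then show ?thesis by simp
qed

lemma coef_zero: "coef 0 n = 0"
proof -
  have "coef 0 = (\<lambda>n. 0)" by (rule coef_eqI) simp
  then show ?thesis by simp
qed

lemma summable_inner:
  assumes f: "f \<in> hset B" and g: "g \<in> hset B"
  shows "summable (\<lambda>n. of_real (bw n) * coef f n * cnj (coef g n))"
proof (rule summable_comparison_test')
  show "summable (\<lambda>n. bw n * (cmod (coef f n))\<^sup>2 + bw n * (cmod (coef g n))\<^sup>2)"
    using f g by (intro summable_add) (auto simp: in_bergman)
  fix n
  define x y where "x = cmod (coef f n)" and "y = cmod (coef g n)"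
  have "2 * (x * y) \<le> x\<^sup>2 + y\<^sup>2" using sum_squares_bound[of x y] by simp
  moreover have "0 \<le> x * y" by (simp add: x_def y_def)
  ultimately have "x * y \<le> x\<^sup>2 + y\<^sup>2" by linarith
  then have "bw n * (x * y) \<le> bw n * (x\<^sup>2 + y\<^sup>2)" by (intro mult_left_mono) auto
  then show "norm (of_real (bw n) * coef f n * cnj (coef g n))
      \<le> bw n * (cmod (coef f n))\<^sup>2 + bw n * (cmod (coef g n))\<^sup>2"
    by (simp add: norm_mult x_def y_def algebra_simps)
qed

lemma inner_self_bergman:
  assumes f: "f \<in> hset B"
  shows "Re (hinner B f f) = (\<Sum>n. bw n * (cmod (coef f n))\<^sup>2)"
proof -
  have "of_real (bw n) * coef f n * cnj (coef f n) = of_real (bw n * (cmod (coef f n))\<^sup>2)" for n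
    using complex_norm_square[of "coef f n"] by (simp add: mult.assoc)
  then have "hinner B f f = of_real (\<Sum>n. bw n * (cmod (coef f n))\<^sup>2)"
    using f by (simp only: inner_bergman) (intro suminf_of_real[symmetric], simp add: in_bergman)
  then show ?thesis by simp
qed

sublocale prehilbert B
proof
  show "0 \<in> hset B" unfolding in_bergman coef_zero by (simp add: zero_fun_def)
  show add: "f + g \<in> hset B" if f: "f \<in> hset B" and g: "g \<in> hset B" for f g
  proof -
    have "summable (\<lambda>n. bw n * (cmod (coef f n + coef g n))\<^sup>2)"
    proof (rule summable_comparison_test')
      show "summable (\<lambda>n. 2 * (bw n * (cmod (coef f n))\<^sup>2) + 2 * (bw n * (cmod (coef g n))\<^sup>2))"
        using f g by (intro summable_add summable_mult) (auto simp: in_bergman)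
      fix n
      have "(cmod (coef f n + coef g n))\<^sup>2 \<le> (cmod (coef f n) + cmod (coef g n))\<^sup>2"
        by (intro power_mono norm_triangle_ineq) auto
      also have "\<dots> \<le> 2 * (cmod (coef f n))\<^sup>2 + 2 * (cmod (coef g n))\<^sup>2"
        using sum_squares_bound[of "cmod (coef f n)" "cmod (coef g n)"] by (simp add: power2_sum)
      finally have "bw n * (cmod (coef f n + coef g n))\<^sup>2
          \<le> bw n * (2 * (cmod (coef f n))\<^sup>2 + 2 * (cmod (coef g n))\<^sup>2)"
        by (intro mult_left_mono) auto
      then show "norm (bw n * (cmod (coef f n + coef g n))\<^sup>2)
        \<le> 2 * (bw n * (cmod (coef f n))\<^sup>2) + 2 * (bw n * (cmod (coef g n))\<^sup>2)"
        by (simp add: algebra_simps)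
    qed
    moreover have "(\<lambda>z. f z + g z) holomorphic_on ball 0 1"
      using f g by (intro holomorphic_intros) (auto simp: in_bergman)
    moreover have "\<forall>z. \<not> cmod z < 1 \<longrightarrow> f z + g z = 0"
      using f g by (simp add: in_bergman)
    ultimately show ?thesis
      unfolding in_bergman coef_add[OF f g] by (simp add: plus_fun_def)
  qed
  show scl: "c *\<^sub>c f \<in> hset B" if f: "f \<in> hset B" for f c
  proof -
    have "summable (\<lambda>n. (cmod c)\<^sup>2 * (bw n * (cmod (coef f n))\<^sup>2))"
      using f by (intro summable_mult) (auto simp: in_bergman)
    then have "summable (\<lambda>n. bw n * (cmod (c * coef f n))\<^sup>2)"
      by (simp add: norm_mult power_mult_distrib mult_ac)
    moreover have "(\<lambda>z. c * f z) holomorphic_on ball 0 1"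
      using f by (intro holomorphic_intros) (auto simp: in_bergman)
    moreover have "\<forall>z. \<not> cmod z < 1 \<longrightarrow> c * f z = 0"
      using f by (simp add: in_bergman)
    ultimately show ?thesis
      unfolding in_bergman coef_scl[OF f] by (simp add: scl_def)
  qed
  fix f g h :: "complex \<Rightarrow> complex" assume f: "f \<in> hset B" and h: "h \<in> hset B"
  show "hinner B (f + g) h = hinner B f h + hinner B g h" if g: "g \<in> hset B"
    unfolding inner_bergman coef_add[OF f g]
    by (subst suminf_add[OF summable_inner[OF f h] summable_inner[OF g h]]) (simp add: algebra_simps)
  show "hinner B (c *\<^sub>c f) h = c * hinner B f h" for c
    unfolding inner_bergman coef_scl[OF f]
    by (subst suminf_mult[OF summable_inner[OF f h], symmetric]) (simp add: algebra_simps)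
  have "(\<lambda>n. cnj (of_real (bw n) * coef f n * cnj (coef h n))) sums cnj (hinner B f h)"
    unfolding inner_bergman sums_cnj by (rule summable_sums[OF summable_inner[OF f h]])
  then show "hinner B h f = cnj (hinner B f h)"
    unfolding inner_bergman[of h f] by (simp add: sums_iff mult_ac)
next
  fix f :: "complex \<Rightarrow> complex" assume f: "f \<in> hset B"
  have sm: "summable (\<lambda>n. bw n * (cmod (coef f n))\<^sup>2)" using f by (simp add: in_bergman)
  show "0 \<le> Re (hinner B f f)"
    unfolding inner_self_bergman[OF f] using sm by (intro suminf_nonneg) auto
  assume "Re (hinner B f f) = 0"
  then have "\<forall>n. bw n * (cmod (coef f n))\<^sup>2 = 0"
    unfolding inner_self_bergman[OF f] using sm by (subst (asm) suminf_eq_zero_iff) auto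
  then have c: "coef f n = 0" for n by simp
  show "f = 0"
  proof
    fix z
    show "f z = 0 z"
      using bergman_sums[OF f, of z] f by (cases "cmod z < 1") (auto simp: c sums_iff in_bergman)
  qed
qed

lemma coef_diff: "f \<in> car \<Longrightarrow> g \<in> car \<Longrightarrow> coef (f - g) n = coef f n - coef g n"
  using coef_add[of "f - g" g n] by simp

lemma nrm_sq_sums: "f \<in> car \<Longrightarrow> (\<lambda>n. bw n * (cmod (coef f n))\<^sup>2) sums (nrm f)\<^sup>2"
  using inner_self_bergman[of f] by (simp add: nrm_sq in_bergman sums_iff)

lemma coef_bound:
  assumes f: "f \<in> car"
  shows "bw n * (cmod (coef f n))\<^sup>2 \<le> (nrm f)\<^sup>2"
  using sum_le_suminf[OF sums_summable[OF nrm_sq_sums[OF f]], of "{n}"]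
    sums_unique[OF nrm_sq_sums[OF f]] by simp

lemma nrm_leI:
  assumes f: "f \<in> car" and "0 \<le> e"
    and le: "\<And>N. (\<Sum>n<N. bw n * (cmod (coef f n))\<^sup>2) \<le> e\<^sup>2"
  shows "nrm f \<le> e"
proof -
  have "(nrm f)\<^sup>2 \<le> e\<^sup>2"
    using nrm_sq_sums[OF f] unfolding sums_def by (rule LIMSEQ_le_const2) (use le in blast)
  then show ?thesis using \<open>0 \<le> e\<close> by (rule power2_le_imp_le)
qed

text \<open>
  Completeness of a weighted \<open>l\<^sup>2\<close> space: the coefficients converge one by one, and bounds on partial
  sums pass to the limit.
\<close>
sublocale hilbert B
proof
  fix X :: "nat \<Rightarrow> complex \<Rightarrow> complex"
  assume X: "\<And>n. X n \<in> car" and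
    Cauchy: "\<And>e. e > 0 \<Longrightarrow> \<exists>N. \<forall>m\<ge>N. \<forall>n\<ge>N. nrm (X m - X n) < e"
  have "\<exists>a. (\<lambda>n. coef (X n) k) \<longlonglongrightarrow> a" for k
  proof -
    have "Cauchy (\<lambda>n. coef (X n) k)"
    proof (rule metric_CauchyI)
      fix e :: real assume e: "e > 0"
      define d where "d = sqrt (bw k) * e"
      have d: "d > 0" using e by (simp add: d_def)
      obtain N where N: "\<And>m n. N \<le> m \<Longrightarrow> N \<le> n \<Longrightarrow> nrm (X m - X n) < d" using Cauchy[OF d] by blast
      have "dist (coef (X m) k) (coef (X n) k) < e" if "N \<le> m" "N \<le> n" for m n
      proof -
        have "bw k * (cmod (coef (X m) k - coef (X n) k))\<^sup>2 \<le> (nrm (X m - X n))\<^sup>2"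
          using coef_bound[of "X m - X n" k] X by (simp add: coef_diff)
        also have "\<dots> < d\<^sup>2" using N[OF that] X d by (intro power_strict_mono) auto
        also have "\<dots> = bw k * e\<^sup>2" by (simp add: d_def power_mult_distrib)
        finally have "(cmod (coef (X m) k - coef (X n) k))\<^sup>2 < e\<^sup>2" by simp
        then show ?thesis using e by (simp add: dist_norm power_less_imp_less_base)
      qed
      then show "\<exists>M. \<forall>m\<ge>M. \<forall>n\<ge>M. dist (coef (X m) k) (coef (X n) k) < e" by blast
    qed
    then show ?thesis by (simp add: Cauchy_convergent convergentD)
  qed
  then obtain a where a: "\<And>k. (\<lambda>n. coef (X n) k) \<longlonglongrightarrow> a k" by metis
  have part: "\<exists>N. \<forall>m\<ge>N. \<forall>K. (\<Sum>k<K. bw k * (cmod (coef (X m) k - a k))\<^sup>2) \<le> e\<^sup>2" if "e > 0" for e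
  proof -
    obtain N where N: "\<And>m n. N \<le> m \<Longrightarrow> N \<le> n \<Longrightarrow> nrm (X m - X n) < e" using Cauchy[OF \<open>e > 0\<close>] by blast
    have "(\<Sum>k<K. bw k * (cmod (coef (X m) k - a k))\<^sup>2) \<le> e\<^sup>2" if m: "N \<le> m" for m K
    proof (rule LIMSEQ_le_const2)
      show "(\<lambda>n. \<Sum>k<K. bw k * (cmod (coef (X m) k - coef (X n) k))\<^sup>2)
          \<longlonglongrightarrow> (\<Sum>k<K. bw k * (cmod (coef (X m) k - a k))\<^sup>2)"
        by (intro tendsto_intros a)
      have "(\<Sum>k<K. bw k * (cmod (coef (X m) k - coef (X n) k))\<^sup>2) \<le> e\<^sup>2" if n: "N \<le> n" for n
      proof -
        have ns: "(\<lambda>k. bw k * (cmod (coef (X m - X n) k))\<^sup>2) sums (nrm (X m - X n))\<^sup>2"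
          using X by (intro nrm_sq_sums) auto
        have "(\<Sum>k<K. bw k * (cmod (coef (X m - X n) k))\<^sup>2) \<le> (nrm (X m - X n))\<^sup>2"
          using sum_le_suminf[OF sums_summable[OF ns], of "{..<K}"] sums_unique[OF ns] by simp
        also have "\<dots> \<le> e\<^sup>2" using N[OF m n] X by (intro power_mono) auto
        finally show ?thesis using X by (simp add: coef_diff)
      qed
      then show "\<exists>M. \<forall>n\<ge>M. (\<Sum>k<K. bw k * (cmod (coef (X m) k - coef (X n) k))\<^sup>2) \<le> e\<^sup>2" by blast
    qed
    then show ?thesis by blast
  qed
  obtain m where m: "\<And>K. (\<Sum>k<K. bw k * (cmod (coef (X m) k - a k))\<^sup>2) \<le> 1" using part[of 1] by auto
  have "summable (\<lambda>k. bw k * (cmod (coef (X m) k - a k))\<^sup>2)"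
    by (rule summableI_nonneg_bounded[of _ 1]) (use m in auto)
  note h = of_coefs[OF this]
  define g where "g = X m - of_coefs (\<lambda>k. coef (X m) k - a k)"
  have g: "g \<in> car" "coef g k = a k" for k using X h by (auto simp: g_def coef_diff)
  have "(\<lambda>n. nrm (X n - g)) \<longlonglongrightarrow> 0"
  proof (rule LIMSEQ_I)
    fix r :: real assume r: "r > 0"
    obtain N where N: "\<And>m K. N \<le> m \<Longrightarrow> (\<Sum>k<K. bw k * (cmod (coef (X m) k - a k))\<^sup>2) \<le> (r / 2)\<^sup>2"
      using part[of "r / 2"] r by auto
    have "norm (nrm (X n - g) - 0) < r" if "N \<le> n" for n
    proof -
      have "nrm (X n - g) \<le> r / 2"
        using r X g N[OF that] by (intro nrm_leI) (auto simp: coef_diff)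
      then show ?thesis using r X g by simp
    qed
    then show "\<exists>N. \<forall>n\<ge>N. norm (nrm (X n - g) - 0) < r" by blast
  qed
  then show "\<exists>g\<in>car. (\<lambda>n. nrm (X n - g)) \<longlonglongrightarrow> 0" using g by blast
qed

end

section \<open>Reproducing kernels and the half-plane transform\<close>

lemma sum_mult_delta:
  fixes k n :: nat and x :: "nat \<Rightarrow> complex"
  shows "(\<Sum>m<k. x m * (if n = m then 1 else 0)) = (if n < k then x n else 0)"
  by (simp add: if_distrib[of "(*) _"] cong: if_cong)

text \<open>
  The imaginary parts of the four logarithms are less than \<open>\<pi> / 2\<close> in modulus, so those of both sides differ
  by less than \<open>2 \<pi>\<close>, and they differ by a multiple of \<open>2 \<pi> \<i>\<close>. Two factors with positive real part
  would not suffice for the kernel, since \<open>x * y\<close> may have negative real part.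
\<close>
lemma Ln_Re_pos_times3:
  assumes "Re x > 0" "Re y > 0" "Re q > 0" "Re (x * y * q) > 0"
  shows "Ln (x * y * q) = Ln x + Ln y + Ln q"
proof -
  have nz: "x \<noteq> 0" "y \<noteq> 0" "q \<noteq> 0" using assms by auto
  have b: "\<bar>Im (Ln w)\<bar> < pi / 2" if "Re w > 0" for w
    using that Re_Ln_pos_lt_imp by blast
  have xy: "Ln (x * y) = Ln x + Ln y"
    using b[OF assms(1)] b[OF assms(2)] nz by (intro Ln_times_simple) auto
  show ?thesis
    using Ln_times[of "x * y" q] b[OF assms(1)] b[OF assms(2)] b[OF assms(3)] b[OF assms(4)] nz
    by (auto simp: xy split: if_splits)
qed

lemma powr_Re_pos_times3:
  assumes "Re x > 0" "Re y > 0" "Re q > 0" "Re (x * y * q) > 0"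
  shows "(x * y * q) powr t = x powr t * y powr t * q powr t"
proof -
  have nz: "x \<noteq> 0" "y \<noteq> 0" "q \<noteq> 0" using assms by auto
  then show ?thesis
    using Ln_Re_pos_times3[OF assms] by (simp add: powr_def algebra_simps exp_add[symmetric])
qed

lemma powr_Re_pos_times:
  assumes "Re x > 0" "Re y > 0" "Re (x * y) > 0"
  shows "(x * y) powr (t :: complex) = x powr t * y powr t"
  using powr_Re_pos_times3[of x y 1 t] assms by simp

lemma half_plane_disc: "1 / 2 < Re v \<longleftrightarrow> cmod (1 - 1 / v) < 1" if "v \<noteq> 0"
proof -
  have "cmod (1 - 1 / v) = cmod (v - 1) / cmod v"
    using that by (simp add: norm_divide[symmetric] diff_divide_distrib)
  also have "\<dots> < 1 \<longleftrightarrow> (cmod (v - 1))\<^sup>2 < (cmod v)\<^sup>2"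
    using that by (auto simp: divide_less_eq_1 intro: power_strict_mono power2_less_imp_less)
  also have "\<dots> \<longleftrightarrow> 1 / 2 < Re v"
    unfolding cmod_power2 by (simp add: power2_eq_square algebra_simps)
  finally show ?thesis by simp
qed

lemma half_plane_imp_disc: "1 / 2 < Re v \<Longrightarrow> cmod (1 - 1 / v) < 1"
  by (subst half_plane_disc[symmetric]) auto

lemma disc_imp_half_plane: "cmod z < 1 \<Longrightarrow> 1 / 2 < Re (1 / (1 - z))"
  by (subst half_plane_disc) auto

lemma Re_one_minus_pos: "cmod x < 1 \<Longrightarrow> 0 < Re (1 - x)"
  using complex_Re_le_cmod[of x] by simp

context bergman_space
begin

definition point_kernel :: "complex \<Rightarrow> complex \<Rightarrow> complex" where
  "point_kernel w = of_coefs (\<lambda>n. cnj w ^ n / of_real (bw n))"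

lemma point_kernel:
  assumes w: "cmod w < 1"
  shows point_kernel_closed: "point_kernel w \<in> car"
    and coef_point_kernel: "coef (point_kernel w) n = cnj w ^ n / of_real (bw n)"
    and inner_point_kernel: "f \<in> car \<Longrightarrow> ip f (point_kernel w) = f w"
    and point_kernel_eq: "cmod z < 1 \<Longrightarrow> point_kernel w z = (1 - cnj w * z) powr (- of_real s)"
proof -
  have "(cmod w)\<^sup>2 < 1" using w by (simp add: abs_square_less_1)
  then have "summable (\<lambda>n. ((cmod w)\<^sup>2) ^ n / bw n)" by (intro summable_power_div_bw) auto
  moreover have "bw n * (cmod (cnj w ^ n / of_real (bw n)))\<^sup>2 = ((cmod w)\<^sup>2) ^ n / bw n" for n
    by (simp add: norm_divide norm_power power_divide power2_eq_square power_mult_distrib)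
  ultimately have sm: "summable (\<lambda>n. bw n * (cmod (cnj w ^ n / of_real (bw n)))\<^sup>2)" by simp
  show 1: "point_kernel w \<in> car" and 2: "coef (point_kernel w) n = cnj w ^ n / of_real (bw n)" for n
    using of_coefs[OF sm] by (simp_all add: point_kernel_def)
  show "ip f (point_kernel w) = f w" if f: "f \<in> car"
    using bergman_sums[OF f w] by (simp add: inner_bergman 2 sums_iff)
  show "point_kernel w z = (1 - cnj w * z) powr (- of_real s)" if z: "cmod z < 1"
  proof -
    have "cmod (cnj w * z) < 1" using mult_strict_mono'[OF w z] by (simp add: norm_mult)
    from binomial_kernel_sums[OF this] bergman_sums[OF 1 z] show ?thesis
      by (simp add: 2 sums_iff power_mult_distrib)
  qed
qed

definition half_plane :: "complex set" where
  "half_plane = {v. 1 / 2 < Re v}"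

lemma half_plane_iff: "v \<in> half_plane \<longleftrightarrow> 1 / 2 < Re v"
  by (simp add: half_plane_def)

text \<open>
  The half-plane version of \<open>f\<close>, at the point \<open>v = 1 / (1 - z)\<close>. The factor compensates the factors
  which affine maps would produce otherwise; it makes the kernel depend on \<open>u + cnj v\<close> only.
\<close>
definition transform :: "(complex \<Rightarrow> complex) \<Rightarrow> complex \<Rightarrow> complex" where
  "transform f v = v powr (- of_real s) * f (1 - 1 / v)"

text \<open>
  The vector which represents the functional \<open>f \<mapsto> transform f v\<close>.
\<close>
definition kern :: "complex \<Rightarrow> complex \<Rightarrow> complex" where
  "kern v = cnj (v powr (- of_real s)) *\<^sub>c point_kernel (1 - 1 / v)"

lemma transform_add: "transform (f + g) v = transform f v + transform g v"
  and transform_scl: "transform (c *\<^sub>c f) v = c * transform f v"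
  by (simp_all add: transform_def scl_def algebra_simps)

lemma kern_closed [simp]: "v \<in> half_plane \<Longrightarrow> kern v \<in> car"
  by (auto simp: kern_def half_plane_iff half_plane_imp_disc point_kernel_closed)

lemma inner_kern: "f \<in> car \<Longrightarrow> v \<in> half_plane \<Longrightarrow> ip f (kern v) = transform f v"
  using point_kernel_closed[of "1 - 1 / v"] inner_point_kernel[of "1 - 1 / v" f]
  by (auto simp: kern_def half_plane_iff half_plane_imp_disc inner_scl_right transform_def)

text \<open>
  With \<open>z = 1 - 1 / u\<close> and \<open>w = 1 - 1 / v\<close> one has \<open>u * cnj v * (1 - cnj w * z) = u + cnj v - 1\<close>.
\<close>
lemma transform_kern:
  assumes u: "u \<in> half_plane" and v: "v \<in> half_plane"
  shows "transform (kern v) u = (u + cnj v - 1) powr (- of_real s)"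
proof -
  define w z where "w = 1 - 1 / v" and "z = 1 - 1 / u"
  have w: "cmod w < 1" and z: "cmod z < 1" using u v by (auto simp: half_plane_iff half_plane_imp_disc w_def z_def)
  have nz: "u \<noteq> 0" "v \<noteq> 0" using u v by (auto simp: half_plane_iff)
  have prod: "u * cnj v * (1 - cnj w * z) = u + cnj v - 1"
    using nz by (simp add: w_def z_def field_simps)
  have "cmod (cnj w * z) < 1" using mult_strict_mono'[OF w z] by (simp add: norm_mult)
  then have q: "0 < Re (1 - cnj w * z)" by (rule Re_one_minus_pos)
  have "(u * cnj v * (1 - cnj w * z)) powr (- of_real s)
      = u powr (- of_real s) * cnj v powr (- of_real s) * (1 - cnj w * z) powr (- of_real s)"
    using u v prod by (intro powr_Re_pos_times3 q) (simp_all only: prod, simp_all add: half_plane_iff)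
  moreover have "cnj v powr (- of_real s) = cnj (v powr (- of_real s))"
    using v by (subst cnj_powr) (auto simp: half_plane_iff)
  ultimately show ?thesis
    using point_kernel_eq[OF w z] unfolding prod by (simp add: transform_def kern_def scl_def w_def z_def)
qed

lemma eval_by_transform:
  assumes "cmod z < 1"
  shows "f z = (1 / (1 - z)) powr of_real s * transform f (1 / (1 - z))"
proof -
  have "1 - z \<noteq> 0" using assms by auto
  then have "(1 / (1 - z)) powr of_real s * (1 / (1 - z)) powr (- of_real s) = 1"
    by (subst powr_add[symmetric]) simp
  then show ?thesis using \<open>1 - z \<noteq> 0\<close> by (simp add: transform_def mult.assoc[symmetric])
qed

lemma transform_eqI:
  assumes f: "f \<in> car" and g: "g \<in> car" and eq: "\<And>u. u \<in> half_plane \<Longrightarrow> transform f u = transform g u"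
  shows "f = g"
proof
  fix z
  show "f z = g z"
  proof (cases "cmod z < 1")
    case True
    then have "1 / (1 - z) \<in> half_plane" unfolding half_plane_iff by (rule disc_imp_half_plane)
    then show ?thesis
      using eq eval_by_transform[OF True, of f] eval_by_transform[OF True, of g] by simp
  qed (use f g in \<open>simp add: in_bergman\<close>)
qed

lemma point_evaluation_bound:
  assumes "cmod w < 1" "f \<in> car"
  shows "cmod (f w) \<le> nrm f * nrm (point_kernel w)"
  using Cauchy_Schwarz[of f "point_kernel w"] point_kernel_closed[OF assms(1)]
    inner_point_kernel[OF assms] assms by simp

lemma point_evaluation_tendsto:
  assumes w: "cmod w < 1" and X: "\<And>n. X n \<in> car" and f: "f \<in> car"
    and lim: "(\<lambda>n. nrm (X n - f)) \<longlonglongrightarrow> 0"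
  shows "(\<lambda>n. X n w) \<longlonglongrightarrow> f w"
proof (rule LIM_zero_cancel, rule tendsto_norm_zero_cancel, rule tendsto_sandwich)
  show "eventually (\<lambda>n. 0 \<le> norm (X n w - f w)) sequentially" by simp
  have "norm (X n w - f w) \<le> nrm (X n - f) * nrm (point_kernel w)" for n
    using point_evaluation_bound[OF w, of "X n - f"] X f by simp
  then show "eventually (\<lambda>n. norm (X n w - f w) \<le> nrm (X n - f) * nrm (point_kernel w)) sequentially"
    by simp
  show "(\<lambda>n. nrm (X n - f) * nrm (point_kernel w)) \<longlonglongrightarrow> 0"
    by (rule tendsto_eq_rhs[OF tendsto_mult_right[OF lim]]) simp
qed (rule tendsto_const)

section \<open>Density of the kernels\<close>

definition monomial :: "nat \<Rightarrow> complex \<Rightarrow> complex" where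
  "monomial k = of_coefs (\<lambda>n. if n = k then 1 else 0)"

lemma monomial_closed [simp]: "monomial k \<in> car" and coef_monomial: "coef (monomial k) n = (if n = k then 1 else 0)"
proof -
  have "summable (\<lambda>n. bw n * (cmod (if n = k then 1 else 0))\<^sup>2)"
    by (rule summable_finite[of "{k}"]) auto
  from of_coefs[OF this] show "monomial k \<in> car" "coef (monomial k) n = (if n = k then 1 else 0)"
    by (simp_all add: monomial_def)
qed

lemma coef_sum: "(\<And>i. i \<in> I \<Longrightarrow> f i \<in> car) \<Longrightarrow> coef (sum f I) n = (\<Sum>i\<in>I. coef (f i) n)"
  by (induction I rule: infinite_finite_induct) (auto simp: coef_zero coef_add sum_closed)

text \<open>
  The kernels span a dense subspace, stated as an induction principle. Up to scalars the kernels are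
  the point kernels \<open>(1 - cnj w z) powr (- s) = (\<Sum>m. (cnj w z) ^ m / bw m)\<close>. Subtracting the terms with
  \<open>m < k\<close>, dividing by \<open>w ^ k\<close> and letting \<open>w\<close> tend to \<open>0\<close> along the reals isolates the monomial of
  degree \<open>k\<close>, so all monomials are reached by induction on the degree; partial sums of the
  power series do the rest.
\<close>
lemma kern_induct:
  assumes f: "f \<in> car"
    and kern: "\<And>v. v \<in> half_plane \<Longrightarrow> Q (kern v)"
    and add: "\<And>f g. f \<in> car \<Longrightarrow> g \<in> car \<Longrightarrow> Q f \<Longrightarrow> Q g \<Longrightarrow> Q (f + g)"
    and scl: "\<And>f c. f \<in> car \<Longrightarrow> Q f \<Longrightarrow> Q (c *\<^sub>c f)"
    and lim: "\<And>X f. (\<And>n. X n \<in> car) \<Longrightarrow> (\<And>n. Q (X n)) \<Longrightarrow> f \<in> car \<Longrightarrow>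
      (\<lambda>n. nrm (X n - f)) \<longlonglongrightarrow> 0 \<Longrightarrow> Q f"
  shows "Q f"
proof -
  have zero: "Q 0"
  proof -
    have "1 \<in> half_plane" by (simp add: half_plane_iff)
    from scl[OF kern_closed[OF this] kern[OF this], of 0] show ?thesis by (simp only: scl_simps)
  qed
  have sum: "Q (sum g I)" if "finite I" "\<And>i. i \<in> I \<Longrightarrow> g i \<in> car \<and> Q (g i)" for g and I :: "nat set"
    using that
  proof (induction I rule: finite_induct)
    case empty
    show ?case unfolding sum.empty by (rule zero)
  next
    case (insert x F)
    show ?case unfolding sum.insert[OF insert(1,2)]
      by (intro add sum_closed) (use insert in blast)+
  qed
  have pk: "Q (point_kernel w)" if w: "cmod w < 1" for w
  proof -
    define v where "v = 1 / (1 - w)"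
    have v: "v \<in> half_plane" unfolding half_plane_iff v_def by (rule disc_imp_half_plane[OF w])
    have nz: "cnj (v powr (- of_real s)) \<noteq> 0" using v by (auto simp: half_plane_iff)
    have "1 - 1 / v = w" by (simp add: v_def)
    then have eq: "(1 / cnj (v powr (- of_real s))) *\<^sub>c kern v = point_kernel w"
      using nz unfolding kern_def scl_simps(3) by (simp only: nonzero_divide_eq_eq scl_simps(4) refl)
        (simp add: scl_simps(4))
    from scl[OF kern_closed[OF v] kern[OF v]] show ?thesis unfolding eq[symmetric] .
  qed
  have monomial: "Q (monomial k)" for k
  proof (induction k rule: less_induct)
    case (less k)
    define r where "r = (\<lambda>j. 1 / (real j + 2))"
    have r: "0 < r j" "r j \<le> 1 / 2" for j by (auto simp: r_def field_simps)
    have rc: "cmod (of_real (r j)) < 1" for j using r[of j] by simp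
    define X where "X = (\<lambda>j. of_real (bw k / r j ^ k) *\<^sub>c
      (point_kernel (of_real (r j)) - (\<Sum>m<k. of_real (r j ^ m / bw m) *\<^sub>c monomial m)))"
    have sc: "(\<Sum>m<k. of_real (r j ^ m / bw m) *\<^sub>c monomial m) \<in> car" for j by (intro sum_closed) auto
    have X: "X j \<in> car" for j unfolding X_def by (intro scl_closed diff_closed sc point_kernel_closed rc)
    have QX: "Q (X j)" for j
    proof -
      have neg: "Q (- 1 *\<^sub>c (\<Sum>m<k. of_real (r j ^ m / bw m) *\<^sub>c monomial m))"
        by (intro scl sc sum) (auto intro!: scl less.IH)
      have eq: "point_kernel (of_real (r j)) + - 1 *\<^sub>c (\<Sum>m<k. of_real (r j ^ m / bw m) *\<^sub>c monomial m)
          = point_kernel (of_real (r j)) - (\<Sum>m<k. of_real (r j ^ m / bw m) *\<^sub>c monomial m)"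
        by (simp only: minus_one_scl diff_conv_add_uminus)
      from add[OF point_kernel_closed[OF rc[of j]] scl_closed[OF sc[of j]] pk[OF rc[of j]] neg]
      have "Q (point_kernel (of_real (r j)) - (\<Sum>m<k. of_real (r j ^ m / bw m) *\<^sub>c monomial m))"
        unfolding eq .
      then show ?thesis unfolding X_def by (intro scl diff_closed sc point_kernel_closed rc)
    qed
    have coefX: "coef (X j - monomial k) n = (if n \<le> k then 0 else of_real (bw k * r j ^ (n - k) / bw n))" for j n
    proof -
      have "coef (X j) n = of_real (bw k / r j ^ k) *
          (of_real (r j ^ n / bw n) - (\<Sum>m<k. of_real (r j ^ m / bw m) * (if n = m then 1 else 0)))"
        using sc[of j] point_kernel_closed[OF rc[of j]] unfolding X_def
        by (subst coef_scl, blast, subst coef_diff, blast, blast, subst coef_sum)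
          (auto simp: coef_point_kernel[OF rc] coef_scl coef_monomial)
      also have "(\<Sum>m<k. of_real (r j ^ m / bw m) * (if n = m then 1 else 0)) =
          (if n < k then complex_of_real (r j ^ n / bw n) else 0)"
        by (rule sum_mult_delta)
      finally have "coef (X j) n = (if n < k then 0 else of_real (bw k * (r j ^ n / r j ^ k) / bw n))"
        by simp
      moreover have "r j ^ n / r j ^ k = r j ^ (n - k)" if "k \<le> n"
        using that r[of j] by (simp add: power_diff)
      ultimately show ?thesis using X[of j] by (auto simp: coef_diff coef_monomial)
    qed
    \<comment> \<open>For \<open>n > k\<close> and \<open>r \<le> 1/2\<close> one has \<open>r ^ (2 (n - k)) \<le> r\<^sup>2 * 4 ^ (k + 1) * (1 / 4) ^ n\<close>, so \<open>C\<close> bounds the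
      tail of the series.\<close>
    define C where "C = (\<Sum>n. (1 / 4 :: real) ^ n / bw n)"
    have Csum: "summable (\<lambda>n. (1 / 4 :: real) ^ n / bw n)" by (intro summable_power_div_bw) auto
    have C0: "0 \<le> C" unfolding C_def using Csum by (intro suminf_nonneg) auto
    have bound: "nrm (X j - monomial k) \<le> r j * sqrt ((bw k)\<^sup>2 * 4 ^ Suc k * C)" for j
    proof (rule nrm_leI)
      show "0 \<le> r j * sqrt ((bw k)\<^sup>2 * 4 ^ Suc k * C)" using r[of j] C0 by auto
      have tbound: "bw n * (cmod (coef (X j - monomial k) n))\<^sup>2 \<le> (r j)\<^sup>2 * (bw k)\<^sup>2 * 4 ^ Suc k * ((1 / 4) ^ n / bw n)" for n
      proof (cases "n \<le> k")
        case True
        then show ?thesis by (simp add: coefX)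
      next
        case False
        then obtain d where d: "n = k + Suc d" by (metis add_Suc_right less_imp_Suc_add not_le)
        have E: "bw n * (cmod (coef (X j - monomial k) n))\<^sup>2 = (bw k)\<^sup>2 * ((r j) ^ Suc d)\<^sup>2 / bw n"
          using r[of j] d by (simp add: coefX norm_mult norm_divide norm_power power_divide power_mult_distrib power2_eq_square)
        have "((r j) ^ Suc d)\<^sup>2 = (r j)\<^sup>2 * ((r j)\<^sup>2) ^ d"
          by (simp add: power_mult_distrib power_mult[symmetric] mult.commute)
        also have "\<dots> \<le> (r j)\<^sup>2 * (1 / 4) ^ d"
        proof (intro mult_left_mono power_mono)
          have "(r j)\<^sup>2 \<le> (1 / 2)\<^sup>2" using r[of j] by (intro power_mono) auto
          then show "(r j)\<^sup>2 \<le> 1 / 4" by (simp add: power2_eq_square)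
        qed simp_all
        also have "(1 / 4 :: real) ^ d = 4 ^ Suc k * (1 / 4) ^ n"
          by (simp add: d power_add power_one_over)
        finally have P: "((r j) ^ Suc d)\<^sup>2 \<le> (r j)\<^sup>2 * (4 ^ Suc k * (1 / 4) ^ n)" .
        have "(bw k)\<^sup>2 * ((r j) ^ Suc d)\<^sup>2 / bw n \<le> (bw k)\<^sup>2 * ((r j)\<^sup>2 * (4 ^ Suc k * (1 / 4) ^ n)) / bw n"
          by (intro divide_right_mono mult_left_mono P) auto
        also have "\<dots> = (r j)\<^sup>2 * (bw k)\<^sup>2 * 4 ^ Suc k * ((1 / 4) ^ n / bw n)"
          by simp
        finally show ?thesis unfolding E .
      qed
      fix N
      have "(\<Sum>n<N. bw n * (cmod (coef (X j - monomial k) n))\<^sup>2)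
          \<le> (\<Sum>n<N. (r j)\<^sup>2 * (bw k)\<^sup>2 * 4 ^ Suc k * ((1 / 4) ^ n / bw n))"
        by (intro sum_mono tbound)
      also have "\<dots> = (r j)\<^sup>2 * (bw k)\<^sup>2 * 4 ^ Suc k * (\<Sum>n<N. (1 / 4) ^ n / bw n)"
        by (simp only: sum_distrib_left)
      also have "\<dots> \<le> (r j)\<^sup>2 * (bw k)\<^sup>2 * 4 ^ Suc k * C"
        unfolding C_def using Csum by (intro mult_left_mono sum_le_suminf) auto
      also have "\<dots> = (r j * sqrt ((bw k)\<^sup>2 * 4 ^ Suc k * C))\<^sup>2"
        using C0 by (simp add: power_mult_distrib)
      finally show "(\<Sum>n<N. bw n * (cmod (coef (X j - monomial k) n))\<^sup>2) \<le> (r j * sqrt ((bw k)\<^sup>2 * 4 ^ Suc k * C))\<^sup>2" .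
    qed (use X in simp)
    show "Q (monomial k)"
    proof (rule lim[of X])
      have r0: "r \<longlonglongrightarrow> 0"
        using LIMSEQ_ignore_initial_segment[OF lim_inverse_n, of 2] by (simp add: r_def inverse_eq_divide add.commute)
      show "(\<lambda>n. nrm (X n - monomial k)) \<longlonglongrightarrow> 0"
      proof (rule tendsto_sandwich[OF _ _ tendsto_const])
        show "eventually (\<lambda>n. nrm (X n - monomial k) \<le> r n * sqrt ((bw k)\<^sup>2 * 4 ^ Suc k * C)) sequentially"
          using bound by simp
        show "(\<lambda>n. r n * sqrt ((bw k)\<^sup>2 * 4 ^ Suc k * C)) \<longlonglongrightarrow> 0"
          by (rule tendsto_eq_rhs[OF tendsto_mult_right[OF r0]]) simp
      qed (use X in auto)
    qed (use X QX in auto)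
  qed
  define Y where "Y = (\<lambda>N. \<Sum>n<N. coef f n *\<^sub>c monomial n)"
  have Y: "Y N \<in> car" and QY: "Q (Y N)" for N
    unfolding Y_def by (intro sum_closed, simp) (intro sum, auto intro!: scl monomial)
  have coefY: "coef (Y N - f) n = (if n < N then 0 else - coef f n)" for N n
    using Y[of N] f by (simp add: coef_diff) (simp add: Y_def coef_sum coef_scl coef_monomial sum_mult_delta)
  show "Q f"
  proof (rule lim[OF Y QY f])
    have sm: "summable (\<lambda>n. bw n * (cmod (coef f n))\<^sup>2)" using f by (simp add: in_bergman)
    have eq: "(nrm (Y N - f))\<^sup>2 = (\<Sum>n. bw (n + N) * (cmod (coef f (n + N)))\<^sup>2)" for N
    proof -
      have s: "(\<lambda>n. bw n * (cmod (coef (Y N - f) n))\<^sup>2) sums (nrm (Y N - f))\<^sup>2"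
        using Y f by (intro nrm_sq_sums) auto
      from sums_split_initial_segment[OF s, of N]
      have "(\<lambda>n. bw (n + N) * (cmod (coef f (n + N)))\<^sup>2) sums (nrm (Y N - f))\<^sup>2"
        by (simp add: coefY)
      then show ?thesis by (simp add: sums_iff)
    qed
    have "(\<lambda>N. (nrm (Y N - f))\<^sup>2) \<longlonglongrightarrow> 0"
      unfolding eq using suminf_exist_split2[OF sm] by (simp add: add.commute)
    then have "(\<lambda>N. sqrt ((nrm (Y N - f))\<^sup>2)) \<longlonglongrightarrow> sqrt 0" by (rule tendsto_real_sqrt)
    then show "(\<lambda>N. nrm (Y N - f)) \<longlonglongrightarrow> 0" using Y f by simp
  qed
qed

end

section \<open>Comparison of kernels\<close>

lemma powr_of_real_mult:
  assumes "b > 0"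
  shows "(of_real b * x) powr (of_real t) = of_real (b powr t) * x powr (of_real t :: complex)"
  using assms by (subst powr_times_real_left) (auto simp: powr_of_real)

lemma scl_sum: "a *\<^sub>c sum g A = (\<Sum>v\<in>A. a *\<^sub>c g v)"
proof (induction A rule: infinite_finite_induct)
  case (insert x F)
  show ?case unfolding sum.insert[OF insert(1,2)] scl_simps insert(3) ..
qed (simp_all only: sum.empty sum.infinite scl_simps not_False_eq_True)

context bergman_space
begin

lemma gram:
  assumes "finite A" and p: "\<And>i. i \<in> A \<Longrightarrow> p i \<in> half_plane"
  shows "(nrm (\<Sum>i\<in>A. c i *\<^sub>c kern (p i)))\<^sup>2 =
    Re (\<Sum>i\<in>A. \<Sum>j\<in>A. c i * cnj (c j) * (p j + cnj (p i) - 1) powr (- of_real s))"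
proof -
  have cl: "(\<Sum>i\<in>A. c i *\<^sub>c kern (p i)) \<in> car" using p by (intro sum_closed) auto
  have "ip (\<Sum>i\<in>A. c i *\<^sub>c kern (p i)) (\<Sum>i\<in>A. c i *\<^sub>c kern (p i)) =
      (\<Sum>i\<in>A. \<Sum>j\<in>A. ip (c i *\<^sub>c kern (p i)) (c j *\<^sub>c kern (p j)))"
    using p cl by (subst inner_sum_left) (auto intro!: sum.cong inner_sum_right)
  also have "\<dots> = (\<Sum>i\<in>A. \<Sum>j\<in>A. c i * cnj (c j) * (p j + cnj (p i) - 1) powr (- of_real s))"
    using p by (intro sum.cong refl)
      (simp add: inner_scl_left inner_scl_right inner_kern transform_scl transform_kern mult_ac)
  finally show ?thesis using nrm_sq[OF cl] by simp
qed

text \<open>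
  The binomial series of \<open>y powr (- s) * (1 - k / y) powr (- s)\<close> for \<open>y = x + k\<close>. It converges on the
  whole right half-plane because \<open>k < \<bar>x + k\<bar>\<close> there.
\<close>

lemma shifted_kernel_sums:
  assumes x: "0 < Re x" and k: "0 \<le> k"
  shows "(\<lambda>n. of_real (k ^ n / bw n) * (x + of_real k) powr (- of_real (s + real n)))
    sums (x powr (- of_real s))"
proof -
  define y where "y = x + of_real k"
  have y: "k < Re y" using x by (simp add: y_def)
  then have y0: "y \<noteq> 0" using k by auto
  have "k < cmod y" using y complex_Re_le_cmod[of y] by linarith
  then have q: "cmod (of_real k / y) < 1" using k y0 by (simp add: norm_divide divide_less_eq_1)
  have prod: "y * (1 - of_real k / y) = x"
  proof -
    have "y * (1 - of_real k / y) = y - of_real k" using y0 by (simp add: right_diff_distrib)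
    then show ?thesis by (simp add: y_def)
  qed
  have "x powr (- of_real s) = y powr (- of_real s) * (1 - of_real k / y) powr (- of_real s)"
    using powr_Re_pos_times[of y "1 - of_real k / y" "- of_real s"] Re_one_minus_pos[OF q] x y k
    unfolding prod by simp
  moreover have "y powr (- of_real s) * (of_real (1 / bw n) * (of_real k / y) ^ n)
      = of_real (k ^ n / bw n) * y powr (- of_real (s + real n))" for n
  proof -
    have "- of_real (s + real n) = - complex_of_real s - of_nat n" by simp
    then have "y powr (- of_real (s + real n)) = y powr (- of_real s) / y ^ n"
      using y0 by (simp add: powr_diff powr_nat)
    then show ?thesis by (simp add: power_divide)
  qed
  ultimately show ?thesis
    using sums_mult[OF binomial_kernel_sums[OF q], of "y powr (- of_real s)"] by (simp add: y_def)
qed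

text \<open>
  By \<open>shifted_kernel_sums\<close> the difference of the two sides is a series with nonnegative coefficients
  in the forms \<open>Q n\<close>, \<open>n \<ge> 1\<close>, where \<open>Q n\<close> has the exponent \<open>- (s + n)\<close>. The exponent \<open>s + n\<close> belongs to
  the Bergman space with parameter \<open>\<alpha> + n\<close>, and the shift by \<open>k\<close> is shared equally between the two
  points of each pair, so \<open>Q n\<close> is the square of a norm in that space.
\<close>
lemma gram_antimono:
  assumes fin: "finite A" and p: "\<And>i. i \<in> A \<Longrightarrow> p i \<in> half_plane" and k: "0 \<le> k"
  shows "Re (\<Sum>i\<in>A. \<Sum>j\<in>A. c i * cnj (c j) * (p j + cnj (p i) - 1 + of_real k) powr (- of_real s))
    \<le> Re (\<Sum>i\<in>A. \<Sum>j\<in>A. c i * cnj (c j) * (p j + cnj (p i) - 1) powr (- of_real s))"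
proof -
  define Q where "Q = (\<lambda>n. \<Sum>i\<in>A. \<Sum>j\<in>A. c i * cnj (c j) *
    (p j + cnj (p i) - 1 + of_real k) powr (- of_real (s + real n)))"
  have Q: "0 \<le> Re (Q n)" for n
  proof -
    interpret W: bergman_space "\<alpha> + real n" using alpha by unfold_locales simp
    \<comment> \<open>Half of the shift for each argument of the kernel.\<close>
    define p' where "p' = (\<lambda>i. p i + of_real (k / 2))"
    have "p j + cnj (p i) - 1 + of_real k = p' j + cnj (p' i) - 1" for i j
      by (simp add: p'_def complex_eq_iff)
    moreover have "W.s = s + real n" by (simp add: W.s_def s_def)
    ultimately have Q': "Q n = (\<Sum>i\<in>A. \<Sum>j\<in>A. c i * cnj (c j) * (p' j + cnj (p' i) - 1) powr (- of_real W.s))"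
      by (simp only: Q_def)
    have p'half_plane: "p' i \<in> W.half_plane" if "i \<in> A" for i
      using p[OF that] k by (simp add: p'_def half_plane_iff W.half_plane_iff)
    have "Re (Q n) = (W.nrm (\<Sum>i\<in>A. c i *\<^sub>c W.kern (p' i)))\<^sup>2"
      unfolding Q' by (rule W.gram[OF fin p'half_plane, symmetric])
    then show ?thesis by simp
  qed
  have "(\<lambda>n. \<Sum>i\<in>A. \<Sum>j\<in>A. c i * cnj (c j) * (of_real (k ^ n / bw n) *
      (p j + cnj (p i) - 1 + of_real k) powr (- of_real (s + real n))))
    sums (\<Sum>i\<in>A. \<Sum>j\<in>A. c i * cnj (c j) * (p j + cnj (p i) - 1) powr (- of_real s))"
  proof (intro sums_sum sums_mult shifted_kernel_sums k)
    fix i j assume "i \<in> A" "j \<in> A"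
    then show "0 < Re (p j + cnj (p i) - 1)" using p[of i] p[of j] by (simp add: half_plane_iff)
  qed
  also have "(\<lambda>n. \<Sum>i\<in>A. \<Sum>j\<in>A. c i * cnj (c j) * (of_real (k ^ n / bw n) *
      (p j + cnj (p i) - 1 + of_real k) powr (- of_real (s + real n)))) = (\<lambda>n. of_real (k ^ n / bw n) * Q n)"
    by (simp only: Q_def sum_distrib_left mult.left_commute)
  finally have F: "(\<lambda>n. of_real (k ^ n / bw n) * Q n)
    sums (\<Sum>i\<in>A. \<Sum>j\<in>A. c i * cnj (c j) * (p j + cnj (p i) - 1) powr (- of_real s))" .
  have Re_times: "Re (of_real r * x) = r * Re x" for r x by simp
  have sums: "(\<lambda>n. k ^ n / bw n * Re (Q n))
    sums Re (\<Sum>i\<in>A. \<Sum>j\<in>A. c i * cnj (c j) * (p j + cnj (p i) - 1) powr (- of_real s))"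
    using sums_Re[OF F] unfolding Re_times .
  have "Re (Q 0) \<le> (\<Sum>n. k ^ n / bw n * Re (Q n))"
    using sum_le_suminf[OF sums_summable[OF sums], of "{0}"] Q k by (simp add: bw_0)
  then show ?thesis using sums_unique[OF sums] by (simp add: Q_def)
qed

definition kernel_span :: "(complex \<Rightarrow> complex) set" where
  "kernel_span = {f. \<exists>A c. finite A \<and> A \<subseteq> half_plane \<and> f = (\<Sum>v\<in>A. c v *\<^sub>c kern v)}"

lemma kernel_span_closed: "f \<in> kernel_span \<Longrightarrow> f \<in> car"
proof -
  assume "f \<in> kernel_span"
  then obtain A c where A: "A \<subseteq> half_plane" and f: "f = (\<Sum>v\<in>A. c v *\<^sub>c kern v)" by (auto simp: kernel_span_def)
  show "f \<in> car" unfolding f using A by (intro sum_closed scl_closed kern_closed) auto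
qed

lemma kern_in_kernel_span: "v \<in> half_plane \<Longrightarrow> kern v \<in> kernel_span"
proof -
  assume v: "v \<in> half_plane"
  have "kern v = (\<Sum>w\<in>{v}. 1 *\<^sub>c kern w)" by (simp add: scl_simps(4))
  then show ?thesis unfolding kernel_span_def using v
    by (intro CollectI exI[of _ "{v}"] exI[of _ "\<lambda>_. 1"]) auto
qed

lemma scl_in_kernel_span:
  assumes "f \<in> kernel_span"
  shows "a *\<^sub>c f \<in> kernel_span"
proof -
  obtain A c where A: "finite A" "A \<subseteq> half_plane" and f: "f = (\<Sum>v\<in>A. c v *\<^sub>c kern v)"
    using assms unfolding kernel_span_def by blast
  have "a *\<^sub>c f = (\<Sum>v\<in>A. (a * c v) *\<^sub>c kern v)" unfolding f scl_sum scl_simps ..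
  then show ?thesis unfolding kernel_span_def using A
    by (intro CollectI exI[of _ A] exI[of _ "\<lambda>v. a * c v"]) simp
qed

lemma add_in_kernel_span:
  assumes "f \<in> kernel_span" "g \<in> kernel_span"
  shows "f + g \<in> kernel_span"
proof -
  obtain A c where A: "finite A" "A \<subseteq> half_plane" and f: "f = (\<Sum>v\<in>A. c v *\<^sub>c kern v)"
    using assms(1) unfolding kernel_span_def by blast
  obtain A' c' where A': "finite A'" "A' \<subseteq> half_plane" and g: "g = (\<Sum>v\<in>A'. c' v *\<^sub>c kern v)"
    using assms(2) unfolding kernel_span_def by blast
  define x x' where "x = (\<lambda>v. if v \<in> A then c v else 0)" and "x' = (\<lambda>v. if v \<in> A' then c' v else 0)"
  have "f = (\<Sum>v\<in>A \<union> A'. x v *\<^sub>c kern v)"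
    unfolding f using A A' by (intro sum.mono_neutral_cong_left) (auto simp: x_def scl_simps)
  moreover have "g = (\<Sum>v\<in>A \<union> A'. x' v *\<^sub>c kern v)"
    unfolding g using A A' by (intro sum.mono_neutral_cong_left) (auto simp: x'_def scl_simps)
  moreover have "(a + b) *\<^sub>c h = a *\<^sub>c h + b *\<^sub>c h" for a b and h :: "complex \<Rightarrow> complex"
    by (simp add: scl_def fun_eq_iff distrib_right)
  ultimately have "f + g = (\<Sum>v\<in>A \<union> A'. (x v + x' v) *\<^sub>c kern v)"
    by (simp only: sum.distrib)
  then show ?thesis unfolding kernel_span_def using A A'
    by (intro CollectI exI[of _ "A \<union> A'"] exI[of _ "\<lambda>v. x v + x' v"]) simp
qed

lemma kernel_span_dense:
  assumes "f \<in> car" "e > 0"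
  shows "\<exists>g\<in>kernel_span. nrm (f - g) < e"
proof -
  have "\<forall>e>0. \<exists>g\<in>kernel_span. nrm (f - g) < e" using assms(1)
  proof (rule kern_induct)
    fix v assume "v \<in> half_plane"
    then have "kern v \<in> kernel_span" by (rule kern_in_kernel_span)
    moreover have "nrm (kern v - kern v) = 0" by (simp only: diff_self nrm_zero)
    ultimately show "\<forall>e>0. \<exists>g\<in>kernel_span. nrm (kern v - g) < e" by (metis)
  next
    fix f g assume f: "f \<in> car" and g: "g \<in> car"
      and Qf: "\<forall>e>0. \<exists>h\<in>kernel_span. nrm (f - h) < e" and Qg: "\<forall>e>0. \<exists>h\<in>kernel_span. nrm (g - h) < e"
    show "\<forall>e>0. \<exists>h\<in>kernel_span. nrm (f + g - h) < e"
    proof (intro allI impI)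
      fix e :: real assume e: "e > 0"
      obtain f' where f': "f' \<in> kernel_span" "nrm (f - f') < e / 2" using Qf e half_gt_zero by blast
      obtain g' where g': "g' \<in> kernel_span" "nrm (g - g') < e / 2" using Qg e half_gt_zero by blast
      have "nrm ((f - f') + (g - g')) < e"
        using nrm_triangle[of "f - f'" "g - g'"] f g f' g' kernel_span_closed by fastforce
      moreover have "(f - f') + (g - g') = f + g - (f' + g')" by (rule add_diff_add[symmetric])
      ultimately show "\<exists>h\<in>kernel_span. nrm (f + g - h) < e"
        using add_in_kernel_span[OF f'(1) g'(1)] by metis
    qed
  next
    fix f c assume f: "f \<in> car" and Qf: "\<forall>e>0. \<exists>h\<in>kernel_span. nrm (f - h) < e"
    show "\<forall>e>0. \<exists>h\<in>kernel_span. nrm (c *\<^sub>c f - h) < e"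
    proof (intro allI impI)
      fix e :: real assume e: "e > 0"
      define d where "d = e / (cmod c + 1)"
      have cp: "cmod c + 1 > 0" using norm_ge_zero[of c] by linarith
      then have d: "d > 0" using e by (simp add: d_def)
      obtain f' where f': "f' \<in> kernel_span" "nrm (f - f') < d" using Qf d by blast
      have "nrm (c *\<^sub>c f - c *\<^sub>c f') = cmod c * nrm (f - f')"
        using f f' kernel_span_closed by (simp add: nrm_scl flip: scl_simps(2))
      also have "\<dots> \<le> cmod c * d" using f' by (intro mult_left_mono) auto
      also have "\<dots> < (cmod c + 1) * d" using d by simp
      also have "\<dots> = e" using cp by (simp add: d_def)
      finally show "\<exists>h\<in>kernel_span. nrm (c *\<^sub>c f - h) < e" using scl_in_kernel_span[OF f'(1)] by blast
    qed
  next
    fix X f assume X: "\<And>n. X n \<in> car" and QX: "\<And>n. \<forall>e>0. \<exists>h\<in>kernel_span. nrm (X n - h) < e"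
      and f: "f \<in> car" and lim: "(\<lambda>n. nrm (X n - f)) \<longlonglongrightarrow> 0"
    show "\<forall>e>0. \<exists>h\<in>kernel_span. nrm (f - h) < e"
    proof (intro allI impI)
      fix e :: real assume e: "e > 0"
      have "eventually (\<lambda>n. nrm (X n - f) < e / 2) sequentially"
        using lim e by (intro order_tendstoD) auto
      then obtain n where n: "nrm (X n - f) < e / 2" by (auto simp: eventually_sequentially)
      obtain h where h: "h \<in> kernel_span" "nrm (X n - h) < e / 2" using QX e half_gt_zero by blast
      have "nrm (f - h) \<le> nrm (f - X n) + nrm (X n - h)"
        using f X h kernel_span_closed by (intro nrm_triangle3) auto
      then have "nrm (f - h) < e" using n h nrm_diff_commute[OF f X] by simp
      then show "\<exists>h\<in>kernel_span. nrm (f - h) < e" using h by blast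
    qed
  qed
  then show ?thesis using assms(2) by blast
qed

section \<open>Operators induced by affine maps of the half-plane\<close>

text \<open>
  In terms of the transform: \<open>F u \<mapsto> b powr (s / 2) * F (b * u + d)\<close>; see \<open>transform_affine_comp\<close>.
\<close>
definition affine_comp :: "real \<Rightarrow> real \<Rightarrow> (complex \<Rightarrow> complex) \<Rightarrow> complex \<Rightarrow> complex" where
  "affine_comp b d f z = (if cmod z < 1 then of_real (b powr (s / 2)) * (1 / (1 - z)) powr of_real s *
    transform f (of_real b * (1 / (1 - z)) + of_real d) else 0)"

text \<open>
  The condition says that \<open>u \<mapsto> b * u + d\<close> maps the half-plane \<open>Re u > 1/2\<close> into itself.
\<close>
definition half_plane_map :: "real \<Rightarrow> real \<Rightarrow> bool" where
  "half_plane_map b d \<longleftrightarrow> 0 < b \<and> 1 / 2 \<le> b / 2 + d"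

lemma half_plane_map_closed:
  assumes "half_plane_map b d" "u \<in> half_plane"
  shows "of_real b * u + of_real d \<in> half_plane"
proof -
  have "b * (1 / 2) < b * Re u" using assms by (intro mult_strict_left_mono) (auto simp: half_plane_map_def half_plane_iff)
  then have "1 / 2 < b * Re u + d" using assms(1) unfolding half_plane_map_def by linarith
  then show ?thesis by (simp add: half_plane_iff)
qed

lemma transform_affine_comp:
  assumes u: "u \<in> half_plane"
  shows "transform (affine_comp b d f) u = of_real (b powr (s / 2)) * transform f (of_real b * u + of_real d)"
proof -
  have nz: "u \<noteq> 0" using u by (auto simp: half_plane_iff)
  have z: "cmod (1 - 1 / u) < 1" using u by (simp add: half_plane_iff half_plane_imp_disc)
  have "u powr (- of_real s) * u powr of_real s = 1"
    using nz by (subst powr_add[symmetric]) simp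
  then show ?thesis
    using nz z by (simp add: transform_def[of "affine_comp b d f"] affine_comp_def)
qed

lemma affine_comp_add: "affine_comp b d (f + g) = affine_comp b d f + affine_comp b d g"
  and affine_comp_scl: "affine_comp b d (c *\<^sub>c f) = c *\<^sub>c affine_comp b d f"
  by (simp_all add: affine_comp_def fun_eq_iff transform_add transform_scl algebra_simps)
    (simp_all add: affine_comp_def scl_def transform_def algebra_simps)

lemma affine_comp_zero: "affine_comp b d 0 = 0"
  by (simp add: affine_comp_def fun_eq_iff transform_def)

lemma affine_comp_sum: "affine_comp b d (sum g A) = (\<Sum>v\<in>A. affine_comp b d (g v))"
proof (induction A rule: infinite_finite_induct)
  case (insert x F)
  show ?case unfolding sum.insert[OF insert(1,2)] affine_comp_add insert(3) ..
qed (simp_all only: sum.empty sum.infinite affine_comp_zero not_False_eq_True)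

text \<open>
  Kernels are mapped to multiples of kernels, since
  \<open>b * u + d + cnj v - 1 = b * (u + cnj w - 1)\<close> for this \<open>w\<close>.
\<close>
lemma affine_comp_kern:
  assumes ad: "half_plane_map b d" and v: "v \<in> half_plane"
  defines "w \<equiv> (v + of_real d - 1) / of_real b + 1"
  shows "w \<in> half_plane" and "affine_comp b d (kern v) = of_real (b powr (- s / 2)) *\<^sub>c kern w"
proof -
  have b: "0 < b" using ad by (simp add: half_plane_map_def)
  have "- b / 2 < Re v + d - 1" using ad v by (simp add: half_plane_map_def half_plane_iff)
  then have "- b / 2 / b < (Re v + d - 1) / b" using b by (rule divide_strict_right_mono)
  moreover have "- b / 2 / b = - 1 / 2" using b by simp
  moreover have "Re w = (Re v + d - 1) / b + 1" by (simp add: w_def)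
  ultimately show w: "w \<in> half_plane" unfolding half_plane_iff by linarith
  show "affine_comp b d (kern v) = of_real (b powr (- s / 2)) *\<^sub>c kern w"
  proof
    fix z
    show "affine_comp b d (kern v) z = (of_real (b powr (- s / 2)) *\<^sub>c kern w) z"
    proof (cases "cmod z < 1")
      case True
      define u where "u = 1 / (1 - z)"
      have u: "u \<in> half_plane" using disc_imp_half_plane[OF True] by (simp add: u_def half_plane_iff)
      have e: "of_real b * u + of_real d + cnj v - 1 = of_real b * (u + cnj w - 1)"
      proof -
        have "of_real b * cnj w = cnj v + of_real d - 1 + of_real b"
          using b by (simp add: w_def distrib_left)
        then show ?thesis by (simp add: distrib_left right_diff_distrib)
      qed
      have "transform (kern v) (of_real b * u + of_real d) = (of_real b * (u + cnj w - 1)) powr (- of_real s)"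
        using transform_kern[OF half_plane_map_closed[OF ad u] v] unfolding e .
      also have "\<dots> = of_real (b powr (- s)) * (u + cnj w - 1) powr (- of_real s)"
        using powr_of_real_mult[OF b, of "u + cnj w - 1" "- s"] by simp
      also have "(u + cnj w - 1) powr (- of_real s) = transform (kern w) u"
        using transform_kern[OF u w] by simp
      finally have t: "transform (kern v) (of_real b * u + of_real d) = of_real (b powr (- s)) * transform (kern w) u" .
      have "b powr (s / 2) * b powr (- s) = b powr (- s / 2)"
        by (simp add: powr_add[symmetric])
      then have bb: "complex_of_real (b powr (s / 2)) * of_real (b powr (- s)) = of_real (b powr (- s / 2))"
        by (simp flip: of_real_mult)
      have "affine_comp b d (kern v) z = (of_real (b powr (s / 2)) * of_real (b powr (- s))) * (u powr of_real s * transform (kern w) u)"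
        using True t by (simp add: affine_comp_def u_def mult_ac)
      also have "u powr of_real s * transform (kern w) u = kern w z"
        using eval_by_transform[OF True, of "kern w"] by (simp add: u_def)
      finally show ?thesis by (simp only: bb scl_def)
    next
      case False
      then show ?thesis using kern_closed[OF w] by (simp add: affine_comp_def scl_def in_bergman)
    qed
  qed
qed

text \<open>
  If \<open>v\<close> is moved to \<open>p v\<close>, then \<open>b * (p w + cnj (p v) - 1)\<close> exceeds \<open>w + cnj v - 1\<close> by \<open>2 d - 1 + b\<close>. That
  this shift is nonnegative is exactly the condition on the affine map.
\<close>
lemma affine_comp_kernel_span:
  assumes ad: "half_plane_map b d" and f: "f \<in> kernel_span"
  shows "affine_comp b d f \<in> car" and "nrm (affine_comp b d f) \<le> nrm f"
proof -
  obtain A c where A: "finite A" "A \<subseteq> half_plane" and f_eq: "f = (\<Sum>v\<in>A. c v *\<^sub>c kern v)"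
    using f unfolding kernel_span_def by blast
  define p where "p = (\<lambda>v. (v + of_real d - 1) / of_real b + 1 :: complex)"
  define k where "k = 2 * d - 1 + b"
  have b: "0 < b" and k: "0 \<le> k" using ad by (auto simp: half_plane_map_def k_def)
  have p: "p v \<in> half_plane" if "v \<in> A" for v using affine_comp_kern(1)[OF ad, of v] that A by (auto simp: p_def)
  have Vk: "affine_comp b d (kern v) = of_real (b powr (- s / 2)) *\<^sub>c kern (p v)" if "v \<in> A" for v
    using affine_comp_kern(2)[OF ad, of v] that A by (auto simp: p_def)
  define g where "g = (\<Sum>v\<in>A. c v *\<^sub>c kern (p v))"
  have g: "g \<in> car" unfolding g_def using p by (intro sum_closed) auto
  have "affine_comp b d f = (\<Sum>v\<in>A. of_real (b powr (- s / 2)) *\<^sub>c (c v *\<^sub>c kern (p v)))"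
    unfolding f_eq affine_comp_sum affine_comp_scl by (intro sum.cong refl) (simp only: Vk scl_simps(3) mult.commute)
  also have "\<dots> = of_real (b powr (- s / 2)) *\<^sub>c g" unfolding g_def scl_sum ..
  finally have Vf: "affine_comp b d f = of_real (b powr (- s / 2)) *\<^sub>c g" .
  show Vc: "affine_comp b d f \<in> car" unfolding Vf using g by (rule scl_closed)
  have scaling: "of_real (b powr (- s)) * (p w + cnj (p v) - 1) powr (- of_real s)
      = (w + cnj v - 1 + of_real k) powr (- of_real s)" for v w
  proof -
    have "of_real b * (p w + cnj (p v) - 1) = w + cnj v - 1 + of_real k"
    proof -
      define q where "q = (\<lambda>v. (v + of_real d - 1) / of_real b :: complex)"
      have q: "of_real b * q v = v + of_real d - 1" for v using b by (simp add: q_def)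
      have "of_real b * cnj (q v) = cnj v + of_real d - 1"
        using arg_cong[OF q[of v], of cnj] by simp
      moreover have "of_real b * (p w + cnj (p v) - 1) = of_real b * q w + of_real b * cnj (q v) + of_real b"
        by (simp add: p_def q_def algebra_simps)
      ultimately show ?thesis using q[of w] by (simp add: k_def)
    qed
    then show ?thesis using powr_of_real_mult[OF b, of "p w + cnj (p v) - 1" "- s"] by simp
  qed
  have "(nrm (affine_comp b d f))\<^sup>2 = b powr (- s) * (nrm g)\<^sup>2"
    unfolding Vf using g by (simp add: nrm_scl power_mult_distrib) (simp add: power2_eq_square powr_add[symmetric])
  also have "\<dots> = Re (of_real (b powr (- s)) *
      (\<Sum>v\<in>A. \<Sum>w\<in>A. c v * cnj (c w) * (p w + cnj (p v) - 1) powr (- of_real s)))"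
  proof -
    have "(nrm g)\<^sup>2 = Re (\<Sum>v\<in>A. \<Sum>w\<in>A. c v * cnj (c w) * (p w + cnj (p v) - 1) powr (- of_real s))"
      unfolding g_def by (rule gram[OF A(1) p])
    moreover have "r * Re x = Re (of_real r * x)" for r x by simp
    ultimately show ?thesis by (simp only:)
  qed
  also have "of_real (b powr (- s)) *
      (\<Sum>v\<in>A. \<Sum>w\<in>A. c v * cnj (c w) * (p w + cnj (p v) - 1) powr (- of_real s))
    = (\<Sum>v\<in>A. \<Sum>w\<in>A. c v * cnj (c w) * (w + cnj v - 1 + of_real k) powr (- of_real s))"
    unfolding scaling[symmetric] by (simp only: sum_distrib_left mult.left_commute)
  also have "Re \<dots> \<le> Re (\<Sum>v\<in>A. \<Sum>w\<in>A. c v * cnj (c w) * (w + cnj v - 1) powr (- of_real s))"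
    using A k by (intro gram_antimono) auto
  also have "\<dots> = (nrm f)\<^sup>2"
    unfolding f_eq using A by (intro gram[symmetric]) auto
  finally show "nrm (affine_comp b d f) \<le> nrm f"
    by (rule power2_le_imp_le) (rule nrm_nonneg[OF kernel_span_closed[OF f]])
qed

lemma affine_comp_diff: "affine_comp b d (f - g) = affine_comp b d f - affine_comp b d g"
  using affine_comp_add[of b d "f - g" g] by (simp only: diff_add_cancel add_diff_cancel_right')

text \<open>
  Approximate \<open>f\<close> by combinations of kernels. Their images form a Cauchy sequence, whose limit is
  found by evaluation at points.
\<close>
lemma affine_comp_closed_contraction:
  assumes ad: "half_plane_map b d" and f: "f \<in> car"
  shows "affine_comp b d f \<in> car \<and> nrm (affine_comp b d f) \<le> nrm f"
proof -
  have "\<exists>g. g \<in> kernel_span \<and> nrm (f - g) < 1 / (real n + 1)" for n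
    using kernel_span_dense[OF f, of "1 / (real n + 1)"] by auto
  then obtain g where g: "\<And>n. g n \<in> kernel_span" and close: "\<And>n. nrm (f - g n) < 1 / (real n + 1)" by metis
  have gc [simp]: "g n \<in> car" for n by (rule kernel_span_closed[OF g])
  have lim: "(\<lambda>n. nrm (g n - f)) \<longlonglongrightarrow> 0"
  proof (rule tendsto_sandwich[OF _ _ tendsto_const])
    show "eventually (\<lambda>n. 0 \<le> nrm (g n - f)) sequentially" using f by simp
    have "nrm (g n - f) \<le> 1 / (real n + 1)" for n
      using close[of n] nrm_diff_commute[OF f gc, of n] by simp
    then show "eventually (\<lambda>n. nrm (g n - f) \<le> 1 / (real n + 1)) sequentially" by simp
    show "(\<lambda>n. 1 / (real n + 1)) \<longlonglongrightarrow> 0"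
      using LIMSEQ_inverse_real_of_nat by (simp add: inverse_eq_divide add.commute)
  qed
  have Vg: "affine_comp b d (g n) \<in> car" for n by (rule affine_comp_kernel_span(1)[OF ad g])
  have diff: "nrm (affine_comp b d (g m) - affine_comp b d (g n)) \<le> nrm (g m - f) + nrm (g n - f)" for m n
  proof -
    have "g m + - 1 *\<^sub>c g n \<in> kernel_span" by (intro add_in_kernel_span scl_in_kernel_span g)
    then have "g m - g n \<in> kernel_span" by (simp only: minus_one_scl diff_conv_add_uminus)
    from affine_comp_kernel_span(2)[OF ad this] have "nrm (affine_comp b d (g m) - affine_comp b d (g n)) \<le> nrm (g m - g n)"
      by (simp only: affine_comp_diff)
    also have "\<dots> \<le> nrm (g m - f) + nrm (f - g n)" using f by (intro nrm_triangle3) auto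
    finally show ?thesis using nrm_diff_commute[OF f gc, of n] by simp
  qed
  have "\<exists>h\<in>car. (\<lambda>n. nrm (affine_comp b d (g n) - h)) \<longlonglongrightarrow> 0"
  proof (rule complete[OF Vg])
    fix e :: real assume e: "e > 0"
    have "eventually (\<lambda>n. nrm (g n - f) < e / 2) sequentially"
      using lim e by (intro order_tendstoD) auto
    then obtain N where N: "\<And>n. N \<le> n \<Longrightarrow> nrm (g n - f) < e / 2" by (auto simp: eventually_sequentially)
    have "nrm (affine_comp b d (g m) - affine_comp b d (g n)) < e" if "N \<le> m" "N \<le> n" for m n
      using diff[of m n] N[OF that(1)] N[OF that(2)] by linarith
    then show "\<exists>N. \<forall>m\<ge>N. \<forall>n\<ge>N. nrm (affine_comp b d (g m) - affine_comp b d (g n)) < e" by blast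
  qed
  then obtain h where h: "h \<in> car" and Vlim: "(\<lambda>n. nrm (affine_comp b d (g n) - h)) \<longlonglongrightarrow> 0" by blast
  have "h z = affine_comp b d f z" for z
  proof (cases "cmod z < 1")
    case True
    define u where "u = of_real b * (1 / (1 - z)) + of_real d"
    have "1 / (1 - z) \<in> half_plane" using disc_imp_half_plane[OF True] by (simp add: half_plane_iff)
    then have u: "u \<in> half_plane" unfolding u_def by (rule half_plane_map_closed[OF ad])
    then have "cmod (1 - 1 / u) < 1" by (simp add: half_plane_iff half_plane_imp_disc)
    from point_evaluation_tendsto[OF this gc f lim]
    have "(\<lambda>n. affine_comp b d (g n) z) \<longlonglongrightarrow> affine_comp b d f z"
      using True unfolding affine_comp_def transform_def u_def by (auto intro!: tendsto_intros)
    moreover have "(\<lambda>n. affine_comp b d (g n) z) \<longlonglongrightarrow> h z"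
      by (rule point_evaluation_tendsto[OF True Vg h Vlim])
    ultimately show ?thesis by (rule LIMSEQ_unique[symmetric])
  next
    case False
    then show ?thesis using h by (simp add: affine_comp_def in_bergman)
  qed
  then have hV: "affine_comp b d f = h" by (simp add: fun_eq_iff)
  have "nrm h \<le> nrm f"
  proof (rule LIMSEQ_le_const)
    show "(\<lambda>n. nrm (affine_comp b d (g n) - h) + nrm (g n - f) + nrm f) \<longlonglongrightarrow> nrm f"
      by (rule tendsto_eq_rhs[OF tendsto_add[OF tendsto_add[OF Vlim lim] tendsto_const]]) simp
    have "nrm h \<le> nrm (affine_comp b d (g n) - h) + nrm (g n - f) + nrm f" for n
      using nrm_triangle_diff[OF h Vg, of n] nrm_diff_commute[OF h Vg, of n]
        affine_comp_kernel_span(2)[OF ad g, of n] nrm_triangle_diff[OF gc f, of n] by linarith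
    then show "\<exists>N. \<forall>n\<ge>N. nrm h \<le> nrm (affine_comp b d (g n) - h) + nrm (g n - f) + nrm f" by blast
  qed
  then show ?thesis using h by (simp add: hV)
qed

definition affine_op :: "real \<Rightarrow> real \<Rightarrow> (complex \<Rightarrow> complex) \<Rightarrow> complex \<Rightarrow> complex" where
  "affine_op b d = restrict (affine_comp b d) car"

lemma affine_op_eq: "f \<in> car \<Longrightarrow> affine_op b d f = affine_comp b d f"
  by (simp add: affine_op_def)

lemma affine_op_closed: "half_plane_map b d \<Longrightarrow> f \<in> car \<Longrightarrow> affine_op b d f \<in> car"
  and affine_op_contraction: "half_plane_map b d \<Longrightarrow> f \<in> car \<Longrightarrow> nrm (affine_op b d f) \<le> nrm f"
  using affine_comp_closed_contraction by (auto simp: affine_op_eq)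

lemma affine_op_op: "half_plane_map b d \<Longrightarrow> affine_op b d \<in> bounded_ops B"
  by (rule opI[where K = 1]) (simp_all add: affine_op_closed affine_op_contraction, simp_all add: affine_op_eq affine_comp_add affine_comp_scl, simp add: affine_op_def)

lemma transform_affine_op: "f \<in> car \<Longrightarrow> u \<in> half_plane \<Longrightarrow>
    transform (affine_op b d f) u = of_real (b powr (s / 2)) * transform f (of_real b * u + of_real d)"
  by (simp add: affine_op_eq transform_affine_comp)

lemma affine_op_affine_op:
  assumes "half_plane_map b d" "half_plane_map b' d'" and f: "f \<in> car"
  shows "affine_op b d (affine_op b' d' f) = affine_op (b * b') (b' * d + d') f"
proof (rule transform_eqI)
  have ad: "half_plane_map (b * b') (b' * d + d')"
  proof -
    have "b' * (1 / 2) \<le> b' * (b / 2 + d)" using assms by (intro mult_left_mono) (auto simp: half_plane_map_def)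
    then show ?thesis using assms by (simp add: half_plane_map_def algebra_simps)
  qed
  show "affine_op b d (affine_op b' d' f) \<in> car" "affine_op (b * b') (b' * d + d') f \<in> car"
    using assms ad by (simp_all add: affine_op_closed)
  fix u assume u: "u \<in> half_plane"
  have "0 < b" "0 < b'" using assms by (auto simp: half_plane_map_def)
  then show "transform (affine_op b d (affine_op b' d' f)) u = transform (affine_op (b * b') (b' * d + d') f) u"
    using assms u half_plane_map_closed[of b d u] affine_op_closed[of b' d' f]
    by (simp add: transform_affine_op powr_mult algebra_simps)
qed

lemma affine_op_1_0: "f \<in> car \<Longrightarrow> affine_op 1 0 f = f"
  by (rule transform_eqI) (auto simp: affine_op_closed half_plane_map_def transform_affine_op)

text \<open>
  Translation by \<open>k\<close> sends \<open>kern v\<close> to \<open>kern (v + k)\<close>, so for \<open>g = kern v\<close> both sides are equal to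
  the transform of \<open>f\<close> at \<open>v + k\<close>.
\<close>
lemma affine_op_1_adjoint:
  assumes k: "0 \<le> k" and f: "f \<in> car" and g: "g \<in> car"
  shows "ip (affine_op 1 k f) g = ip f (affine_op 1 k g)"
proof -
  have ad: "half_plane_map 1 k" using k by (simp add: half_plane_map_def)
  note Vc [simp] = affine_op_closed[OF ad]
  show ?thesis using g
  proof (rule kern_induct)
    fix v assume v: "v \<in> half_plane"
    have v': "v + of_real k \<in> half_plane" using half_plane_map_closed[OF ad v] by simp
    have "affine_op 1 k (kern v) = kern (v + of_real k)"
      using affine_comp_kern(2)[OF ad v] v by (simp add: affine_op_eq scl_simps(4))
    then show "ip (affine_op 1 k f) (kern v) = ip f (affine_op 1 k (kern v))"
      using f v v' by (simp add: inner_kern transform_affine_op)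
  next
    fix X g assume X: "\<And>n. X n \<in> car" and IH: "\<And>n. ip (affine_op 1 k f) (X n) = ip f (affine_op 1 k (X n))"
      and g: "g \<in> car" and lim: "(\<lambda>n. nrm (X n - g)) \<longlonglongrightarrow> 0"
    have "cmod (ip (affine_op 1 k f) g - ip f (affine_op 1 k g)) \<le> 0"
    proof (rule LIMSEQ_le_const)
      show "(\<lambda>n. 2 * nrm f * nrm (X n - g)) \<longlonglongrightarrow> 0"
        by (rule tendsto_eq_rhs[OF tendsto_mult_left[OF lim]]) simp
      have "cmod (ip (affine_op 1 k f) g - ip f (affine_op 1 k g)) \<le> 2 * nrm f * nrm (X n - g)" for n
      proof -
        have eq: "ip (affine_op 1 k f) g - ip f (affine_op 1 k g) = ip f (affine_op 1 k (X n - g)) - ip (affine_op 1 k f) (X n - g)"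
          using f g X IH[of n] by (simp add: op_diff[OF affine_op_op[OF ad]] inner_diff_right)
        have "cmod (ip (affine_op 1 k f) g - ip f (affine_op 1 k g))
            \<le> cmod (ip f (affine_op 1 k (X n - g))) + cmod (ip (affine_op 1 k f) (X n - g))"
          unfolding eq by (rule norm_triangle_ineq4)
        also have "\<dots> \<le> nrm f * nrm (affine_op 1 k (X n - g)) + nrm (affine_op 1 k f) * nrm (X n - g)"
          using f g X by (intro add_mono Cauchy_Schwarz) auto
        also have "\<dots> \<le> nrm f * nrm (X n - g) + nrm f * nrm (X n - g)"
          using f g X by (intro add_mono mult_left_mono mult_right_mono affine_op_contraction[OF ad]) auto
        finally show ?thesis by simp
      qed
      then show "\<exists>N. \<forall>n\<ge>N. cmod (ip (affine_op 1 k f) g - ip f (affine_op 1 k g)) \<le> 2 * nrm f * nrm (X n - g)" by blast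
    qed
    then show "ip (affine_op 1 k f) g = ip f (affine_op 1 k g)" by simp
  next
    fix g h assume "g \<in> car" "h \<in> car" "ip (affine_op 1 k f) g = ip f (affine_op 1 k g)" "ip (affine_op 1 k f) h = ip f (affine_op 1 k h)"
    then show "ip (affine_op 1 k f) (g + h) = ip f (affine_op 1 k (g + h))"
      using f by (simp only: op_add[OF affine_op_op[OF ad]] inner_add_right Vc)
  next
    fix g c assume "g \<in> car" "ip (affine_op 1 k f) g = ip f (affine_op 1 k g)"
    then show "ip (affine_op 1 k f) (c *\<^sub>c g) = ip f (affine_op 1 k (c *\<^sub>c g))"
      using f by (simp only: op_scl[OF affine_op_op[OF ad]] inner_scl_right Vc)
  qed
qed

text \<open>
  If the operator annihilates \<open>f\<close>, then \<open>f\<close> vanishes on the open set of the disc that corresponds to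
  \<open>Re u > 1/2 + k\<close>, hence everywhere by analytic continuation.
\<close>
lemma affine_op_1_injective:
  assumes k: "0 \<le> k" and f: "f \<in> car" and zero: "affine_op 1 k f = 0"
  shows "f = 0"
proof -
  have hol: "f holomorphic_on ball 0 1" using f by (simp add: in_bergman)
  have vanish: "f (1 - 1 / (u + of_real k)) = 0" if u: "u \<in> half_plane" for u
  proof -
    have "u + of_real k \<noteq> 0" using u k by (auto simp: half_plane_iff complex_eq_iff)
    moreover have "transform f (u + of_real k) = 0"
      using transform_affine_op[OF f u, of 1 k] zero by (simp add: transform_def)
    ultimately show ?thesis by (simp add: transform_def)
  qed
  define S where "S = {z \<in> ball (0 :: complex) 1. 1 / 2 + k < Re (1 / (1 - z))}"
  have S: "S = ball 0 1 \<inter> (\<lambda>z. Re (1 / (1 - z))) -` {1 / 2 + k <..}" by (auto simp: S_def)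
  have "continuous_on (ball 0 1) (\<lambda>z :: complex. Re (1 / (1 - z)))"
    by (intro continuous_intros) auto
  then have op: "open S" unfolding S by (intro continuous_open_preimage) auto
  have ne: "of_real (1 - 1 / (k + 1)) \<in> S"
  proof -
    have "complex_of_real (1 - 1 / (k + 1)) \<in> ball 0 1"
      unfolding mem_ball dist_0_norm norm_of_real using k by (simp add: abs_if field_simps)
    moreover have "1 / (1 - complex_of_real (1 - 1 / (k + 1))) = of_real (k + 1)" by (simp add: field_simps)
    ultimately show ?thesis unfolding S_def by simp
  qed
  have fS: "f z = 0" if "z \<in> S" for z
  proof -
    have z: "cmod z < 1" "1 / 2 + k < Re (1 / (1 - z))" using that by (auto simp: S_def)
    have "1 / (1 - z) - of_real k \<in> half_plane" using z by (simp add: half_plane_iff)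
    from vanish[OF this] show ?thesis by simp
  qed
  have "f z = 0" if "cmod z < 1" for z
    by (rule analytic_continuation_open[OF op open_ball[of 0 1] _ _ _ hol holomorphic_on_const[of 0] fS])
      (use that ne in \<open>auto simp: S_def\<close>)
  then show ?thesis using f by (auto simp: in_bergman fun_eq_iff)
qed

section \<open>Powers of \<open>1 - z\<close>\<close>

definition one_minus_power :: "complex \<Rightarrow> complex \<Rightarrow> complex" where
  "one_minus_power q z = (if cmod z < 1 then (1 - z) powr q else 0)"

lemma coef_one_minus_power: "coef (one_minus_power q) = (\<lambda>n. (q gchoose n) * (-1) ^ n)"
proof (rule coef_eqI)
  fix z :: complex assume z: "cmod z < 1"
  have eq: "(q gchoose n) * (- z) ^ n = (q gchoose n) * (-1) ^ n * z ^ n" for n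
    by (simp add: power_minus[of z])
  then show "(\<lambda>n. (q gchoose n) * (-1) ^ n * z ^ n) sums one_minus_power q z"
    using gen_binomial_complex[of "- z" q] z unfolding eq by (simp add: one_minus_power_def)
qed

lemma bw_asymptotic: "\<exists>C. \<forall>n\<ge>1. bw n \<le> C * real n powr (1 - s)"
proof -
  have "(- s) gchoose n = (-1) ^ n / bw n" for n
    unfolding gbinomial_pochhammer times_divide_eq_right[symmetric] minus_minus inverse_bw[symmetric]
    by simp
  then have eq: "((- s) gchoose n) / ((-1) ^ n / exp ((- s + 1) * of_real (ln (real n))))
      = exp ((1 - s) * ln (real n)) / bw n" for n by simp
  have "(\<lambda>n. exp ((1 - s) * ln (real n)) / bw n) \<longlonglongrightarrow> inverse (Gamma s)"
    using gbinomial_asymptotic[of "- s"] unfolding eq by simp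
  moreover have "inverse (Gamma s) \<noteq> 0" using Gamma_real_pos[OF s_pos] by simp
  ultimately have "(\<lambda>n. inverse (exp ((1 - s) * ln (real n)) / bw n)) \<longlonglongrightarrow> inverse (inverse (Gamma s))"
    by (rule tendsto_inverse)
  then have "Bseq (\<lambda>n. inverse (exp ((1 - s) * ln (real n)) / bw n))"
    by (intro convergent_imp_Bseq convergentI)
  then obtain C where C: "\<And>n. norm (inverse (exp ((1 - s) * ln (real n)) / bw n)) \<le> C" unfolding Bseq_def by blast
  have "bw n \<le> C * real n powr (1 - s)" if n: "n \<ge> 1" for n
    using C[of n] n by (simp add: powr_def divide_simps mult.commute)
  then show ?thesis by blast
qed

lemma gbinomial_bound: "\<exists>C\<ge>0. \<forall>n\<ge>1. cmod (q gchoose n) \<le> C * real n powr (- Re q - 1)"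
proof -
  have "Bseq (\<lambda>n. (q gchoose n) / ((-1) ^ n / exp ((q + 1) * of_real (ln (real n)))))"
    by (rule convergent_imp_Bseq[OF convergentI[OF gbinomial_asymptotic]])
  then obtain C where C0: "C > 0"
    and C: "\<And>n. cmod ((q gchoose n) / ((-1) ^ n / exp ((q + 1) * of_real (ln (real n))))) \<le> C"
    by (auto elim: BseqE)
  have "cmod (q gchoose n) \<le> C * real n powr (- Re q - 1)" if n: "n \<ge> 1" for n
  proof -
    have "cmod (q gchoose n) * real n powr (Re q + 1) \<le> C"
      using C[of n] n by (simp add: norm_divide norm_mult norm_power powr_def)
    then have "cmod (q gchoose n) \<le> C / real n powr (Re q + 1)"
      using n by (simp add: pos_le_divide_eq)
    also have "\<dots> = C * real n powr (- Re q - 1)"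
      using powr_minus_divide[of "real n" "Re q + 1"] by simp
    finally show ?thesis .
  qed
  then show ?thesis using C0 by (intro exI[of _ C]) auto
qed

text \<open>
  The binomial coefficients decay like \<open>n powr (- Re q - 1)\<close> and the weights like \<open>n powr (1 - s)\<close>, so the
  terms of the norm are at most of order \<open>n powr (- 1 - s - 2 * Re q)\<close>.
\<close>
lemma one_minus_power_closed:
  assumes q: "- s / 2 < Re q"
  shows "one_minus_power q \<in> car"
proof -
  obtain C where C: "\<And>n. n \<ge> 1 \<Longrightarrow> bw n \<le> C * real n powr (1 - s)" using bw_asymptotic by blast
  obtain K where K0: "K \<ge> 0" and K: "\<And>n. n \<ge> 1 \<Longrightarrow> cmod (q gchoose n) \<le> K * real n powr (- Re q - 1)"
    using gbinomial_bound by blast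
  have "summable (\<lambda>n. bw n * (cmod (coef (one_minus_power q) n))\<^sup>2)"
  proof (rule summable_comparison_test')
    show "summable (\<lambda>n. C * K\<^sup>2 * real n powr (- 1 - s - 2 * Re q))"
      using q by (intro summable_mult) (simp add: summable_real_powr_iff)
    fix n :: nat assume n: "n \<ge> 1"
    have "0 \<le> C * real n powr (1 - s)" using C[OF n] bw_nonneg[of n] by linarith
    then have "bw n * (cmod (coef (one_minus_power q) n))\<^sup>2 \<le> (C * real n powr (1 - s)) * (K * real n powr (- Re q - 1))\<^sup>2"
      using C[OF n] K[OF n] by (intro mult_mono power_mono) (auto simp: coef_one_minus_power norm_mult norm_power)
    also have "\<dots> = C * K\<^sup>2 * (real n powr (1 - s) * real n powr (- Re q - 1) * real n powr (- Re q - 1))"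
      by (simp add: power2_eq_square)
    also have "real n powr (1 - s) * real n powr (- Re q - 1) * real n powr (- Re q - 1)
        = real n powr (- 1 - s - 2 * Re q)"
    proof -
      have "(1 - s) + (- Re q - 1) + (- Re q - 1) = - 1 - s - 2 * Re q" by simp
      then show ?thesis by (simp only: powr_add[symmetric])
    qed
    finally show "norm (bw n * (cmod (coef (one_minus_power q) n))\<^sup>2) \<le> C * K\<^sup>2 * real n powr (- 1 - s - 2 * Re q)"
      by simp
  qed
  moreover have "(\<lambda>z. (1 - z) powr q) holomorphic_on ball 0 1"
  proof (intro holomorphic_intros)
    fix z :: complex assume "z \<in> ball 0 1"
    then have "0 < Re (1 - z)" by (intro Re_one_minus_pos) simp
    then show "1 - z \<notin> \<real>\<^sub>\<le>\<^sub>0" by (auto simp: complex_nonpos_Reals_iff)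
  qed
  then have "one_minus_power q holomorphic_on ball 0 1" by (rule holomorphic_transform) (simp add: one_minus_power_def)
  ultimately show ?thesis by (simp add: in_bergman one_minus_power_def)
qed

text \<open>
  The two affine maps with slopes \<open>1 / a\<close> and \<open>a\<close> are inverse to each other and preserve the line
  \<open>Re u = 1/2\<close>.
\<close>
lemma dilation_semigroup_affine_op:
  assumes a: "0 < a" "a < 1"
  shows "dilation_semigroup B (affine_op 1) (affine_op (1 / a) (- (1 - a) / (2 * a))) (affine_op a ((1 - a) / 2)) a (a powr (- s / 2))"
proof -
  have P: "half_plane_map 1 k" if "0 \<le> k" for k using that by (simp add: half_plane_map_def)
  have D: "half_plane_map (1 / a) (- (1 - a) / (2 * a))" using a by (simp add: half_plane_map_def field_simps)
  have E: "half_plane_map a ((1 - a) / 2)" using a by (simp add: half_plane_map_def field_simps)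
  show ?thesis
  proof (intro dilation_semigroup.intro prehilbert_axioms dilation_semigroup_axioms.intro a)
    show "0 < a powr (- s / 2)" using a by simp
    fix f assume f: "f \<in> car"
    show "affine_op (1 / a) (- (1 - a) / (2 * a)) (affine_op a ((1 - a) / 2) f) = f"
    proof -
      have "1 / a * a = 1" "a * (- (1 - a) / (2 * a)) + (1 - a) / 2 = 0" using a by (simp_all add: field_simps)
      then show ?thesis by (simp only: affine_op_affine_op[OF D E f] affine_op_1_0[OF f])
    qed
    show "affine_op a ((1 - a) / 2) (affine_op (1 / a) (- (1 - a) / (2 * a)) f) = f"
    proof -
      have "a * (1 / a) = 1" "1 / a * ((1 - a) / 2) + - (1 - a) / (2 * a) = 0" using a by (simp_all add: field_simps)
      then show ?thesis by (simp only: affine_op_affine_op[OF E D f] affine_op_1_0[OF f])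
    qed
    fix k :: real assume k: "0 \<le> k"
    show "affine_op (1 / a) (- (1 - a) / (2 * a)) (affine_op 1 k f) = affine_op 1 (a * k) (affine_op (1 / a) (- (1 - a) / (2 * a)) f)"
    proof -
      have ak: "0 \<le> a * k" using a k by simp
      have "1 / a * (a * k) = k" using a by simp
      then show ?thesis
        unfolding affine_op_affine_op[OF D P[OF k] f] affine_op_affine_op[OF P[OF ak] D f] by (simp add: add.commute)
    qed
    show "affine_op 1 k (affine_op 1 m f) = affine_op 1 (k + m) f" if "0 \<le> m" for m
      using affine_op_affine_op[OF P[OF k] P[OF that] f] by simp
  qed (fact affine_op_op[OF P] affine_op_contraction[OF P] affine_op_1_adjoint affine_op_1_injective affine_op_op[OF D] affine_op_op[OF E]
      affine_op_contraction[OF D] affine_op_contraction[OF E])+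
qed

end

section \<open>Iterated Aluthge transforms of the composition operator\<close>

theorem corollary2p3:
  fixes a \<alpha> :: real and \<phi> :: "complex \<Rightarrow> complex" and n :: nat
  assumes "0 < a" and "a < 1" and "\<alpha> > -1"
    and "\<phi> = (\<lambda>z. of_real a * z + (1 - of_real a))"
  shows "0 \<in> interior (numerical_range (bergman \<alpha>)
             (iterated_aluthge (bergman \<alpha>) n (composition_op \<alpha> \<phi>)))
    \<and> op_norm (bergman \<alpha>) (iterated_aluthge (bergman \<alpha>) n (composition_op \<alpha> \<phi>))
        = 1 / a powr ((\<alpha> + 2) / 2)
    \<and> normaloid (bergman \<alpha>) (iterated_aluthge (bergman \<alpha>) n (composition_op \<alpha> \<phi>))
    \<and> spectraloid (bergman \<alpha>) (iterated_aluthge (bergman \<alpha>) n (composition_op \<alpha> \<phi>))"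
proof -
  interpret bergman_space \<alpha> using assms(3) by unfold_locales
  let ?g = "(1 - a) / 2"
  define d c where "d = - (1 - a) / (2 * a)" and "c = a powr (- s / 2)"
  interpret W: dilation_semigroup B "affine_op 1" "affine_op (1 / a) d" "affine_op a ?g" a c
    unfolding d_def c_def by (rule dilation_semigroup_affine_op[OF assms(1,2)])
  have g: "0 \<le> ?g" using assms by simp
  have Cphi: "composition_op \<alpha> \<phi> = W.T ?g"
  proof (rule extensionalityI)
    show "composition_op \<alpha> \<phi> \<in> extensional car" "W.T ?g \<in> extensional car"
      unfolding composition_op_def W.T_def by (rule restrict_extensional)+
    fix f assume f: "f \<in> car"
    have P: "half_plane_map 1 ?g" using g by (simp add: half_plane_map_def)
    have D: "half_plane_map (1 / a) d" using assms by (simp add: d_def half_plane_map_def field_simps)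
    \<comment> \<open>Scaled by \<open>1 / a\<close>, the translation by \<open>(1 - a) / 2\<close> cancels the constant term of the affine map of \<open>D\<close>, and the pure
      dilation \<open>u \<mapsto> u / a\<close> remains.\<close>
    have "1 / a * ?g + d = 0" using assms by (simp add: d_def field_simps)
    then have T: "W.T ?g f = of_real c *\<^sub>c affine_comp (1 / a) 0 f"
      using affine_op_affine_op[OF P D f] f by (simp add: W.T_eq affine_op_eq)
    show "composition_op \<alpha> \<phi> f = W.T ?g f"
    proof
      fix z
      show "composition_op \<alpha> \<phi> f z = W.T ?g f z"
      proof (cases "cmod z < 1")
        case True
        define u where "u = 1 / (1 - z)"
        have u: "u \<noteq> 0" using True by (auto simp: u_def)
        have z: "1 - 1 / (of_real (1 / a) * u) = of_real a * z + (1 - of_real a)"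
          using u assms by (simp add: u_def algebra_simps)
        have "affine_comp (1 / a) 0 f z = of_real ((1 / a) powr (s / 2)) * u powr of_real s *
            ((of_real (1 / a) * u) powr (- of_real s) * f (of_real a * z + (1 - of_real a)))"
          unfolding z[symmetric] using True by (simp add: affine_comp_def transform_def u_def)
        also have "(of_real (1 / a) * u) powr (- of_real s) = of_real ((1 / a) powr (- s)) * u powr (- of_real s)"
          using powr_of_real_mult[of "1 / a" u "- s"] assms by simp
        finally have "W.T ?g f z = of_real (c * (1 / a) powr (s / 2) * (1 / a) powr (- s)) *
            (u powr of_real s * u powr (- of_real s)) * f (\<phi> z)"
          by (simp add: T scl_def assms(4) mult_ac)
        also have "u powr of_real s * u powr (- of_real s) = 1"
          using u by (subst powr_add[symmetric]) simp
        also have "c * (1 / a) powr (s / 2) * (1 / a) powr (- s) = 1"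
          using assms by (simp add: c_def powr_divide powr_minus_divide powr_add[symmetric])
        finally show ?thesis using f True by (simp add: composition_op_def)
      next
        case False
        then show ?thesis using f by (simp add: composition_op_def T scl_def affine_comp_def)
      qed
    qed
  qed
  let ?T = "iterated_aluthge B n (composition_op \<alpha> \<phi>)"
  have eig: "\<exists>f\<in>car. f \<noteq> 0 \<and> ?T f = l *\<^sub>c f" if l: "l \<noteq> 0" "cmod l < c" for l
  proof -
    \<comment> \<open>The exponent with \<open>a powr q = l\<close>. Since \<open>ln a < 0\<close>, the bound on \<open>\<bar>l\<bar>\<close> says that \<open>Re q > - s / 2\<close>.\<close>
    define q where "q = Ln l / of_real (ln a)"
    have lna: "ln a < 0" using assms by simp
    have "ln (cmod l) < ln c" using l W.c0 by (subst ln_less_cancel_iff) auto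
    also have "ln c = - s / 2 * ln a" using assms by (simp add: c_def ln_powr)
    finally have "ln (cmod l) < - s / 2 * ln a" .
    then have "- s / 2 < ln (cmod l) / ln a" using lna by (simp add: neg_less_divide_eq)
    then have q: "- s / 2 < Re q" using l by (simp add: q_def)
    note f = one_minus_power_closed[OF q]
    have aq: "complex_of_real a powr q = l"
      using l assms lna by (simp add: powr_def q_def Ln_of_real)
    have "W.T ?g (one_minus_power q) = l *\<^sub>c one_minus_power q"
    proof
      fix z
      have "cmod (\<phi> z) < 1" if "cmod z < 1"
      proof -
        have "cmod (\<phi> z) \<le> cmod (of_real a * z) + cmod (of_real (1 - a))"
          unfolding assms(4) using norm_triangle_ineq[of "of_real a * z" "of_real (1 - a)"] by simp
        also have "\<dots> = a * cmod z + (1 - a)" using assms by (simp add: norm_mult del: of_real_diff)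
        also have "\<dots> < a * 1 + (1 - a)" using that assms by (intro add_strict_right_mono mult_strict_left_mono) auto
        finally show ?thesis by simp
      qed
      moreover have "1 - \<phi> z = of_real a * (1 - z)" by (simp add: assms(4) algebra_simps)
      moreover have "(of_real a * (1 - z)) powr q = l * (1 - z) powr q"
        unfolding aq[symmetric] using assms by (intro powr_times_real_left) auto
      ultimately show "W.T ?g (one_minus_power q) z = (l *\<^sub>c one_minus_power q) z"
        using f unfolding Cphi[symmetric] by (simp add: composition_op_def one_minus_power_def scl_def)
    qed
    moreover have "one_minus_power q \<noteq> 0"
    proof
      assume "one_minus_power q = 0"
      then have "one_minus_power q 0 = 0" by (simp only: zero_fun_apply)
      then show False by (simp add: one_minus_power_def)
    qed
    ultimately show ?thesis
      unfolding Cphi using W.iterated_aluthge_eigenvector[OF f] by blast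
  qed
  define k where "k = ?g * ((1 + a) / (2 * a)) ^ n"
  have k: "0 \<le> k" using g assms by (simp add: k_def)
  have T: "?T = W.T k" unfolding Cphi k_def by (rule W.iterated_aluthge_T[OF g])
  have c: "c = 1 / a powr ((\<alpha> + 2) / 2)"
  proof -
    have e: "- s / 2 = - ((\<alpha> + 2) / 2)" unfolding s_def by linarith
    show ?thesis unfolding c_def e by (rule powr_minus_divide)
  qed
  have "0 \<in> interior (numerical_range B ?T)" "op_norm B ?T = c" "normaloid B ?T" "spectraloid B ?T"
    using disc_of_eigenvalues[of ?T c] W.T_op[OF k] W.T_bound[OF k] W.c0 eig unfolding T by blast+
  then show ?thesis unfolding c by blast
qed

end
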